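(* Let $R$ be a graded-commutative noetherian ring and $\mathsf T$ a compactly generated $R$-linear triangulated category with arbitrary coproducts. Set $\mathcal V=\operatorname{supp}_R\mathsf T$. Consider the maps $$\sigma(\mathsf S)=(\mathsf S\cap\varGamma_{\mathfrak p}\mathsf T)_{\mathfrak p\in\mathcal V},\qquad\tau\bigl((\mathsf S(\mathfrak p))_{\mathfrak p\in\mathcal V}\bigr)=\operatorname{Loc}_{\mathsf T}\bigl(\mathsf S(\mathfrak p)\mid\mathfrak p\in\mathcal V\bigr),$$ where $\sigma$ goes from localizing subcategories of $\mathsf T$ to families $(\mathsf S(\mathfrak p))_{\mathfrak p\in\mathcal V}$ with $\mathsf S(\mathfrak p)$ a localizing subcategory of $\varGamma_{\mathfrak p}\mathsf T$, and $\tau$ goes in the opposite direction. The following conditions are equivalent. (1) The local-global principle holds for $\mathsf T$. (2) The map $\sigma$ is bijective, with inverse $\tau$. (3) The map $\sigma$ is one-to-one.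
   Context: Graded-commutative: $R$ is $\mathbb Z$-graded with $rs=(-1)^{|r||s|}sr$ for homogeneous $r,s$. $\operatorname{Spec}R$ is the set of homogeneous prime ideals; $\mathcal V(\mathfrak a)=\{\mathfrak p\in\operatorname{Spec}R\mid\mathfrak p\supseteq\mathfrak a\}$ for a homogeneous ideal $\mathfrak a$. $R$-modules are graded and $M_{\mathfrak p}$ is homogeneous localization. A subset $\mathcal W\subseteq\operatorname{Spec}R$ is specialization closed if $\mathfrak p\in\mathcal W$, $\mathfrak p\subseteq\mathfrak q$ imply $\mathfrak q\in\mathcal W$. $\mathsf T$ has suspension $\Sigma$. A localizing subcategory is a full triangulated subcategory closed under coproducts; $\operatorname{Loc}_{\mathsf T}(\mathsf C)$ is the smallest one containing $\mathsf C$. An object $C$ is compact if $\operatorname{Hom}_{\mathsf T}(C,-)$ commutes with coproducts; $\mathsf T^c$ is the full subcategory of compact objects. $\mathsf T$ is compactly generated if $\mathsf T=\operatorname{Loc}_{\mathsf T}(\mathsf G)$ for a set $\mathsf G$ of compact objects. $\mathsf T$ is $R$-linear if there is given a homomorphism of graded rings $R\to Z^*(\mathsf T)$ to the graded center ($Z^n(\mathsf T)$ consists of natural transformations $\eta\colon\mathrm{Id}\to\Sigma^n$ with $\eta\Sigma=(-1)^n\Sigma\eta$); then $\operatorname{Hom}^*_{\mathsf T}(X,Y)=\bigoplus_i\operatorname{Hom}_{\mathsf T}(X,\Sigma^iY)$ is a graded $R$-module. For specialization closed $\mathcal W$, let $\mathsf T_{\mathcal W}=\{X\in\mathsf T\mid\operatorname{Hom}^*_{\mathsf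 T}(C,X)_{\mathfrak p}=0\text{ for all }C\in\mathsf T^c,\ \mathfrak p\in\operatorname{Spec}R\setminus\mathcal W\}$. This is a localizing subcategory and there is a localization functor $L_{\mathcal W}\colon\mathsf T\to\mathsf T$ with $\operatorname{Ker}L_{\mathcal W}=\mathsf T_{\mathcal W}$, giving functorial exact triangles $\varGamma_{\mathcal W}X\to X\to L_{\mathcal W}X\to$ with $\varGamma_{\mathcal W}X\in\mathsf T_{\mathcal W}$ and $\operatorname{Hom}_{\mathsf T}(\mathsf T_{\mathcal W},L_{\mathcal W}X)=0$. For $\mathfrak p\in\operatorname{Spec}R$ put $\mathcal Z(\mathfrak p)=\{\mathfrak q\in\operatorname{Spec}R\mid\mathfrak q\not\subseteq\mathfrak p\}$, $X_{\mathfrak p}=L_{\mathcal Z(\mathfrak p)}X$, $\varGamma_{\mathfrak p}X=\varGamma_{\mathcal V(\mathfrak p)}(X_{\mathfrak p})$. $\varGamma_{\mathfrak p}\mathsf T$ is the essential image of $\varGamma_{\mathfrak p}$, a localizing subcategory of $\mathsf T$. The support of $X$ is $\operatorname{supp}_RX=\{\mathfrak p\in\operatorname{Spec}R\mid\varGamma_{\mathfrak p}X\neq0\}$, and $\operatorname{supp}_R\mathsf T=\bigcup_{X\in\mathsf T}\operatorname{supp}_RX$. The local-global principle holds for $\mathsf T$ if $\operatorname{Loc}_{\mathsf T}(X)=\operatorname{Loc}_{\mathsf T}(\{\varGamma_{\mathfrak p}X\mid\mathfrak p\in\operatorname{Spec}R\})$ for every object $X$ of $\mathsf T$. *)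

theory Defs
  imports "HOL-Algebra.Ring_Divisibility" "HOL-Algebra.Free_Abelian_Groups"
begin

unbundle cardinal_syntax

section \<open>Graded rings, homogeneous primes, homogeneous localization\<close>

record 'r graded_ring = "'r ring" +
  hpart :: "int \<Rightarrow> 'r set"

locale graded_ring = ring R for R :: "('r, 'y) graded_ring_scheme" (structure) +
  assumes hpart_subgroup: "additive_subgroup (hpart R n) R"
    and one_hpart: "\<one> \<in> hpart R 0"
    and mult_hpart: "r \<in> hpart R m \<Longrightarrow> s \<in> hpart R n \<Longrightarrow> r \<otimes> s \<in> hpart R (m + n)"
    and direct_sum:
      "bij_betw (\<lambda>c. gfinprod (add_monoid R) c UNIV)
         (carrier (sum_group UNIV (\<lambda>n. (add_monoid R)\<lparr>carrier := hpart R n\<rparr>)))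
         (carrier R)"

locale graded_commutative_ring = graded_ring +
  assumes graded_comm:
    "r \<in> hpart R m \<Longrightarrow> s \<in> hpart R n \<Longrightarrow>
       r \<otimes> s = (if even (m * n) then s \<otimes> r else \<ominus> (s \<otimes> r))"

definition homogeneous :: "('r, 'x) graded_ring_scheme \<Rightarrow> 'r set" where
  "homogeneous R = (\<Union>n. hpart R n)"

definition homogeneous_ideal :: "'r set \<Rightarrow> ('r, 'x) graded_ring_scheme \<Rightarrow> bool" where
  "homogeneous_ideal I R \<longleftrightarrow> ideal I R \<and> I = genideal R (I \<inter> homogeneous R)"

definition Spec :: "('r, 'x) graded_ring_scheme \<Rightarrow> 'r set set" where
  "Spec R = {\<pp>. homogeneous_ideal \<pp> R \<and> \<pp> \<noteq> carrier R \<and>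
     (\<forall>a\<in>homogeneous R. \<forall>b\<in>homogeneous R. a \<otimes>\<^bsub>R\<^esub> b \<in> \<pp> \<longrightarrow> a \<in> \<pp> \<or> b \<in> \<pp>)}"

definition V_closed :: "('r, 'x) graded_ring_scheme \<Rightarrow> 'r set \<Rightarrow> 'r set set" where
  "V_closed R \<aa> = {\<pp> \<in> Spec R. \<aa> \<subseteq> \<pp>}"

definition Z_set :: "('r, 'x) graded_ring_scheme \<Rightarrow> 'r set \<Rightarrow> 'r set set" where
  "Z_set R \<pp> = {\<qq> \<in> Spec R. \<not> \<qq> \<subseteq> \<pp>}"

text \<open>
  The summand of degree \<open>i\<close> of a graded module is \<open>gpart M i\<close>, an abelian group in
  multiplicative notation; \<open>gsmult M n r i m\<close> is the product of a homogeneous scalar \<open>r\<close>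
  of degree \<open>n\<close> with an element \<open>m\<close> of degree \<open>i\<close>.
\<close>

record ('r, 'm) graded_module =
  gpart :: "int \<Rightarrow> 'm monoid"
  gsmult :: "int \<Rightarrow> 'r \<Rightarrow> int \<Rightarrow> 'm \<Rightarrow> 'm"

text \<open>
  Homogeneous localization at \<open>\<pp>\<close>, piece of degree \<open>d\<close>.  A triple \<open>(n, s, m)\<close> represents
  the left fraction \<open>s\<inverse>m\<close>, where \<open>s\<close> has degree \<open>n\<close> and \<open>m\<close> has degree \<open>d + n\<close>.  Two
  fractions are identified if they can be expanded to a common one (the Ore relation);
  in this form no Koszul signs occur.
\<close>

definition fractions ::
  "('r, 'x) graded_ring_scheme \<Rightarrow> ('r, 'm) graded_module \<Rightarrow> 'r set \<Rightarrow> int \<Rightarrow> (int \<times> 'r \<times> 'm) set"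
  where
  "fractions R M \<pp> d =
     {(n, s, m). s \<in> hpart R n \<and> s \<notin> \<pp> \<and> m \<in> carrier (gpart M (d + n))}"

definition fraction_rel ::
  "('r, 'x) graded_ring_scheme \<Rightarrow> ('r, 'm) graded_module \<Rightarrow> 'r set \<Rightarrow> int \<Rightarrow>
   ((int \<times> 'r \<times> 'm) \<times> (int \<times> 'r \<times> 'm)) set" where
  "fraction_rel R M \<pp> d =
     {((n, s, m), (n', s', m')).
        (n, s, m) \<in> fractions R M \<pp> d \<and> (n', s', m') \<in> fractions R M \<pp> d \<and>
        (\<exists>k k' a a'. a \<in> hpart R k \<and> a' \<in> hpart R k' \<and> k + n = k' + n' \<and>
           a \<otimes>\<^bsub>R\<^esub> s = a' \<otimes>\<^bsub>R\<^esub> s' \<and> a \<otimes>\<^bsub>R\<^esub> s \<notin> \<pp> \<and>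
           gsmult M k a (d + n) m = gsmult M k' a' (d + n') m')}"

definition localization ::
  "('r, 'x) graded_ring_scheme \<Rightarrow> ('r, 'm) graded_module \<Rightarrow> 'r set \<Rightarrow> int \<Rightarrow>
   (int \<times> 'r \<times> 'm) set set" where
  "localization R M \<pp> d = fractions R M \<pp> d // fraction_rel R M \<pp> d"

definition localization_is_zero ::
  "('r, 'x) graded_ring_scheme \<Rightarrow> ('r, 'm) graded_module \<Rightarrow> 'r set \<Rightarrow> bool" where
  "localization_is_zero R M \<pp> \<longleftrightarrow>
     (\<forall>d. localization R M \<pp> d = {fraction_rel R M \<pp> d `` {(0, \<one>\<^bsub>R\<^esub>, \<one>\<^bsub>gpart M d\<^esub>)}})"

section \<open>Triangulated categories\<close>

text \<open>
  The suspension is an automorphism of the category, so that all powers \<open>\<Sigma>\<^sup>n\<close> for integers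
  \<open>n\<close> are strictly defined.  A triangle \<open>X \<rightarrow> Y \<rightarrow> Z \<rightarrow> \<Sigma>X\<close> is given by its three arrows.
\<close>

record ('o, 'a) tricat =
  obj :: "'o set"
  arr :: "'a set"
  src :: "'a \<Rightarrow> 'o"
  tgt :: "'a \<Rightarrow> 'o"
  idt :: "'o \<Rightarrow> 'a"
  cmp :: "'a \<Rightarrow> 'a \<Rightarrow> 'a"  (infixl \<open>\<cdot>\<index>\<close> 70)
  aadd :: "'a \<Rightarrow> 'a \<Rightarrow> 'a"
  azero :: "'o \<Rightarrow> 'o \<Rightarrow> 'a"
  susp_obj :: "'o \<Rightarrow> 'o"
  susp_arr :: "'a \<Rightarrow> 'a"
  tri :: "('a \<times> 'a \<times> 'a) set"

definition Mor :: "('o, 'a, 'x) tricat_scheme \<Rightarrow> 'o \<Rightarrow> 'o \<Rightarrow> 'a set" where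
  "Mor T X Y = {f \<in> arr T. src T f = X \<and> tgt T f = Y}"

definition mor_group :: "('o, 'a, 'x) tricat_scheme \<Rightarrow> 'o \<Rightarrow> 'o \<Rightarrow> 'a monoid" where
  "mor_group T X Y = \<lparr>carrier = Mor T X Y, mult = aadd T, one = azero T X Y\<rparr>"

definition aneg :: "('o, 'a, 'x) tricat_scheme \<Rightarrow> 'a \<Rightarrow> 'a" where
  "aneg T f = inv\<^bsub>mor_group T (src T f) (tgt T f)\<^esub> f"

definition is_zero_obj :: "('o, 'a, 'x) tricat_scheme \<Rightarrow> 'o \<Rightarrow> bool" where
  "is_zero_obj T Z \<longleftrightarrow> Z \<in> obj T \<and>
     (\<forall>Y\<in>obj T. (\<exists>!f. f \<in> Mor T Z Y) \<and> (\<exists>!f. f \<in> Mor T Y Z))"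

definition is_iso :: "('o, 'a, 'x) tricat_scheme \<Rightarrow> 'a \<Rightarrow> bool" where
  "is_iso T f \<longleftrightarrow> f \<in> arr T \<and>
     (\<exists>g\<in>Mor T (tgt T f) (src T f).
        g \<cdot>\<^bsub>T\<^esub> f = idt T (src T f) \<and> f \<cdot>\<^bsub>T\<^esub> g = idt T (tgt T f))"

definition isomorphic :: "('o, 'a, 'x) tricat_scheme \<Rightarrow> 'o \<Rightarrow> 'o \<Rightarrow> bool" where
  "isomorphic T X Y \<longleftrightarrow> (\<exists>f\<in>Mor T X Y. is_iso T f)"

definition is_coproduct ::
  "('o, 'a, 'x) tricat_scheme \<Rightarrow> 'i set \<Rightarrow> ('i \<Rightarrow> 'o) \<Rightarrow> 'o \<Rightarrow> ('i \<Rightarrow> 'a) \<Rightarrow> bool" where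
  "is_coproduct T I X C \<iota> \<longleftrightarrow> C \<in> obj T \<and> (\<forall>i\<in>I. \<iota> i \<in> Mor T (X i) C) \<and>
     (\<forall>Y\<in>obj T. \<forall>f. (\<forall>i\<in>I. f i \<in> Mor T (X i) Y) \<longrightarrow>
        (\<exists>!u. u \<in> Mor T C Y \<and> (\<forall>i\<in>I. u \<cdot>\<^bsub>T\<^esub> \<iota> i = f i)))"

locale preadditive_cat =
  fixes T :: "('o, 'a, 'x) tricat_scheme" (structure)
  assumes src_obj: "f \<in> arr T \<Longrightarrow> src T f \<in> obj T"
    and tgt_obj: "f \<in> arr T \<Longrightarrow> tgt T f \<in> obj T"
    and idt_mor: "X \<in> obj T \<Longrightarrow> idt T X \<in> Mor T X X"
    and cmp_mor: "f \<in> Mor T X Y \<Longrightarrow> g \<in> Mor T Y Z \<Longrightarrow> g \<cdot> f \<in> Mor T X Z"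
    and cmp_idt: "f \<in> Mor T X Y \<Longrightarrow> f \<cdot> idt T X = f"
    and idt_cmp: "f \<in> Mor T X Y \<Longrightarrow> idt T Y \<cdot> f = f"
    and cmp_assoc: "f \<in> Mor T W X \<Longrightarrow> g \<in> Mor T X Y \<Longrightarrow> h \<in> Mor T Y Z \<Longrightarrow>
          (h \<cdot> g) \<cdot> f = h \<cdot> (g \<cdot> f)"
    and mor_comm_group: "X \<in> obj T \<Longrightarrow> Y \<in> obj T \<Longrightarrow> comm_group (mor_group T X Y)"
    and cmp_aadd: "f \<in> Mor T X Y \<Longrightarrow> f' \<in> Mor T X Y \<Longrightarrow> g \<in> Mor T Y Z \<Longrightarrow>
          g \<cdot> aadd T f f' = aadd T (g \<cdot> f) (g \<cdot> f')"
    and aadd_cmp: "f \<in> Mor T X Y \<Longrightarrow> g \<in> Mor T Y Z \<Longrightarrow> g' \<in> Mor T Y Z \<Longrightarrow>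
          aadd T g g' \<cdot> f = aadd T (g \<cdot> f) (g' \<cdot> f)"

locale additive_cat = preadditive_cat +
  assumes ex_zero_obj: "\<exists>Z. is_zero_obj T Z"
    and ex_binary_coproduct: "X \<in> obj T \<Longrightarrow> Y \<in> obj T \<Longrightarrow>
          \<exists>C \<iota>. is_coproduct T (UNIV :: bool set) (\<lambda>b. if b then X else Y) C \<iota>"

locale triangulated_cat = additive_cat +
  assumes susp_obj_bij: "bij_betw (susp_obj T) (obj T) (obj T)"
    and susp_arr_bij: "X \<in> obj T \<Longrightarrow> Y \<in> obj T \<Longrightarrow>
          bij_betw (susp_arr T) (Mor T X Y) (Mor T (susp_obj T X) (susp_obj T Y))"
    and susp_idt: "X \<in> obj T \<Longrightarrow> susp_arr T (idt T X) = idt T (susp_obj T X)"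
    and susp_cmp: "f \<in> Mor T X Y \<Longrightarrow> g \<in> Mor T Y Z \<Longrightarrow>
          susp_arr T (g \<cdot> f) = susp_arr T g \<cdot> susp_arr T f"
    and susp_aadd: "f \<in> Mor T X Y \<Longrightarrow> g \<in> Mor T X Y \<Longrightarrow>
          susp_arr T (aadd T f g) = aadd T (susp_arr T f) (susp_arr T g)"
    and tri_mor: "(f, g, h) \<in> tri T \<Longrightarrow>
          \<exists>X Y Z. f \<in> Mor T X Y \<and> g \<in> Mor T Y Z \<and> h \<in> Mor T Z (susp_obj T X)"
    and TR1_iso: "\<lbrakk>(f, g, h) \<in> tri T;
          f \<in> Mor T X Y; g \<in> Mor T Y Z; h \<in> Mor T Z (susp_obj T X);
          f' \<in> Mor T X' Y'; g' \<in> Mor T Y' Z'; h' \<in> Mor T Z' (susp_obj T X');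
          a \<in> Mor T X X'; b \<in> Mor T Y Y'; c \<in> Mor T Z Z';
          is_iso T a; is_iso T b; is_iso T c;
          b \<cdot> f = f' \<cdot> a; c \<cdot> g = g' \<cdot> b; susp_arr T a \<cdot> h = h' \<cdot> c\<rbrakk> \<Longrightarrow>
          (f', g', h') \<in> tri T"
    and TR1_idt: "X \<in> obj T \<Longrightarrow> is_zero_obj T Z \<Longrightarrow>
          (idt T X, azero T X Z, azero T Z (susp_obj T X)) \<in> tri T"
    and TR1_cone: "f \<in> arr T \<Longrightarrow> \<exists>g h. (f, g, h) \<in> tri T"
    and TR2: "\<lbrakk>f \<in> Mor T X Y; g \<in> Mor T Y Z; h \<in> Mor T Z (susp_obj T X)\<rbrakk> \<Longrightarrow>
          (f, g, h) \<in> tri T \<longleftrightarrow> (g, h, aneg T (susp_arr T f)) \<in> tri T"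
    and TR3: "\<lbrakk>(f, g, h) \<in> tri T; (f', g', h') \<in> tri T;
          a \<in> Mor T (src T f) (src T f'); b \<in> Mor T (tgt T f) (tgt T f'); b \<cdot> f = f' \<cdot> a\<rbrakk> \<Longrightarrow>
          \<exists>c\<in>Mor T (tgt T g) (tgt T g'). c \<cdot> g = g' \<cdot> b \<and> susp_arr T a \<cdot> h = h' \<cdot> c"
    and TR4: "\<lbrakk>f \<in> Mor T X Y; g \<in> Mor T Y Z;
          (f, u, u') \<in> tri T; (g, v, v') \<in> tri T; (g \<cdot> f, w, w') \<in> tri T\<rbrakk> \<Longrightarrow>
          \<exists>j k. j \<in> Mor T (tgt T u) (tgt T w) \<and> k \<in> Mor T (tgt T w) (tgt T v) \<and>
            (j, k, susp_arr T u \<cdot> v') \<in> tri T \<and>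
            w \<cdot> g = j \<cdot> u \<and> u' = w' \<cdot> j \<and> k \<cdot> w = v \<and> v' \<cdot> k = susp_arr T f \<cdot> w'"

definition arr_pow :: "('o, 'a, 'x) tricat_scheme \<Rightarrow> int \<Rightarrow> 'a \<Rightarrow> 'a" where
  "arr_pow T n = (if 0 \<le> n then susp_arr T ^^ nat n
                  else inv_into (arr T) (susp_arr T) ^^ nat (- n))"

definition obj_pow :: "('o, 'a, 'x) tricat_scheme \<Rightarrow> int \<Rightarrow> 'o \<Rightarrow> 'o" where
  "obj_pow T n = (if 0 \<le> n then susp_obj T ^^ nat n
                  else inv_into (obj T) (susp_obj T) ^^ nat (- n))"

section \<open>Coproducts, compact objects, localizing subcategories\<close>

text \<open>
  Size conventions.  ``Small'' means of cardinality less than \<open>\<kappa>\<close>, where \<open>\<kappa>\<close> is an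
  uncountable regular cardinal; for an inaccessible \<open>\<kappa>\<close> this is smallness with respect to
  a Grothendieck universe.  Small families are indexed by sets \<open>I\<close> of elements of the type
  on which \<open>\<kappa>\<close> lives, which is no restriction up to reindexing.  Local smallness is
  required only for arrows out of compact objects (see \<open>compactly_generated_cat\<close>), which is
  weaker than smallness of all sets of arrows: the latter would force \<open>\<kappa>\<close> to be a strong
  limit as soon as there is a nonzero object.
\<close>

definition size_bound :: "'i rel \<Rightarrow> bool" where
  "size_bound \<kappa> \<longleftrightarrow> Card_order \<kappa> \<and> natLeq <o \<kappa> \<and> regularCard \<kappa>"

definition has_coproducts :: "'i rel \<Rightarrow> ('o, 'a, 'x) tricat_scheme \<Rightarrow> bool" where
  "has_coproducts \<kappa> T \<longleftrightarrow>
     (\<forall>(I :: 'i set) X. |I| <o \<kappa> \<longrightarrow> X ` I \<subseteq> obj T \<longrightarrow> (\<exists>C \<iota>. is_coproduct T I X C \<iota>))"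

text \<open>
  \<open>C\<close> is compact if the canonical map \<open>\<Oplus>\<^sub>i Hom(C, X\<^sub>i) \<rightarrow> Hom(C, \<Coprod>\<^sub>i X\<^sub>i)\<close> is bijective.
\<close>

definition compact_obj :: "'i rel \<Rightarrow> ('o, 'a, 'x) tricat_scheme \<Rightarrow> 'o \<Rightarrow> bool" where
  "compact_obj \<kappa> T C \<longleftrightarrow> C \<in> obj T \<and>
     (\<forall>(I :: 'i set) X S \<iota>. |I| <o \<kappa> \<longrightarrow> X ` I \<subseteq> obj T \<longrightarrow> is_coproduct T I X S \<iota> \<longrightarrow>
        bij_betw (\<lambda>f. gfinprod (mor_group T C S) (\<lambda>i. \<iota> i \<cdot>\<^bsub>T\<^esub> f i) I)
          (carrier (sum_group I (\<lambda>i. mor_group T C (X i)))) (Mor T C S))"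

text \<open>Full subcategories are represented by their sets of objects.\<close>

definition triangulated_subcat :: "('o, 'a, 'x) tricat_scheme \<Rightarrow> 'o set \<Rightarrow> bool" where
  "triangulated_subcat T S \<longleftrightarrow> S \<subseteq> obj T \<and> S \<noteq> {} \<and>
     (\<forall>X\<in>S. \<forall>Y\<in>obj T. isomorphic T X Y \<longrightarrow> Y \<in> S) \<and>
     (\<forall>X\<in>obj T. X \<in> S \<longleftrightarrow> susp_obj T X \<in> S) \<and>
     (\<forall>(f, g, h)\<in>tri T. src T f \<in> S \<longrightarrow> tgt T f \<in> S \<longrightarrow> tgt T g \<in> S)"

definition localizing :: "'i rel \<Rightarrow> ('o, 'a, 'x) tricat_scheme \<Rightarrow> 'o set \<Rightarrow> bool" where
  "localizing \<kappa> T S \<longleftrightarrow> triangulated_subcat T S \<and>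
     (\<forall>(I :: 'i set) X C \<iota>. |I| <o \<kappa> \<longrightarrow> X ` I \<subseteq> S \<longrightarrow> is_coproduct T I X C \<iota> \<longrightarrow> C \<in> S)"

definition Loc :: "'i rel \<Rightarrow> ('o, 'a, 'x) tricat_scheme \<Rightarrow> 'o set \<Rightarrow> 'o set" where
  "Loc \<kappa> T A = \<Inter>{S. localizing \<kappa> T S \<and> A \<subseteq> S}"

locale compactly_generated_cat = triangulated_cat T
  for \<kappa> :: "'i rel" and T :: "('o, 'a, 'x) tricat_scheme" (structure) +
  assumes size_bound: "size_bound \<kappa>"
    and coproducts: "has_coproducts \<kappa> T"
    and small_mor: "compact_obj \<kappa> T C \<Longrightarrow> X \<in> obj T \<Longrightarrow> |Mor T C X| <o \<kappa>"
    and compactly_generated: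
      "\<exists>G. G \<subseteq> {C. compact_obj \<kappa> T C} \<and> |G| <o \<kappa> \<and> Loc \<kappa> T G = obj T"

section \<open>The graded center and linear structures\<close>

definition center :: "('o, 'a, 'x) tricat_scheme \<Rightarrow> int \<Rightarrow> ('o \<Rightarrow> 'a) set" where
  "center T n = {\<eta>.
     (\<forall>X\<in>obj T. \<eta> X \<in> Mor T X (obj_pow T n X)) \<and>
     (\<forall>X Y. \<forall>f\<in>Mor T X Y. arr_pow T n f \<cdot>\<^bsub>T\<^esub> \<eta> X = \<eta> Y \<cdot>\<^bsub>T\<^esub> f) \<and>
     (\<forall>X\<in>obj T. \<eta> (susp_obj T X) =
        (if even n then susp_arr T (\<eta> X) else aneg T (susp_arr T (\<eta> X))))}"

text \<open>
  A homomorphism of graded rings from \<open>R\<close> to the graded center is given by its components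
  \<open>\<phi> n\<close> of degree \<open>n\<close>.  The product of \<open>\<eta>\<close> and \<open>\<theta>\<close> of degree \<open>n\<close> in the graded center
  is \<open>\<Sigma>\<^sup>n \<eta> \<cdot> \<theta>\<close>.
\<close>

locale linear_structure = triangulated_cat T + graded_ring R
  for T :: "('o, 'a, 'x) tricat_scheme" (structure) and R :: "('r, 'y) graded_ring_scheme" +
  fixes \<phi> :: "int \<Rightarrow> 'r \<Rightarrow> 'o \<Rightarrow> 'a"
  assumes phi_center: "r \<in> hpart R n \<Longrightarrow> \<phi> n r \<in> center T n"
    and phi_add: "r \<in> hpart R n \<Longrightarrow> s \<in> hpart R n \<Longrightarrow> X \<in> obj T \<Longrightarrow>
          \<phi> n (r \<oplus>\<^bsub>R\<^esub> s) X = aadd T (\<phi> n r X) (\<phi> n s X)"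
    and phi_mult: "r \<in> hpart R m \<Longrightarrow> s \<in> hpart R n \<Longrightarrow> X \<in> obj T \<Longrightarrow>
          \<phi> (m + n) (r \<otimes>\<^bsub>R\<^esub> s) X = arr_pow T n (\<phi> m r X) \<cdot>\<^bsub>T\<^esub> \<phi> n s X"
    and phi_one: "X \<in> obj T \<Longrightarrow> \<phi> 0 \<one>\<^bsub>R\<^esub> X = idt T X"

text \<open>The graded module \<open>Hom\<^sup>*(X, Y)\<close>; scalars act through the target \<open>Y\<close>.\<close>

definition graded_hom ::
  "('o, 'a, 'x) tricat_scheme \<Rightarrow> (int \<Rightarrow> 'r \<Rightarrow> 'o \<Rightarrow> 'a) \<Rightarrow> 'o \<Rightarrow> 'o \<Rightarrow> ('r, 'a) graded_module"
  where
  "graded_hom T \<phi> X Y =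
     \<lparr>gpart = (\<lambda>i. mor_group T X (obj_pow T i Y)),
      gsmult = (\<lambda>n r i f. arr_pow T i (\<phi> n r Y) \<cdot>\<^bsub>T\<^esub> f)\<rparr>"

section \<open>Local cohomology, support, local-global principle\<close>

context
  fixes \<kappa> :: "'i rel"
    and T :: "('o, 'a, 'x) tricat_scheme"
    and R :: "('r, 'y) graded_ring_scheme"
    and \<phi> :: "int \<Rightarrow> 'r \<Rightarrow> 'o \<Rightarrow> 'a"
begin

definition torsion_subcat :: "'r set set \<Rightarrow> 'o set" where
  "torsion_subcat W = {X \<in> obj T. \<forall>C. compact_obj \<kappa> T C \<longrightarrow>
     (\<forall>\<pp>\<in>Spec R - W. localization_is_zero R (graded_hom T \<phi> C X) \<pp>)}"

text \<open>
  The exact triangle \<open>\<Gamma>\<^sub>W X \<rightarrow> X \<rightarrow> L\<^sub>W X \<rightarrow> \<Sigma>\<Gamma>\<^sub>W X\<close> is determined by \<open>W\<close> and \<open>X\<close> up to unique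
  isomorphism; we choose one.  Only the values on objects of the functors are needed.
\<close>

definition is_localization_triangle :: "'r set set \<Rightarrow> 'o \<Rightarrow> 'a \<times> 'a \<times> 'a \<Rightarrow> bool" where
  "is_localization_triangle W X = (\<lambda>(f, g, h).
     (f, g, h) \<in> tri T \<and> tgt T f = X \<and> src T f \<in> torsion_subcat W \<and>
     (\<forall>Y\<in>torsion_subcat W. Mor T Y (tgt T g) = {azero T Y (tgt T g)}))"

definition localization_triangle :: "'r set set \<Rightarrow> 'o \<Rightarrow> 'a \<times> 'a \<times> 'a" where
  "localization_triangle W X = (SOME t. is_localization_triangle W X t)"

definition Gamma_W :: "'r set set \<Rightarrow> 'o \<Rightarrow> 'o" where
  "Gamma_W W X = (case localization_triangle W X of (f, g, h) \<Rightarrow> src T f)"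

definition L_W :: "'r set set \<Rightarrow> 'o \<Rightarrow> 'o" where
  "L_W W X = (case localization_triangle W X of (f, g, h) \<Rightarrow> tgt T g)"

definition Gamma_p :: "'r set \<Rightarrow> 'o \<Rightarrow> 'o" where
  "Gamma_p \<pp> X = Gamma_W (V_closed R \<pp>) (L_W (Z_set R \<pp>) X)"

definition Gamma_image :: "'r set \<Rightarrow> 'o set" where
  "Gamma_image \<pp> = {Y \<in> obj T. \<exists>X\<in>obj T. isomorphic T (Gamma_p \<pp> X) Y}"

definition supp :: "'o \<Rightarrow> 'r set set" where
  "supp X = {\<pp> \<in> Spec R. \<not> is_zero_obj T (Gamma_p \<pp> X)}"

definition supp_cat :: "'r set set" where
  "supp_cat = (\<Union>X\<in>obj T. supp X)"

definition local_global_principle :: bool where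
  "local_global_principle \<longleftrightarrow>
     (\<forall>X\<in>obj T. Loc \<kappa> T {X} = Loc \<kappa> T ((\<lambda>\<pp>. Gamma_p \<pp> X) ` Spec R))"

definition localizing_subcats :: "'o set set" where
  "localizing_subcats = {S. localizing \<kappa> T S}"

definition localizing_families :: "('r set \<Rightarrow> 'o set) set" where
  "localizing_families =
     (\<Pi>\<^sub>E \<pp>\<in>supp_cat. {S. localizing \<kappa> T S \<and> S \<subseteq> Gamma_image \<pp>})"

definition sigma_map :: "'o set \<Rightarrow> 'r set \<Rightarrow> 'o set" where
  "sigma_map S = (\<lambda>\<pp>\<in>supp_cat. S \<inter> Gamma_image \<pp>)"

definition tau_map :: "('r set \<Rightarrow> 'o set) \<Rightarrow> 'o set" where
  "tau_map F = Loc \<kappa> T (\<Union>\<pp>\<in>supp_cat. F \<pp>)"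

end

end

theory Submission
  imports Defs
begin

text \<open>
  Fix a family of central elements closed under products. An object is torsion if every map into it
  from a compact object is killed by some member of the family, and local if every member acts on it
  invertibly. Killing the fibres of all actions \<open>X \<rightarrow> \<Sigma>\<^sup>n X\<close> simultaneously and iterating
  countably often gives \<open>X \<rightarrow> X\<^sub>\<infinity>\<close> with \<open>X\<^sub>\<infinity>\<close> local and torsion fibre, inside the
  localizing subcategory generated by \<open>X\<close>. Hence the torsion objects form a smashing subcategory,
  and finite intersections of such are again smashing. For \<open>\<Z>(\<pp>)\<close> the family is given by the
  homogeneous elements outside \<open>\<pp>\<close>; for \<open>\<V>(\<pp>)\<close> one intersects over the powers of
  finitely many homogeneous generators of \<open>\<pp>\<close>. So \<open>\<Gamma>\<^sub>\<pp> X\<close> lies in the localizing subcategory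
  generated by \<open>X\<close>, the functor \<open>\<Gamma>\<^sub>\<pp>\<close> pulls localizing subcategories back to localizing ones, and
  its image consists of the objects on which \<open>\<pp>\<close> acts locally nilpotently and the homogeneous
  elements outside \<open>\<pp>\<close> act invertibly; images for different primes meet only in zero objects.
  These facts make the equivalence formal.
\<close>

section \<open>Preadditive categories\<close>

text \<open>Statements are made invariant under isomorphism, and preimages of localizing
  subcategories are rewritten as classes of extensions of local objects by torsion objects; these
  are localizing because local objects are closed under coproducts, which is the purpose of
  smashing. The explicit telescope keeps torsion parts inside \<open>Loc_of {X}\<close>, which
  serves the intersection of smashing subcategories as well as the local-global principle. Smallness
  of \<open>carrier R\<close> permits killing all fibres in one coproduct. A central element
  commutes with suspension only up to sign, so one compares only vanishing and invertibility of its
  action. In the final equivalence \<open>\<sigma> (\<tau> F) = F\<close> holds for every family;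
  the principle is what recovers a localizing subcategory from its local pieces, and injectivity of
  \<open>\<sigma>\<close> is tested on the two subcategories generated by \<open>X\<close> and by
  all \<open>\<Gamma>p \<pp> X\<close>.\<close>

context preadditive_cat
begin

declare Mor_def [simp]

abbreviation plus_arr (infixl \<open>\<boxplus>\<close> 65) where "f \<boxplus> g \<equiv> aadd T f g"
abbreviation uminus_arr (\<open>\<boxminus> _\<close> [81] 80) where "\<boxminus> f \<equiv> aneg T f"

lemma Mor_objD:
  assumes "f \<in> Mor T X Y" shows "X \<in> obj T" "Y \<in> obj T"
  using assms src_obj tgt_obj by auto

lemma idt_simps [simp]:
  assumes "X \<in> obj T" shows "idt T X \<in> arr T" "src T (idt T X) = X" "tgt T (idt T X) = X"
  using idt_mor[OF assms] by auto

lemma cmp_simps [simp]: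
  assumes "f \<in> arr T" "g \<in> arr T" "tgt T f = src T g"
  shows "g \<cdot> f \<in> arr T" "src T (g \<cdot> f) = src T f" "tgt T (g \<cdot> f) = tgt T g"
  using cmp_mor[of f "src T f" "tgt T f" g "tgt T g"] assms by auto

lemma cmp_idt' [simp]: "f \<in> arr T \<Longrightarrow> src T f = X \<Longrightarrow> f \<cdot> idt T X = f"
  using cmp_idt[of f X "tgt T f"] by simp

lemma idt_cmp' [simp]: "f \<in> arr T \<Longrightarrow> tgt T f = Y \<Longrightarrow> idt T Y \<cdot> f = f"
  using idt_cmp[of f "src T f" Y] by simp

lemma assoc [simp]:
  assumes "f \<in> arr T" "g \<in> arr T" "h \<in> arr T" "tgt T f = src T g" "tgt T g = src T h"
  shows "(h \<cdot> g) \<cdot> f = h \<cdot> (g \<cdot> f)"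
  using cmp_assoc[of f "src T f" "tgt T f" g "tgt T g" h "tgt T h"] assms by simp

text \<open>\<open>assoc\<close> as a simplification rule bends all composites to the right, after
  which \<open>g \<cdot> f\<close> no longer occurs inside a longer word. This form applies an
  equation for \<open>g \<cdot> f\<close> in front of a tail \<open>w\<close>.\<close>

lemma cmp_eqD:
  assumes "g \<cdot> f = k" "f \<in> arr T" "g \<in> arr T" "tgt T f = src T g" "w \<in> arr T" "tgt T w = src T f"
  shows "g \<cdot> (f \<cdot> w) = k \<cdot> w"
  using assms by auto

lemma mor_group_simps [simp]:
  "carrier (mor_group T X Y) = Mor T X Y" "mult (mor_group T X Y) = aadd T"
  "one (mor_group T X Y) = azero T X Y"
  by (auto simp: mor_group_def)

lemma azero_simps [simp]:
  assumes "X \<in> obj T" "Y \<in> obj T"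
  shows "azero T X Y \<in> arr T" "src T (azero T X Y) = X" "tgt T (azero T X Y) = Y"
proof -
  interpret comm_group "mor_group T X Y" by (rule mor_comm_group[OF assms])
  show "azero T X Y \<in> arr T" "src T (azero T X Y) = X" "tgt T (azero T X Y) = Y"
    using one_closed by auto
qed

lemma aadd_simps [simp]:
  assumes "f \<in> arr T" "g \<in> arr T" "src T f = src T g" "tgt T f = tgt T g"
  shows "f \<boxplus> g \<in> arr T" "src T (f \<boxplus> g) = src T g" "tgt T (f \<boxplus> g) = tgt T g"
proof -
  interpret comm_group "mor_group T (src T g) (tgt T g)"
    by (rule mor_comm_group) (use assms src_obj tgt_obj in auto)
  show "f \<boxplus> g \<in> arr T" "src T (f \<boxplus> g) = src T g" "tgt T (f \<boxplus> g) = tgt T g"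
    using m_closed[of f g] assms by auto
qed

lemma aneg_simps [simp]:
  assumes "f \<in> arr T"
  shows "\<boxminus> f \<in> arr T" "src T (\<boxminus> f) = src T f" "tgt T (\<boxminus> f) = tgt T f"
proof -
  interpret comm_group "mor_group T (src T f) (tgt T f)"
    by (rule mor_comm_group) (use assms src_obj tgt_obj in auto)
  show "\<boxminus> f \<in> arr T" "src T (\<boxminus> f) = src T f" "tgt T (\<boxminus> f) = tgt T f"
    using inv_closed[of f] assms by (auto simp: aneg_def)
qed

lemma aadd_commute:
  assumes "f \<in> arr T" "g \<in> arr T" "src T f = src T g" "tgt T f = tgt T g"
  shows "f \<boxplus> g = g \<boxplus> f"
proof -
  interpret comm_group "mor_group T (src T g) (tgt T g)"
    by (rule mor_comm_group) (use assms src_obj tgt_obj in auto)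
  show ?thesis using m_comm[of f g] assms by auto
qed

lemma aadd_assoc:
  assumes "f \<in> arr T" "g \<in> arr T" "h \<in> arr T" "src T f = src T g" "tgt T f = tgt T g"
    "src T h = src T g" "tgt T h = tgt T g"
  shows "f \<boxplus> g \<boxplus> h = f \<boxplus> (g \<boxplus> h)"
proof -
  interpret comm_group "mor_group T (src T g) (tgt T g)"
    by (rule mor_comm_group) (use assms src_obj tgt_obj in auto)
  show ?thesis using m_assoc[of f g h] assms by auto
qed

lemma aadd_zero [simp]:
  assumes "f \<in> arr T" "src T f = X" "tgt T f = Y"
  shows "f \<boxplus> azero T X Y = f" "azero T X Y \<boxplus> f = f"
proof -
  interpret comm_group "mor_group T X Y"
    by (rule mor_comm_group) (use assms src_obj tgt_obj in auto)
  show "f \<boxplus> azero T X Y = f" "azero T X Y \<boxplus> f = f"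
    using r_one[of f] l_one[of f] assms by auto
qed

lemma aadd_neg [simp]:
  assumes "f \<in> arr T"
  shows "f \<boxplus> \<boxminus> f = azero T (src T f) (tgt T f)" "\<boxminus> f \<boxplus> f = azero T (src T f) (tgt T f)"
proof -
  interpret comm_group "mor_group T (src T f) (tgt T f)"
    by (rule mor_comm_group) (use assms src_obj tgt_obj in auto)
  show "f \<boxplus> \<boxminus> f = azero T (src T f) (tgt T f)" "\<boxminus> f \<boxplus> f = azero T (src T f) (tgt T f)"
    using r_inv[of f] l_inv[of f] assms by (auto simp: aneg_def)
qed

lemma aadd_eq_zeroD:
  assumes "f \<boxplus> g = azero T X Y" "f \<in> Mor T X Y" "g \<in> Mor T X Y"
  shows "f = \<boxminus> g"
proof -
  interpret comm_group "mor_group T X Y"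
    by (rule mor_comm_group) (use assms src_obj tgt_obj in auto)
  show ?thesis using inv_equality[of f g] assms by (auto simp: aneg_def)
qed

text \<open>Cancellation in the group of arrows. It shows that additive operations such as
  composition and suspension preserve zero, their value at zero being its own double.\<close>

lemma aadd_self_zeroD:
  assumes "f \<boxplus> f = f" "f \<in> Mor T X Y"
  shows "f = azero T X Y"
proof -
  interpret comm_group "mor_group T X Y"
    by (rule mor_comm_group) (use assms src_obj tgt_obj in auto)
  show ?thesis using r_cancel_one[of f f] assms by auto
qed

lemma aneg_aneg [simp]: "f \<in> arr T \<Longrightarrow> \<boxminus> (\<boxminus> f) = f"
  using aadd_eq_zeroD[of f "\<boxminus> f" "src T f" "tgt T f"] by simp

text \<open>Exactness and orthogonality speak about vanishing; this turns an equality of arrows into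
  the vanishing of their difference.\<close>

lemma minus_eq_zero_iff:
  assumes "f \<in> Mor T X Y" "g \<in> Mor T X Y"
  shows "f \<boxplus> \<boxminus> g = azero T X Y \<longleftrightarrow> f = g"
  using aadd_eq_zeroD[of f "\<boxminus> g" X Y] assms by auto

lemma cmp_aadd' [simp]:
  assumes "f \<in> arr T" "f' \<in> arr T" "src T f = src T f'" "tgt T f = tgt T f'" "g \<in> arr T" "tgt T f' = src T g"
  shows "g \<cdot> (f \<boxplus> f') = g \<cdot> f \<boxplus> g \<cdot> f'"
  using cmp_aadd[of f "src T f" "tgt T f" f' g "tgt T g"] assms by auto

lemma aadd_cmp' [simp]:
  assumes "f \<in> arr T" "g \<in> arr T" "g' \<in> arr T" "src T g = src T g'" "tgt T g = tgt T g'" "tgt T f = src T g'"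
  shows "(g \<boxplus> g') \<cdot> f = g \<cdot> f \<boxplus> g' \<cdot> f"
  using aadd_cmp[of f "src T f" "tgt T f" g "tgt T g" g'] assms by auto

lemma cmp_azero [simp]:
  assumes "g \<in> arr T" "src T g = Y" "X \<in> obj T"
  shows "g \<cdot> azero T X Y = azero T X (tgt T g)"
proof -
  have Y: "Y \<in> obj T" using assms src_obj by auto
  have "g \<cdot> azero T X Y \<boxplus> g \<cdot> azero T X Y = g \<cdot> (azero T X Y \<boxplus> azero T X Y)"
    using assms Y by (intro cmp_aadd'[symmetric]) auto
  also have "\<dots> = g \<cdot> azero T X Y" using assms Y by simp
  finally show ?thesis using assms Y by (intro aadd_self_zeroD) auto
qed

lemma azero_cmp [simp]:
  assumes "f \<in> arr T" "tgt T f = Y" "Z \<in> obj T"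
  shows "azero T Y Z \<cdot> f = azero T (src T f) Z"
proof -
  have Y: "Y \<in> obj T" using assms tgt_obj by auto
  have "azero T Y Z \<cdot> f \<boxplus> azero T Y Z \<cdot> f = (azero T Y Z \<boxplus> azero T Y Z) \<cdot> f"
    using assms Y by (intro aadd_cmp'[symmetric]) auto
  also have "\<dots> = azero T Y Z \<cdot> f" using assms Y by simp
  finally show ?thesis using assms Y by (intro aadd_self_zeroD) auto
qed

lemma cmp_aneg [simp]:
  assumes "f \<in> arr T" "g \<in> arr T" "tgt T f = src T g"
  shows "g \<cdot> \<boxminus> f = \<boxminus> (g \<cdot> f)"
proof -
  have "g \<cdot> \<boxminus> f \<boxplus> g \<cdot> f = g \<cdot> (\<boxminus> f \<boxplus> f)" using assms by (intro cmp_aadd'[symmetric]) auto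
  also have "\<dots> = azero T (src T f) (tgt T g)" using assms src_obj tgt_obj by auto
  finally show ?thesis using assms by (intro aadd_eq_zeroD) auto
qed

lemma aneg_cmp [simp]:
  assumes "f \<in> arr T" "g \<in> arr T" "tgt T f = src T g"
  shows "(\<boxminus> g) \<cdot> f = \<boxminus> (g \<cdot> f)"
proof -
  have "\<boxminus> g \<cdot> f \<boxplus> g \<cdot> f = (\<boxminus> g \<boxplus> g) \<cdot> f" using assms by (intro aadd_cmp'[symmetric]) auto
  also have "\<dots> = azero T (src T f) (tgt T g)" using assms src_obj tgt_obj by auto
  finally show ?thesis using assms by (intro aadd_eq_zeroD) auto
qed

lemma aneg_azero [simp]:
  assumes "X \<in> obj T" "Y \<in> obj T" shows "\<boxminus> azero T X Y = azero T X Y"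
  using aadd_eq_zeroD[of "azero T X Y" "azero T X Y" X Y] assms by simp

lemma aneg_eq_zero_iff:
  assumes "f \<in> Mor T X Y" shows "\<boxminus> f = azero T X Y \<longleftrightarrow> f = azero T X Y"
proof
  assume "\<boxminus> f = azero T X Y"
  then have "\<boxminus> (\<boxminus> f) = azero T X Y" using Mor_objD[OF assms] by simp
  then show "f = azero T X Y" using assms by simp
qed (use Mor_objD[OF assms] in simp)

lemma minus_cancel:
  assumes "f \<in> Mor T X Y" "g \<in> Mor T X Y" shows "f \<boxplus> \<boxminus> g \<boxplus> g = f"
  using assms by (subst aadd_assoc) auto

section \<open>Zero objects and isomorphisms\<close>

lemma is_zero_obj_obj: "is_zero_obj T Z \<Longrightarrow> Z \<in> obj T"
  by (simp add: is_zero_obj_def)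

lemma zero_src_eq:
  assumes "is_zero_obj T Z" "f \<in> Mor T Z Y"
  shows "f = azero T Z Y"
proof -
  have Y: "Y \<in> obj T" using assms(2) by (rule Mor_objD)
  then have "\<exists>!f. f \<in> Mor T Z Y" using assms(1) unfolding is_zero_obj_def by blast
  moreover have "azero T Z Y \<in> Mor T Z Y" using Y assms(1) is_zero_obj_obj by simp
  ultimately show ?thesis using assms(2) by blast
qed

lemma zero_tgt_eq:
  assumes "is_zero_obj T Z" "f \<in> Mor T Y Z"
  shows "f = azero T Y Z"
proof -
  have Y: "Y \<in> obj T" using assms(2) by (rule Mor_objD)
  then have "\<exists>!f. f \<in> Mor T Y Z" using assms(1) unfolding is_zero_obj_def by blast
  moreover have "azero T Y Z \<in> Mor T Y Z" using Y assms(1) is_zero_obj_obj by simp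
  ultimately show ?thesis using assms(2) by blast
qed

lemma is_zero_obj_iff: "is_zero_obj T Z \<longleftrightarrow> Z \<in> obj T \<and> idt T Z = azero T Z Z"
proof
  assume "is_zero_obj T Z"
  then show "Z \<in> obj T \<and> idt T Z = azero T Z Z"
    using zero_src_eq[of Z "idt T Z" Z] is_zero_obj_obj by simp
next
  assume Z: "Z \<in> obj T \<and> idt T Z = azero T Z Z"
  have "\<exists>!f. f \<in> Mor T Z Y" "\<exists>!f. f \<in> Mor T Y Z" if Y: "Y \<in> obj T" for Y
  proof -
    have "f = azero T Z Y" if "f \<in> Mor T Z Y" for f
      using cmp_idt'[of f Z] Z that by auto
    then show "\<exists>!f. f \<in> Mor T Z Y"
      using Z Y by (intro ex1I[of _ "azero T Z Y"]) auto
    have "f = azero T Y Z" if "f \<in> Mor T Y Z" for f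
      using idt_cmp'[of f Z] Z that by auto
    then show "\<exists>!f. f \<in> Mor T Y Z"
      using Z Y by (intro ex1I[of _ "azero T Y Z"]) auto
  qed
  then show "is_zero_obj T Z" using Z unfolding is_zero_obj_def by blast
qed

lemma is_isoI:
  assumes "f \<in> Mor T X Y" "g \<in> Mor T Y X" "g \<cdot> f = idt T X" "f \<cdot> g = idt T Y"
  shows "is_iso T f"
  using assms by (auto simp: is_iso_def)

lemma is_isoE:
  assumes "is_iso T f" "f \<in> Mor T X Y"
  obtains g where "g \<in> Mor T Y X" "g \<cdot> f = idt T X" "f \<cdot> g = idt T Y"
  using assms by (auto simp: is_iso_def)

lemma idt_iso: "X \<in> obj T \<Longrightarrow> is_iso T (idt T X)"
  by (rule is_isoI[of _ X X "idt T X"]) auto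

lemma aneg_iso:
  assumes "is_iso T f" shows "is_iso T (\<boxminus> f)"
proof -
  have f: "f \<in> arr T" using assms by (simp add: is_iso_def)
  then obtain g where "g \<in> Mor T (tgt T f) (src T f)" "g \<cdot> f = idt T (src T f)" "f \<cdot> g = idt T (tgt T f)"
    using assms by (auto simp: is_iso_def)
  then show ?thesis using f by (intro is_isoI[of _ "src T f" "tgt T f" "\<boxminus> g"]) (auto simp: src_obj tgt_obj)
qed

lemma cmp_iso:
  assumes "is_iso T f" "is_iso T g" "tgt T f = src T g" shows "is_iso T (g \<cdot> f)"
proof -
  have fg: "f \<in> arr T" "g \<in> arr T" using assms by (auto simp: is_iso_def)
  obtain f' where f': "f' \<in> Mor T (tgt T f) (src T f)" "f' \<cdot> f = idt T (src T f)" "f \<cdot> f' = idt T (tgt T f)"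
    using assms by (auto simp: is_iso_def)
  obtain g' where g': "g' \<in> Mor T (tgt T g) (src T g)" "g' \<cdot> g = idt T (src T g)" "g \<cdot> g' = idt T (tgt T g)"
    using assms by (auto simp: is_iso_def)
  have 1: "g' \<cdot> (g \<cdot> f) = f" using cmp_eqD[OF g'(2), of f] fg f' g' assms by auto
  have 2: "f \<cdot> (f' \<cdot> g') = g'" using cmp_eqD[OF f'(3), of g'] fg f' g' assms by auto
  show ?thesis
    by (rule is_isoI[of _ "src T f" "tgt T g" "f' \<cdot> g'"]) (use fg f' g' assms 1 2 in auto)
qed

lemma iso_cmp_zeroD:
  assumes "is_iso T f" "w \<in> Mor T W (src T f)" "f \<cdot> w = azero T W (tgt T f)"
  shows "w = azero T W (src T f)"
proof -
  have f: "f \<in> arr T" using assms by (simp add: is_iso_def)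
  then obtain g where g: "g \<in> Mor T (tgt T f) (src T f)" "g \<cdot> f = idt T (src T f)"
    using assms by (auto simp: is_iso_def)
  have "w = g \<cdot> (f \<cdot> w)" using cmp_eqD[OF g(2), of w] f g assms by auto
  then show ?thesis using assms g Mor_objD[OF assms(2)] by simp
qed

lemma isomorphic_sym:
  assumes "isomorphic T X Y" shows "isomorphic T Y X"
proof -
  obtain f where f: "f \<in> Mor T X Y" "is_iso T f" using assms by (auto simp: isomorphic_def)
  then obtain g where g: "g \<in> Mor T Y X" "g \<cdot> f = idt T X" "f \<cdot> g = idt T Y" by (elim is_isoE)
  then show ?thesis unfolding isomorphic_def using f is_isoI by blast
qed

lemma isomorphic_trans:
  assumes "isomorphic T X Y" "isomorphic T Y Z" shows "isomorphic T X Z"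
proof -
  obtain f where f: "f \<in> Mor T X Y" "is_iso T f" using assms by (auto simp: isomorphic_def)
  obtain g where g: "g \<in> Mor T Y Z" "is_iso T g" using assms by (auto simp: isomorphic_def)
  have "is_iso T (g \<cdot> f)" using f g by (intro cmp_iso) auto
  then show ?thesis unfolding isomorphic_def using f g by (intro bexI[of _ "g \<cdot> f"]) auto
qed

lemma isomorphic_obj:
  assumes "isomorphic T X Y" shows "X \<in> obj T" "Y \<in> obj T"
  using assms Mor_objD unfolding isomorphic_def by blast+

text \<open>A left inverse \<open>w\<close> of \<open>c\<close> satisfies
  \<open>(c \<cdot> w - 1) \<cdot> c = 0\<close>, so cancellation of \<open>c\<close> on the right
  makes it two-sided. Testing endomorphisms of \<open>Z'\<close> is enough; this is the form in
  which five-lemma arguments end.\<close>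

lemma iso_if_bij_cmp:
  assumes c: "c \<in> Mor T Z Z'"
    and inj: "\<And>w. w \<in> Mor T Z' Z' \<Longrightarrow> w \<cdot> c = azero T Z Z' \<Longrightarrow> w = azero T Z' Z'"
    and surj: "\<exists>w. w \<in> Mor T Z' Z \<and> w \<cdot> c = idt T Z"
  shows "is_iso T c"
proof -
  have Z: "Z \<in> obj T" "Z' \<in> obj T" using c Mor_objD by blast+
  obtain w where w: "w \<in> Mor T Z' Z" "w \<cdot> c = idt T Z" using surj by blast
  have "(c \<cdot> w \<boxplus> \<boxminus> idt T Z') \<cdot> c = azero T Z Z'" using c w Z by simp
  then have "c \<cdot> w \<boxplus> \<boxminus> idt T Z' = azero T Z' Z'" using c w Z by (intro inj) auto
  then have "c \<cdot> w = idt T Z'" using c w Z minus_eq_zero_iff[of "c \<cdot> w" Z' Z' "idt T Z'"] by simp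
  then show ?thesis using w c by (intro is_isoI) auto
qed

text \<open>The dual argument: a right inverse becomes two-sided once \<open>c\<close> can be
  cancelled on the left.\<close>

lemma iso_if_bij_cmp':
  assumes c: "c \<in> Mor T Z Z'"
    and inj: "\<And>w. w \<in> Mor T Z Z \<Longrightarrow> c \<cdot> w = azero T Z Z' \<Longrightarrow> w = azero T Z Z"
    and surj: "\<exists>w. w \<in> Mor T Z' Z \<and> c \<cdot> w = idt T Z'"
  shows "is_iso T c"
proof -
  have Z: "Z \<in> obj T" "Z' \<in> obj T" using c Mor_objD by blast+
  obtain w where w: "w \<in> Mor T Z' Z" "c \<cdot> w = idt T Z'" using surj by blast
  have "c \<cdot> (w \<cdot> c) = c" using cmp_eqD[OF w(2), of c] c w Z by simp
  then have "c \<cdot> (w \<cdot> c \<boxplus> \<boxminus> idt T Z) = azero T Z Z'" using c w Z by simp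
  then have "w \<cdot> c \<boxplus> \<boxminus> idt T Z = azero T Z Z" using c w Z by (intro inj) auto
  then have "w \<cdot> c = idt T Z" using c w Z minus_eq_zero_iff[of "w \<cdot> c" Z Z "idt T Z"] by simp
  then show ?thesis using w c by (intro is_isoI) auto
qed

subsection \<open>Coproducts\<close>

lemma coprod_obj: "is_coproduct T I X C \<iota> \<Longrightarrow> C \<in> obj T"
  by (simp add: is_coproduct_def)

lemma coprod_inj: "is_coproduct T I X C \<iota> \<Longrightarrow> i \<in> I \<Longrightarrow> \<iota> i \<in> Mor T (X i) C"
  by (simp add: is_coproduct_def)

lemma coprod_ex:
  assumes "is_coproduct T I X C \<iota>" "Y \<in> obj T" "\<And>i. i \<in> I \<Longrightarrow> f i \<in> Mor T (X i) Y"
  obtains u where "u \<in> Mor T C Y" "\<And>i. i \<in> I \<Longrightarrow> u \<cdot> \<iota> i = f i"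
proof -
  have "\<exists>!u. u \<in> Mor T C Y \<and> (\<forall>i\<in>I. u \<cdot> \<iota> i = f i)"
    using assms unfolding is_coproduct_def by blast
  then show ?thesis using that by blast
qed

lemma coprod_eqI:
  assumes C: "is_coproduct T I X C \<iota>" and u: "u \<in> Mor T C Y" and v: "v \<in> Mor T C Y"
    and eq: "\<And>i. i \<in> I \<Longrightarrow> u \<cdot> \<iota> i = v \<cdot> \<iota> i"
  shows "u = v"
proof -
  have f: "\<forall>i\<in>I. (\<lambda>i. v \<cdot> \<iota> i) i \<in> Mor T (X i) Y"
    using cmp_mor[OF coprod_inj[OF C] v] by blast
  have "\<exists>!w. w \<in> Mor T C Y \<and> (\<forall>i\<in>I. w \<cdot> \<iota> i = (\<lambda>i. v \<cdot> \<iota> i) i)"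
    by (rule C[unfolded is_coproduct_def, THEN conjunct2, THEN conjunct2, rule_format,
          OF Mor_objD(2)[OF u] f[rule_format]])
  then show ?thesis using u v eq by metis
qed

lemma coprod_zeroI:
  assumes C: "is_coproduct T I X C \<iota>" and u: "u \<in> Mor T C Y"
    and eq: "\<And>i. i \<in> I \<Longrightarrow> u \<cdot> \<iota> i = azero T (X i) Y"
  shows "u = azero T C Y"
  by (rule coprod_eqI[OF C u]) (use coprod_inj[OF C] coprod_obj[OF C] Mor_objD[OF u] eq in auto)

lemma coprod_cong:
  assumes C: "is_coproduct T I X C \<iota>" and "\<And>i. i \<in> I \<Longrightarrow> X i = X' i" "\<And>i. i \<in> I \<Longrightarrow> \<iota> i = \<iota>' i"
  shows "is_coproduct T I X' C \<iota>'"
  using assms unfolding is_coproduct_def by (simp del: Mor_def)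

text \<open>The size conventions speak of index sets in the type of \<open>\<kappa>\<close>, while
  the constructions use coproducts indexed by natural numbers or by central elements; reindexing
  mediates between them.\<close>

lemma coprod_reindex:
  assumes e: "bij_betw e I J" and C: "is_coproduct T J X C \<iota>"
  shows "is_coproduct T I (X \<circ> e) C (\<iota> \<circ> e)"
  unfolding is_coproduct_def
proof (intro conjI ballI allI impI)
  show "C \<in> obj T" using C by (rule coprod_obj)
  show "(\<iota> \<circ> e) i \<in> Mor T ((X \<circ> e) i) C" if "i \<in> I" for i
    using coprod_inj[OF C] bij_betwE[OF e] that by (simp del: Mor_def)
  fix Y f assume Y: "Y \<in> obj T" and f: "\<forall>i\<in>I. f i \<in> Mor T ((X \<circ> e) i) Y"
  let ?g = "f \<circ> inv_into I e"
  have inv: "inv_into I e j \<in> I" "e (inv_into I e j) = j" if "j \<in> J" for j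
    using e that by (auto simp: bij_betw_def inv_into_into f_inv_into_f)
  have "?g j \<in> Mor T (X j) Y" if "j \<in> J" for j
    using f inv[OF that] by (force simp del: Mor_def)
  then have ex: "\<exists>!u. u \<in> Mor T C Y \<and> (\<forall>j\<in>J. u \<cdot> \<iota> j = ?g j)"
    using C Y unfolding is_coproduct_def by blast
  have "(\<forall>j\<in>J. u \<cdot> \<iota> j = ?g j) \<longleftrightarrow> (\<forall>i\<in>I. u \<cdot> (\<iota> \<circ> e) i = f i)" for u
  proof
    assume "\<forall>j\<in>J. u \<cdot> \<iota> j = ?g j"
    then show "\<forall>i\<in>I. u \<cdot> (\<iota> \<circ> e) i = f i"
      using e by (simp add: bij_betw_inv_into_left bij_betwE)
  next
    assume "\<forall>i\<in>I. u \<cdot> (\<iota> \<circ> e) i = f i"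
    then show "\<forall>j\<in>J. u \<cdot> \<iota> j = ?g j" using inv by (metis comp_apply)
  qed
  then show "\<exists>!u. u \<in> Mor T C Y \<and> (\<forall>i\<in>I. u \<cdot> (\<iota> \<circ> e) i = f i)" using ex by simp
qed

end

section \<open>Powers of the suspension\<close>

text \<open>Common form of \<open>obj_pow\<close> and \<open>arr_pow\<close>: integer iterates of a
  bijection \<open>s\<close> of \<open>A\<close>. The laws of exponents are proved once and used for
  objects and for arrows.\<close>

definition zpow :: "'b set \<Rightarrow> ('b \<Rightarrow> 'b) \<Rightarrow> int \<Rightarrow> 'b \<Rightarrow> 'b" where
  "zpow A s n = (if 0 \<le> n then s ^^ nat n else inv_into A s ^^ nat (- n))"

lemma zpow_0 [simp]: "zpow A s 0 x = x"
  by (simp add: zpow_def)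

lemma zpow_1: "zpow A s 1 x = s x"
  by (simp add: zpow_def)

context
  fixes A :: "'b set" and s :: "'b \<Rightarrow> 'b"
  assumes bij: "bij_betw s A A"
begin

lemma zpow_in: "x \<in> A \<Longrightarrow> zpow A s n x \<in> A"
proof -
  assume x: "x \<in> A"
  have "(s ^^ k) x \<in> A" for k using x bij by (induction k) (auto simp: bij_betw_def)
  moreover have "(inv_into A s ^^ k) x \<in> A" for k
    using x bij bij_betw_inv_into[OF bij] by (induction k) (auto simp: bij_betw_def)
  ultimately show ?thesis by (simp add: zpow_def)
qed

lemma zpow_Suc: "x \<in> A \<Longrightarrow> zpow A s (n + 1) x = s (zpow A s n x)"
proof -
  assume x: "x \<in> A"
  show ?thesis
  proof (cases "0 \<le> n")
    case True
    then have "nat (n + 1) = Suc (nat n)" by simp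
    then show ?thesis using True by (simp add: zpow_def)
  next
    case False
    then have *: "nat (- n) = Suc (nat (- (n + 1)))" by simp
    have **: "zpow A s (n + 1) x = (inv_into A s ^^ nat (- (n + 1))) x"
      using False by (cases "n + 1 = 0") (auto simp: zpow_def)
    have "zpow A s n x = inv_into A s (zpow A s (n + 1) x)"
      unfolding ** using False * by (simp add: zpow_def)
    then show ?thesis
      using bij zpow_in[OF x] by (simp add: bij_betw_inv_into_right[OF bij])
  qed
qed

lemma zpow_add: "x \<in> A \<Longrightarrow> zpow A s m (zpow A s n x) = zpow A s (m + n) x"
proof (induction m rule: int_induct[where k = 0])
  case (step1 i)
  then show ?case using zpow_Suc zpow_in by (metis add.assoc add.commute)
next
  case (step2 i)
  have "s (zpow A s (i - 1) (zpow A s n x)) = s (zpow A s (i - 1 + n) x)"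
    using step2 zpow_Suc[of "zpow A s n x" "i - 1"] zpow_Suc[of x "i - 1 + n"] zpow_in by simp
  then show ?case using bij step2 zpow_in by (auto simp: bij_betw_def inj_on_eq_iff)
qed auto

end

context triangulated_cat
begin

abbreviation spow_obj (\<open>\<Sigma>o\<close>) where "\<Sigma>o \<equiv> obj_pow T"
abbreviation spow_arr (\<open>\<Sigma>a\<close>) where "\<Sigma>a \<equiv> arr_pow T"

lemma obj_pow_zpow: "\<Sigma>o n = zpow (obj T) (susp_obj T) n"
  by (simp add: obj_pow_def zpow_def)

lemma arr_pow_zpow: "\<Sigma>a n = zpow (arr T) (susp_arr T) n"
  by (simp add: arr_pow_def zpow_def)

lemma susp_arr_Mor:
  assumes "f \<in> arr T"
  shows "susp_arr T f \<in> arr T" "src T (susp_arr T f) = susp_obj T (src T f)"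
    "tgt T (susp_arr T f) = susp_obj T (tgt T f)"
proof -
  have "susp_arr T f \<in> Mor T (susp_obj T (src T f)) (susp_obj T (tgt T f))"
    using susp_arr_bij[OF src_obj[OF assms] tgt_obj[OF assms]] assms by (auto simp: bij_betw_def)
  then show "susp_arr T f \<in> arr T" "src T (susp_arr T f) = susp_obj T (src T f)"
    "tgt T (susp_arr T f) = susp_obj T (tgt T f)" by auto
qed

text \<open>The axiom is bijectivity on each single set of arrows. Injectivity of the suspension on
  objects recovers source and target from those of the suspended arrow, which glues these bijections
  together.\<close>

lemma susp_arr_bij_arr: "bij_betw (susp_arr T) (arr T) (arr T)"
  unfolding bij_betw_def
proof
  show "inj_on (susp_arr T) (arr T)"
  proof (rule inj_onI)
    fix f g assume f: "f \<in> arr T" and g: "g \<in> arr T" and eq: "susp_arr T f = susp_arr T g"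
    have "inj_on (susp_obj T) (obj T)" using susp_obj_bij by (simp add: bij_betw_def)
    then have "src T f = src T g" "tgt T f = tgt T g"
      using susp_arr_Mor[OF f] susp_arr_Mor[OF g] eq src_obj tgt_obj f g by (auto dest: inj_onD)
    then show "f = g"
      using susp_arr_bij[OF src_obj[OF f] tgt_obj[OF f]] f g eq by (auto simp: bij_betw_def inj_on_def)
  qed
  have "f \<in> susp_arr T ` arr T" if f: "f \<in> arr T" for f
  proof -
    obtain X Y where XY: "X \<in> obj T" "Y \<in> obj T" "src T f = susp_obj T X" "tgt T f = susp_obj T Y"
      using susp_obj_bij src_obj[OF f] tgt_obj[OF f] unfolding bij_betw_def by (metis imageE)
    then have "f \<in> Mor T (susp_obj T X) (susp_obj T Y)" using f by simp
    then show ?thesis using susp_arr_bij[OF XY(1,2)] unfolding bij_betw_def by auto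
  qed
  then show "susp_arr T ` arr T = arr T" using susp_arr_Mor by auto
qed

lemma susp_obj_eq: "susp_obj T X = \<Sigma>o 1 X"
  by (simp add: obj_pow_zpow zpow_1)

lemma susp_arr_eq: "susp_arr T f = \<Sigma>a 1 f"
  by (simp add: arr_pow_zpow zpow_1)

lemma pow0 [simp]: "\<Sigma>o 0 X = X" "\<Sigma>a 0 f = f"
  by (simp_all add: obj_pow_zpow arr_pow_zpow)

lemma obj_pow_obj [simp]: "X \<in> obj T \<Longrightarrow> \<Sigma>o n X \<in> obj T"
  by (simp add: obj_pow_zpow zpow_in[OF susp_obj_bij])

lemma obj_pow_add [simp]: "X \<in> obj T \<Longrightarrow> \<Sigma>o m (\<Sigma>o n X) = \<Sigma>o (m + n) X"
  by (simp add: obj_pow_zpow zpow_add[OF susp_obj_bij])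

lemma obj_pow_eqD:
  assumes "\<Sigma>o n X = \<Sigma>o n Y" "X \<in> obj T" "Y \<in> obj T" shows "X = Y"
  using arg_cong[OF assms(1), of "\<Sigma>o (- n)"] assms(2,3) by simp

lemma arr_pow_arr [simp]: "f \<in> arr T \<Longrightarrow> \<Sigma>a n f \<in> arr T"
  by (simp add: arr_pow_zpow zpow_in[OF susp_arr_bij_arr])

lemma arr_pow_add [simp]: "f \<in> arr T \<Longrightarrow> \<Sigma>a m (\<Sigma>a n f) = \<Sigma>a (m + n) f"
  by (simp add: arr_pow_zpow zpow_add[OF susp_arr_bij_arr])

lemma arr_pow_eqD:
  assumes "\<Sigma>a n f = \<Sigma>a n g" "f \<in> arr T" "g \<in> arr T" shows "f = g"
  using arg_cong[OF assms(1), of "\<Sigma>a (- n)"] assms(2,3) by simp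

text \<open>Induction over the integers whose downward step goes from \<open>n + 1\<close> to
  \<open>n\<close>. This fits the suspension: the claim for \<open>n\<close> is recovered from the
  claim for \<open>n + 1\<close> by injectivity of one suspension.\<close>

lemma pow_induct:
  assumes "P 0" "\<And>n. P n \<Longrightarrow> P (n + 1)" "\<And>n. P (n + 1) \<Longrightarrow> P (n :: int)"
  shows "P n"
proof (induction n rule: int_induct[where k = 0])
  case (step2 i) then show ?case using assms(3)[of "i - 1"] by simp
qed (use assms in auto)

lemma obj_pow_Suc: "X \<in> obj T \<Longrightarrow> \<Sigma>o (n + 1) X = \<Sigma>o 1 (\<Sigma>o n X)"
  by (simp add: add.commute)

lemma arr_pow_Suc: "f \<in> arr T \<Longrightarrow> \<Sigma>a (n + 1) f = \<Sigma>a 1 (\<Sigma>a n f)"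
  by (simp add: add.commute)

lemma arr_pow_src_tgt [simp]:
  assumes "f \<in> arr T"
  shows "src T (\<Sigma>a n f) = \<Sigma>o n (src T f)" "tgt T (\<Sigma>a n f) = \<Sigma>o n (tgt T f)"
proof -
  have one: "src T (\<Sigma>a 1 f) = \<Sigma>o 1 (src T f)" "tgt T (\<Sigma>a 1 f) = \<Sigma>o 1 (tgt T f)" if "f \<in> arr T" for f
    using susp_arr_Mor[OF that] by (simp_all add: susp_arr_eq susp_obj_eq)
  have "src T (\<Sigma>a n f) = \<Sigma>o n (src T f) \<and> tgt T (\<Sigma>a n f) = \<Sigma>o n (tgt T f)"
  proof (induction n rule: pow_induct)
    case (2 n)
    have *: "\<Sigma>a n f \<in> arr T" using assms by simp
    show ?case
      using one[OF *] 2 assms src_obj[OF assms] tgt_obj[OF assms] by (simp add: add.commute)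
  next
    case (3 n)
    have *: "\<Sigma>a n f \<in> arr T" using assms by simp
    have "\<Sigma>o 1 (src T (\<Sigma>a n f)) = \<Sigma>o 1 (\<Sigma>o n (src T f))" "\<Sigma>o 1 (tgt T (\<Sigma>a n f)) = \<Sigma>o 1 (\<Sigma>o n (tgt T f))"
      using one[OF *] 3 assms src_obj[OF assms] tgt_obj[OF assms] by (simp_all add: add.commute)
    then show ?case using obj_pow_eqD src_obj[OF assms] tgt_obj[OF assms] src_obj[OF *] tgt_obj[OF *] obj_pow_obj
      by metis
  qed simp
  then show "src T (\<Sigma>a n f) = \<Sigma>o n (src T f)" "tgt T (\<Sigma>a n f) = \<Sigma>o n (tgt T f)" by auto
qed

lemma arr_pow_cmp [simp]:
  assumes "f \<in> arr T" "g \<in> arr T" "tgt T f = src T g"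
  shows "\<Sigma>a n (g \<cdot> f) = \<Sigma>a n g \<cdot> \<Sigma>a n f"
proof -
  have one: "\<Sigma>a 1 (g \<cdot> f) = \<Sigma>a 1 g \<cdot> \<Sigma>a 1 f" if "f \<in> arr T" "g \<in> arr T" "tgt T f = src T g" for f g
    using susp_cmp[of f "src T f" "tgt T f" g "tgt T g"] that by (simp add: susp_arr_eq)
  show ?thesis
  proof (induction n rule: pow_induct)
    case (2 n)
    then show ?case using assms one[of "\<Sigma>a n f" "\<Sigma>a n g"] by (simp add: arr_pow_Suc del: arr_pow_add)
  next
    case (3 n)
    then have "\<Sigma>a 1 (\<Sigma>a n (g \<cdot> f)) = \<Sigma>a 1 (\<Sigma>a n g \<cdot> \<Sigma>a n f)"
      using assms one[of "\<Sigma>a n f" "\<Sigma>a n g"] by (simp add: arr_pow_Suc del: arr_pow_add)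
    then show ?case by (rule arr_pow_eqD) (use assms in simp_all)
  qed simp
qed

lemma arr_pow_idt [simp]:
  assumes "X \<in> obj T"
  shows "\<Sigma>a n (idt T X) = idt T (\<Sigma>o n X)"
proof -
  have one: "\<Sigma>a 1 (idt T X) = idt T (\<Sigma>o 1 X)" if "X \<in> obj T" for X
    using susp_idt[OF that] by (simp add: susp_arr_eq susp_obj_eq)
  show ?thesis
  proof (induction n rule: pow_induct)
    case (2 n)
    then show ?case using assms one[of "\<Sigma>o n X"] by (simp add: arr_pow_Suc obj_pow_Suc del: arr_pow_add obj_pow_add)
  next
    case (3 n)
    then have "\<Sigma>a 1 (\<Sigma>a n (idt T X)) = \<Sigma>a 1 (idt T (\<Sigma>o n X))"
      using assms one[of "\<Sigma>o n X"] by (simp add: arr_pow_Suc obj_pow_Suc del: arr_pow_add obj_pow_add)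
    then show ?case by (rule arr_pow_eqD) (use assms in simp_all)
  qed simp
qed

lemma arr_pow_aadd [simp]:
  assumes "f \<in> arr T" "g \<in> arr T" "src T f = src T g" "tgt T f = tgt T g"
  shows "\<Sigma>a n (f \<boxplus> g) = \<Sigma>a n f \<boxplus> \<Sigma>a n g"
proof -
  have one: "\<Sigma>a 1 (f \<boxplus> g) = \<Sigma>a 1 f \<boxplus> \<Sigma>a 1 g"
    if "f \<in> arr T" "g \<in> arr T" "src T f = src T g" "tgt T f = tgt T g" for f g
    using susp_aadd[of f "src T f" "tgt T f" g] that by (simp add: susp_arr_eq)
  show ?thesis
  proof (induction n rule: pow_induct)
    case (2 n)
    then show ?case using assms one[of "\<Sigma>a n f" "\<Sigma>a n g"] by (simp add: arr_pow_Suc del: arr_pow_add)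
  next
    case (3 n)
    then have "\<Sigma>a 1 (\<Sigma>a n (f \<boxplus> g)) = \<Sigma>a 1 (\<Sigma>a n f \<boxplus> \<Sigma>a n g)"
      using assms one[of "\<Sigma>a n f" "\<Sigma>a n g"] by (simp add: arr_pow_Suc del: arr_pow_add)
    then show ?case by (rule arr_pow_eqD) (use assms in simp_all)
  qed simp
qed

lemma arr_pow_azero [simp]:
  assumes "X \<in> obj T" "Y \<in> obj T"
  shows "\<Sigma>a n (azero T X Y) = azero T (\<Sigma>o n X) (\<Sigma>o n Y)"
proof (rule aadd_self_zeroD)
  show "\<Sigma>a n (azero T X Y) \<boxplus> \<Sigma>a n (azero T X Y) = \<Sigma>a n (azero T X Y)"
    using assms arr_pow_aadd[of "azero T X Y" "azero T X Y" n] by simp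
qed (use assms in simp)

lemma arr_pow_aneg [simp]:
  assumes "f \<in> arr T"
  shows "\<Sigma>a n (\<boxminus> f) = \<boxminus> \<Sigma>a n f"
proof (rule aadd_eq_zeroD)
  show "\<Sigma>a n (\<boxminus> f) \<boxplus> \<Sigma>a n f = azero T (\<Sigma>o n (src T f)) (\<Sigma>o n (tgt T f))"
    using assms arr_pow_aadd[of "\<boxminus> f" f n] src_obj tgt_obj by simp
qed (use assms in simp_all)

lemma arr_pow_eq_zero_iff:
  assumes "f \<in> Mor T X Y"
  shows "\<Sigma>a n f = azero T (\<Sigma>o n X) (\<Sigma>o n Y) \<longleftrightarrow> f = azero T X Y"
proof
  assume "\<Sigma>a n f = azero T (\<Sigma>o n X) (\<Sigma>o n Y)"
  then show "f = azero T X Y"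
    using assms Mor_objD[OF assms] by (intro arr_pow_eqD[of n f "azero T X Y"]) auto
qed (use Mor_objD[OF assms] in simp)

lemma arr_pow_Mor: "f \<in> Mor T X Y \<Longrightarrow> \<Sigma>a n f \<in> Mor T (\<Sigma>o n X) (\<Sigma>o n Y)"
  by auto

text \<open>The suspension is strictly invertible, so an arrow into a suspended object is itself a
  suspension. Facts about arrows into \<open>Y\<close> thereby pass to all degrees.\<close>

lemma Mor_pow_lift:
  assumes "w \<in> Mor T W (\<Sigma>o n Y)" "Y \<in> obj T"
  obtains v where "v \<in> Mor T (\<Sigma>o (- n) W) Y" "\<Sigma>a n v = w"
  by (rule that[of "\<Sigma>a (- n) w"]) (use assms in auto)

lemma arr_pow_iso:
  assumes "is_iso T f" shows "is_iso T (\<Sigma>a n f)"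
proof -
  have f: "f \<in> arr T" using assms by (simp add: is_iso_def)
  then obtain g where g: "g \<in> Mor T (tgt T f) (src T f)" "g \<cdot> f = idt T (src T f)" "f \<cdot> g = idt T (tgt T f)"
    using assms by (auto simp: is_iso_def)
  show ?thesis
  proof (rule is_isoI[of _ "\<Sigma>o n (src T f)" "\<Sigma>o n (tgt T f)" "\<Sigma>a n g"])
    have "\<Sigma>a n g \<cdot> \<Sigma>a n f = \<Sigma>a n (g \<cdot> f)" "\<Sigma>a n f \<cdot> \<Sigma>a n g = \<Sigma>a n (f \<cdot> g)"
      using f g(1) by simp_all
    then show "\<Sigma>a n g \<cdot> \<Sigma>a n f = idt T (\<Sigma>o n (src T f))" "\<Sigma>a n f \<cdot> \<Sigma>a n g = idt T (\<Sigma>o n (tgt T f))"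
      using g(2,3) f src_obj tgt_obj by simp_all
  qed (use f g in auto)
qed

lemma zero_obj_pow: "is_zero_obj T Z \<Longrightarrow> is_zero_obj T (\<Sigma>o n Z)"
  using arr_pow_idt[of Z n] by (simp add: is_zero_obj_iff)

lemma coprod_pow:
  assumes C: "is_coproduct T I X C \<iota>"
    and X: "\<And>i. i \<in> I \<Longrightarrow> X i \<in> obj T"
  shows "is_coproduct T I (\<lambda>i. \<Sigma>o n (X i)) (\<Sigma>o n C) (\<lambda>i. \<Sigma>a n (\<iota> i))"
  unfolding is_coproduct_def
proof (intro conjI ballI allI impI)
  show "\<Sigma>o n C \<in> obj T" using coprod_obj[OF C] by simp
  show "\<Sigma>a n (\<iota> i) \<in> Mor T (\<Sigma>o n (X i)) (\<Sigma>o n C)" if "i \<in> I" for i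
    using coprod_inj[OF C that] by (rule arr_pow_Mor)
  fix Y f assume Y: "Y \<in> obj T" and f: "\<forall>i\<in>I. f i \<in> Mor T (\<Sigma>o n (X i)) Y"
  have f': "\<Sigma>a (- n) (f i) \<in> Mor T (X i) (\<Sigma>o (- n) Y)" if "i \<in> I" for i
    using f that X[OF that] by simp
  obtain u where u: "u \<in> Mor T C (\<Sigma>o (- n) Y)" "\<And>i. i \<in> I \<Longrightarrow> u \<cdot> \<iota> i = \<Sigma>a (- n) (f i)"
    using coprod_ex[OF C _ f'] Y by (metis obj_pow_obj)
  show "\<exists>!u. u \<in> Mor T (\<Sigma>o n C) Y \<and> (\<forall>i\<in>I. u \<cdot> \<Sigma>a n (\<iota> i) = f i)"
  proof (rule ex1I)
    have "\<Sigma>a n u \<cdot> \<Sigma>a n (\<iota> i) = f i" if "i \<in> I" for i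
      using arg_cong[OF u(2)[OF that], of "\<Sigma>a n"] u(1) f that coprod_inj[OF C that] by simp
    then show "\<Sigma>a n u \<in> Mor T (\<Sigma>o n C) Y \<and> (\<forall>i\<in>I. \<Sigma>a n u \<cdot> \<Sigma>a n (\<iota> i) = f i)"
      using u Y by simp
  next
    fix v assume v: "v \<in> Mor T (\<Sigma>o n C) Y \<and> (\<forall>i\<in>I. v \<cdot> \<Sigma>a n (\<iota> i) = f i)"
    have "\<Sigma>a (- n) v = u"
    proof (rule coprod_eqI[OF C _ u(1)])
      show "\<Sigma>a (- n) v \<in> Mor T C (\<Sigma>o (- n) Y)" using v coprod_obj[OF C] by simp
      fix i assume i: "i \<in> I"
      have "\<Sigma>a (- n) (v \<cdot> \<Sigma>a n (\<iota> i)) = \<Sigma>a (- n) v \<cdot> \<iota> i"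
        using v coprod_inj[OF C i] by simp
      then show "\<Sigma>a (- n) v \<cdot> \<iota> i = u \<cdot> \<iota> i" using v u(2)[OF i] i by simp
    qed
    then have "\<Sigma>a n (\<Sigma>a (- n) v) = \<Sigma>a n u" by simp
    then show "v = \<Sigma>a n u" using v by simp
  qed
qed

section \<open>Exact triangles\<close>

text \<open>Exact triangles with their three objects made explicit; the suspension is written
  \<open>\<Sigma>o 1\<close> so that the power laws apply to it.\<close>

definition triangle where
  "triangle f g h X Y Z \<longleftrightarrow> (f, g, h) \<in> tri T \<and>
     f \<in> Mor T X Y \<and> g \<in> Mor T Y Z \<and> h \<in> Mor T Z (\<Sigma>o 1 X)"

lemma triangleD:
  assumes "triangle f g h X Y Z"
  shows "f \<in> Mor T X Y" "g \<in> Mor T Y Z" "h \<in> Mor T Z (\<Sigma>o 1 X)"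
    "X \<in> obj T" "Y \<in> obj T" "Z \<in> obj T"
  using assms Mor_objD unfolding triangle_def by blast+

lemma triangle_tri: "(f, g, h) \<in> tri T \<Longrightarrow> triangle f g h (src T f) (tgt T f) (tgt T g)"
  using tri_mor[of f g h] by (auto simp: triangle_def susp_obj_eq)

lemma triangle_iff: "triangle f g h X Y Z \<longleftrightarrow> (f, g, h) \<in> tri T \<and> src T f = X \<and> tgt T f = Y \<and> tgt T g = Z"
  using triangle_tri[of f g h] by (auto simp: triangle_def)

lemma cone_ex:
  assumes "f \<in> Mor T X Y" obtains g h Z where "triangle f g h X Y Z"
  using TR1_cone[of f] assms triangle_iff by auto

lemma triangle_rot: "triangle f g h X Y Z \<Longrightarrow> triangle g h (\<boxminus> \<Sigma>a 1 f) Y Z (\<Sigma>o 1 X)"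
  using TR2[of f X Y g Z h] by (simp add: triangle_def susp_obj_eq susp_arr_eq)

lemma triangle_unrot: "triangle g h (\<boxminus> \<Sigma>a 1 f) Y Z (\<Sigma>o 1 X) \<Longrightarrow> f \<in> Mor T X Y \<Longrightarrow> triangle f g h X Y Z"
  using TR2[of f X Y g Z h] by (simp add: triangle_def susp_obj_eq susp_arr_eq)

text \<open>Backward rotation: TR2 is applied to the arrow
  \<open>\<boxminus> \<Sigma>a (- 1) h\<close>, whose negated suspension is \<open>h\<close>
  again.\<close>

lemma triangle_unrot':
  assumes "triangle f g h X Y Z"
  shows "triangle (\<boxminus> \<Sigma>a (- 1) h) f g (\<Sigma>o (- 1) Z) X Y"
proof (rule triangle_unrot)
  note D = triangleD[OF assms]
  show "triangle f g (\<boxminus> \<Sigma>a 1 (\<boxminus> \<Sigma>a (- 1) h)) X Y (\<Sigma>o 1 (\<Sigma>o (- 1) Z))"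
    using assms D by simp
  show "\<boxminus> \<Sigma>a (- 1) h \<in> Mor T (\<Sigma>o (- 1) Z) X" using D by simp
qed

lemma triangle_TR3:
  assumes "triangle f g h X Y Z" "triangle f' g' h' X' Y' Z'" "a \<in> Mor T X X'" "b \<in> Mor T Y Y'" "b \<cdot> f = f' \<cdot> a"
  obtains c where "c \<in> Mor T Z Z'" "c \<cdot> g = g' \<cdot> b" "\<Sigma>a 1 a \<cdot> h = h' \<cdot> c"
  using TR3[of f g h f' g' h' a b] assms by (auto simp: triangle_def susp_arr_eq)

lemma triangle_iso:
  assumes "triangle f g h X Y Z" "f' \<in> Mor T X' Y'" "g' \<in> Mor T Y' Z'" "h' \<in> Mor T Z' (\<Sigma>o 1 X')"
    "a \<in> Mor T X X'" "b \<in> Mor T Y Y'" "c \<in> Mor T Z Z'" "is_iso T a" "is_iso T b" "is_iso T c"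
    "b \<cdot> f = f' \<cdot> a" "c \<cdot> g = g' \<cdot> b" "\<Sigma>a 1 a \<cdot> h = h' \<cdot> c"
  shows "triangle f' g' h' X' Y' Z'"
  using TR1_iso[of f g h X Y Z f' X' Y' g' Z' h' a b c] assms
  by (simp add: triangle_def susp_obj_eq susp_arr_eq)

text \<open>Only the triangle formed by the three cones is kept, since the applications ask to which
  subcategories the cones belong.\<close>

lemma triangle_octahedral:
  assumes "triangle f u u' X Y Z" "triangle g v v' Y W V" "triangle (g \<cdot> f) w w' X W U"
  obtains j k where "triangle j k (\<Sigma>a 1 u \<cdot> v') Z U V"
proof -
  obtain j k where "j \<in> Mor T Z U" "k \<in> Mor T U V" "(j, k, \<Sigma>a 1 u \<cdot> v') \<in> tri T"
    using TR4[of f X Y g W u u' v v' w w'] assms unfolding triangle_def susp_arr_eq by auto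
  then show ?thesis using that by (auto simp: triangle_iff)
qed

lemma triangle_idt: "X \<in> obj T \<Longrightarrow> is_zero_obj T Z \<Longrightarrow>
    triangle (idt T X) (azero T X Z) (azero T Z (\<Sigma>o 1 X)) X X Z"
  using TR1_idt[of X Z] is_zero_obj_obj[of Z] by (simp add: triangle_def susp_obj_eq)

lemma triangle_idt':
  assumes "X \<in> obj T" "is_zero_obj T Z"
  shows "triangle (azero T Z X) (idt T X) (azero T X (\<Sigma>o 1 Z)) Z X X"
proof -
  have "triangle (\<boxminus> \<Sigma>a (- 1) (azero T (\<Sigma>o 1 Z) (\<Sigma>o 1 X))) (idt T X) (azero T X (\<Sigma>o 1 Z)) (\<Sigma>o (- 1) (\<Sigma>o 1 Z)) X X"
    by (rule triangle_unrot'[OF triangle_idt[OF assms(1) zero_obj_pow[OF assms(2)]]])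
  then show ?thesis using assms is_zero_obj_obj by simp
qed

lemma zero_obtain: obtains Z where "is_zero_obj T Z" "Z \<in> obj T"
  using ex_zero_obj is_zero_obj_obj by blast

text \<open>A filler from the triangle on the identity of \<open>X\<close> factors
  \<open>g \<cdot> f\<close> through a zero object.\<close>

lemma triangle_cmp_zero:
  assumes "triangle f g h X Y Z" shows "g \<cdot> f = azero T X Z"
proof -
  obtain N where N: "is_zero_obj T N" "N \<in> obj T" by (rule zero_obtain)
  note D = triangleD[OF assms]
  obtain c where c: "c \<in> Mor T N Z" "c \<cdot> azero T X N = g \<cdot> f"
    using triangle_TR3[OF triangle_idt[OF D(4) N(1)] assms, of "idt T X" f] D by auto
  then show ?thesis using D N by auto
qed

lemma triangle_cmp_zero':
  assumes "triangle f g h X Y Z" shows "h \<cdot> g = azero T Y (\<Sigma>o 1 X)" "\<Sigma>a 1 f \<cdot> h = azero T Z (\<Sigma>o 1 Y)"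
proof -
  note D = triangleD[OF assms]
  show "h \<cdot> g = azero T Y (\<Sigma>o 1 X)" by (rule triangle_cmp_zero[OF triangle_rot[OF assms]])
  have "\<boxminus> (\<Sigma>a 1 f \<cdot> h) = azero T Z (\<Sigma>o 1 Y)"
    using triangle_cmp_zero[OF triangle_rot[OF triangle_rot[OF assms]]] D by simp
  then show "\<Sigma>a 1 f \<cdot> h = azero T Z (\<Sigma>o 1 Y)"
    using aneg_eq_zero_iff[of "\<Sigma>a 1 f \<cdot> h" Z "\<Sigma>o 1 Y"] D by simp
qed

text \<open>The triangle is mapped to the one on \<open>0 -> W -> W\<close> with identity of
  \<open>W\<close>; the filler is the extension of \<open>w\<close>.\<close>

lemma triangle_coexact:
  assumes "triangle f g h X Y Z" "w \<in> Mor T Y W" "w \<cdot> f = azero T X W"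
  obtains v where "v \<in> Mor T Z W" "v \<cdot> g = w"
proof -
  obtain N where N: "is_zero_obj T N" "N \<in> obj T" by (rule zero_obtain)
  note D = triangleD[OF assms(1)]
  have W: "W \<in> obj T" using assms(2) by (rule Mor_objD)
  obtain c where "c \<in> Mor T Z W" "c \<cdot> g = idt T W \<cdot> w"
    using triangle_TR3[OF assms(1) triangle_idt'[OF W N(1)], of "azero T X N" w] D N assms W by auto
  then show ?thesis using that assms(2) by simp
qed

text \<open>Dual to the previous lemma, but TR3 only fills in the third arrow. Both triangles are
  therefore rotated once, the filler appears one suspension too high, and it is desuspended.\<close>

lemma triangle_exact:
  assumes "triangle f g h X Y Z" "w \<in> Mor T W Y" "g \<cdot> w = azero T W Z"
  obtains v where "v \<in> Mor T W X" "f \<cdot> v = w"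
proof -
  obtain N where N: "is_zero_obj T N" "N \<in> obj T" by (rule zero_obtain)
  note D = triangleD[OF assms(1)]
  have W: "W \<in> obj T" using assms(2) by (rule Mor_objD)
  \<comment> \<open>The rotated identity triangle \<open>W -> 0 -> \<Sigma>W\<close>; the sign of
    the rotation is cancelled by the same sign in the rotated given triangle.\<close>
  have N2: "triangle (azero T W N) (azero T N (\<Sigma>o 1 W)) (\<boxminus> idt T (\<Sigma>o 1 W)) W N (\<Sigma>o 1 W)"
    using triangle_rot[OF triangle_idt[OF W N(1)]] W N by simp
  obtain c where c: "c \<in> Mor T (\<Sigma>o 1 W) (\<Sigma>o 1 X)"
      "\<Sigma>a 1 w \<cdot> \<boxminus> idt T (\<Sigma>o 1 W) = (\<boxminus> \<Sigma>a 1 f) \<cdot> c"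
    using triangle_TR3[OF N2 triangle_rot[OF assms(1)], of w "azero T N Z"] D N assms(2,3) W by auto
  obtain v where v: "v \<in> Mor T W X" "\<Sigma>a 1 v = c" using Mor_pow_lift[OF c(1)] D W by auto
  have "\<boxminus> \<Sigma>a 1 w = \<boxminus> \<Sigma>a 1 (f \<cdot> v)" using c v D assms(2) W by simp
  then have "\<boxminus> (\<boxminus> \<Sigma>a 1 w) = \<boxminus> (\<boxminus> \<Sigma>a 1 (f \<cdot> v))" by simp
  then have "\<Sigma>a 1 w = \<Sigma>a 1 (f \<cdot> v)" using assms(2) v(1) D by simp
  then have "w = f \<cdot> v" using assms(2) v D by (intro arr_pow_eqD[of 1 w]) auto
  then show ?thesis using that v by simp
qed

lemma triangle_exact2:
  assumes "triangle f g h X Y Z" "w \<in> Mor T W Z" "h \<cdot> w = azero T W (\<Sigma>o 1 X)"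
  obtains v where "v \<in> Mor T W Y" "g \<cdot> v = w"
  using triangle_exact[OF triangle_rot[OF assms(1)] assms(2,3)] by blast

lemma triangle_exact3:
  assumes "triangle f g h X Y Z" "w \<in> Mor T W (\<Sigma>o 1 X)" "\<Sigma>a 1 f \<cdot> w = azero T W (\<Sigma>o 1 Y)"
  obtains v where "v \<in> Mor T W Z" "h \<cdot> v = w"
proof -
  have "(\<boxminus> \<Sigma>a 1 f) \<cdot> w = azero T W (\<Sigma>o 1 Y)"
    using assms(2,3) triangleD[OF assms(1)] Mor_objD[OF assms(2)] by simp
  then show ?thesis using triangle_exact[OF triangle_rot[OF triangle_rot[OF assms(1)]] assms(2)] that by blast
qed

lemma triangle_coexact2:
  assumes "triangle f g h X Y Z" "w \<in> Mor T Z W" "w \<cdot> g = azero T Y W"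
  obtains v where "v \<in> Mor T (\<Sigma>o 1 X) W" "v \<cdot> h = w"
  using triangle_coexact[OF triangle_rot[OF assms(1)] assms(2,3)] by blast

lemma triangle_coexact3:
  assumes "triangle f g h X Y Z" "w \<in> Mor T (\<Sigma>o 1 X) W" "w \<cdot> h = azero T Z W"
  obtains v where "v \<in> Mor T (\<Sigma>o 1 Y) W" "v \<cdot> \<Sigma>a 1 f = w"
proof -
  obtain v where v: "v \<in> Mor T (\<Sigma>o 1 Y) W" "v \<cdot> (\<boxminus> \<Sigma>a 1 f) = w"
    using triangle_coexact[OF triangle_rot[OF triangle_rot[OF assms(1)]] assms(2,3)] by blast
  show ?thesis by (rule that[of "\<boxminus> v"]) (use v triangleD[OF assms(1)] in auto)
qed

lemma triangle_exact_pow: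
  assumes "triangle f g h X Y Z" "w \<in> Mor T W (\<Sigma>o n Y)" "\<Sigma>a n g \<cdot> w = azero T W (\<Sigma>o n Z)"
  obtains v where "v \<in> Mor T W (\<Sigma>o n X)" "\<Sigma>a n f \<cdot> v = w"
proof -
  note D = triangleD[OF assms(1)]
  have W: "W \<in> obj T" using assms(2) by (rule Mor_objD)
  obtain w' where w': "w' \<in> Mor T (\<Sigma>o (- n) W) Y" "\<Sigma>a n w' = w" using Mor_pow_lift[OF assms(2)] D by auto
  have "\<Sigma>a n (g \<cdot> w') = \<Sigma>a n (azero T (\<Sigma>o (- n) W) Z)" using assms(2,3) w' D W by simp
  then have "g \<cdot> w' = azero T (\<Sigma>o (- n) W) Z" using w' D W by (intro arr_pow_eqD[of n "g \<cdot> w'"]) auto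
  then obtain v where v: "v \<in> Mor T (\<Sigma>o (- n) W) X" "f \<cdot> v = w'" using triangle_exact[OF assms(1) w'(1)] by blast
  have "\<Sigma>a n f \<cdot> \<Sigma>a n v = \<Sigma>a n (f \<cdot> v)" using v(1) D by simp
  then show ?thesis using that[of "\<Sigma>a n v"] v w' W D by simp
qed

lemma triangle_exact2_pow:
  assumes "triangle f g h X Y Z" "w \<in> Mor T W (\<Sigma>o n Z)" "\<Sigma>a n h \<cdot> w = azero T W (\<Sigma>o (n + 1) X)"
  obtains v where "v \<in> Mor T W (\<Sigma>o n Y)" "\<Sigma>a n g \<cdot> v = w"
  using triangle_exact_pow[OF triangle_rot[OF assms(1)] assms(2)] assms(3) triangleD[OF assms(1)]
  by auto

lemma triangle_shift:
  assumes "triangle f g h X Y Z"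
  shows "triangle (\<boxminus> \<Sigma>a 1 f) (\<boxminus> \<Sigma>a 1 g) (\<boxminus> \<Sigma>a 1 h) (\<Sigma>o 1 X) (\<Sigma>o 1 Y) (\<Sigma>o 1 Z)"
  using triangle_rot[OF triangle_rot[OF triangle_rot[OF assms]]] .

lemma triangle_unshift:
  assumes "triangle f g h X Y Z"
  shows "triangle (\<boxminus> \<Sigma>a (- 1) f) (\<boxminus> \<Sigma>a (- 1) g) (\<boxminus> \<Sigma>a (- 1) h) (\<Sigma>o (- 1) X) (\<Sigma>o (- 1) Y) (\<Sigma>o (- 1) Z)"
  using triangle_unrot'[OF triangle_unrot'[OF triangle_unrot'[OF assms]]] .

text \<open>If \<open>Z\<close> is zero, exactness on both sides makes \<open>f\<close> injective
  and split surjective. If \<open>f\<close> is invertible, then \<open>g\<close> and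
  \<open>h\<close> both vanish, and the identity of \<open>Z\<close>, being a multiple of
  \<open>h\<close>, vanishes too.\<close>

lemma triangle_zero_iso:
  assumes "triangle f g h X Y Z" shows "is_zero_obj T Z \<longleftrightarrow> is_iso T f"
proof
  note D = triangleD[OF assms]
  assume Z: "is_zero_obj T Z"
  show "is_iso T f"
  proof (rule iso_if_bij_cmp'[OF D(1)])
    have "g \<cdot> idt T Y = azero T Y Z" using zero_tgt_eq[OF Z, of g Y] D by simp
    then show "\<exists>w. w \<in> Mor T Y X \<and> f \<cdot> w = idt T Y" using triangle_exact[OF assms idt_mor[OF D(5)]] by blast
    fix w assume w: "w \<in> Mor T X X" "f \<cdot> w = azero T X Y"
    obtain v where v: "v \<in> Mor T X (\<Sigma>o (- 1) Z)" "(\<boxminus> \<Sigma>a (- 1) h) \<cdot> v = w"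
      using triangle_exact[OF triangle_unrot'[OF assms] w] by blast
    then have "v = azero T X (\<Sigma>o (- 1) Z)" using zero_tgt_eq[OF zero_obj_pow[OF Z]] by blast
    then show "w = azero T X X" using v D by simp
  qed
next
  note D = triangleD[OF assms]
  assume f: "is_iso T f"
  obtain f' where f': "f' \<in> Mor T Y X" "f \<cdot> f' = idt T Y" using is_isoE[OF f D(1)] by blast
  have "g \<cdot> (f \<cdot> f') = azero T Y Z" using cmp_eqD[OF triangle_cmp_zero[OF assms], of f'] f' D by simp
  then have g: "g = azero T Y Z" using f' D by simp
  then obtain w where w: "w \<in> Mor T (\<Sigma>o 1 X) Z" "w \<cdot> h = idt T Z"
    using triangle_coexact2[OF assms idt_mor[OF D(6)]] D by auto
  have "h = azero T Z (\<Sigma>o 1 X)"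
    using iso_cmp_zeroD[OF arr_pow_iso[OF f, of 1], of h Z] triangle_cmp_zero'(2)[OF assms] D by simp
  then show "is_zero_obj T Z" using w D by (simp add: is_zero_obj_iff)
qed

lemma triangle_zero_fst:
  assumes "triangle f g h X Y Z" "is_zero_obj T X" shows "is_iso T g"
  using triangle_zero_iso[OF triangle_rot[OF assms(1)]] zero_obj_pow[OF assms(2)] by simp

end

section \<open>Coproducts of triangles and the 3x3 lemma\<close>

context triangulated_cat
begin

text \<open>The comparison \<open>c\<close> of \<open>CZ\<close> with a cone of \<open>u\<close> is
  assembled from fillers on the summands. Its invertibility is a five-lemma argument written out
  with the mapping properties of the coproducts.\<close>

lemma coprod_triangle:
  assumes D: "\<And>i. i \<in> I \<Longrightarrow> triangle (f i) (g i) (h i) (X i) (Y i) (Z i)"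
    and CX: "is_coproduct T I X CX \<iota>X" and CY: "is_coproduct T I Y CY \<iota>Y" and CZ: "is_coproduct T I Z CZ \<iota>Z"
    and u: "u \<in> Mor T CX CY" and u_\<iota>: "\<And>i. i \<in> I \<Longrightarrow> u \<cdot> \<iota>X i = \<iota>Y i \<cdot> f i"
  obtains v w where "triangle u v w CX CY CZ"
proof -
  note XYZ = triangleD[OF D]
  note \<iota>X = coprod_inj[OF CX] and \<iota>Y = coprod_inj[OF CY] and \<iota>Z = coprod_inj[OF CZ]
  note C = coprod_obj[OF CX] coprod_obj[OF CY] coprod_obj[OF CZ]
  have SX: "is_coproduct T I (\<lambda>i. \<Sigma>o 1 (X i)) (\<Sigma>o 1 CX) (\<lambda>i. \<Sigma>a 1 (\<iota>X i))"
    by (rule coprod_pow[OF CX XYZ(4)])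
  have SY: "is_coproduct T I (\<lambda>i. \<Sigma>o 1 (Y i)) (\<Sigma>o 1 CY) (\<lambda>i. \<Sigma>a 1 (\<iota>Y i))"
    by (rule coprod_pow[OF CY XYZ(5)])
  obtain v where v: "v \<in> Mor T CY CZ" and v_\<iota>: "\<And>i. i \<in> I \<Longrightarrow> v \<cdot> \<iota>Y i = \<iota>Z i \<cdot> g i"
    using coprod_ex[OF CY C(3) cmp_mor[OF XYZ(2) \<iota>Z]] by metis
  obtain w where w: "w \<in> Mor T CZ (\<Sigma>o 1 CX)" and w_\<iota>: "\<And>i. i \<in> I \<Longrightarrow> w \<cdot> \<iota>Z i = \<Sigma>a 1 (\<iota>X i) \<cdot> h i"
    using coprod_ex[OF CZ obj_pow_obj[OF C(1)] cmp_mor[OF XYZ(3) arr_pow_Mor[OF \<iota>X]]] by metis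
  obtain g' h' Z' where D': "triangle u g' h' CX CY Z'" using cone_ex[OF u] .
  note T' = triangleD[OF D']
  have "\<exists>c. c \<in> Mor T (Z i) Z' \<and> c \<cdot> g i = g' \<cdot> \<iota>Y i \<and> \<Sigma>a 1 (\<iota>X i) \<cdot> h i = h' \<cdot> c" if "i \<in> I" for i
    using triangle_TR3[OF D[OF that] D' \<iota>X[OF that] \<iota>Y[OF that] u_\<iota>[OF that, symmetric]] by metis
  then obtain c' where c': "\<And>i. i \<in> I \<Longrightarrow> c' i \<in> Mor T (Z i) Z'"
      "\<And>i. i \<in> I \<Longrightarrow> c' i \<cdot> g i = g' \<cdot> \<iota>Y i" "\<And>i. i \<in> I \<Longrightarrow> \<Sigma>a 1 (\<iota>X i) \<cdot> h i = h' \<cdot> c' i"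
    by metis
  obtain c where c: "c \<in> Mor T CZ Z'" and c_\<iota>: "\<And>i. i \<in> I \<Longrightarrow> c \<cdot> \<iota>Z i = c' i"
    using coprod_ex[OF CZ T'(6) c'(1)] by metis
  have cv: "c \<cdot> v = g'"
  proof (rule coprod_eqI[OF CY cmp_mor[OF v c] T'(2)])
    fix i assume i: "i \<in> I"
    have "c \<cdot> v \<cdot> \<iota>Y i = c \<cdot> (\<iota>Z i \<cdot> g i)" using v_\<iota>[OF i] v c \<iota>Y[OF i] by simp
    also have "\<dots> = c' i \<cdot> g i" using c_\<iota>[OF i] c \<iota>Z[OF i] XYZ[OF i] by (simp flip: assoc)
    finally show "c \<cdot> v \<cdot> \<iota>Y i = g' \<cdot> \<iota>Y i" using c'(2)[OF i] by simp
  qed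
  have hc: "h' \<cdot> c = w"
  proof (rule coprod_eqI[OF CZ cmp_mor[OF c T'(3)] w])
    fix i assume i: "i \<in> I"
    show "h' \<cdot> c \<cdot> \<iota>Z i = w \<cdot> \<iota>Z i" using w_\<iota>[OF i] c'(3)[OF i] c_\<iota>[OF i] c \<iota>Z[OF i] T' by simp
  qed
  have "is_iso T c"
  proof (rule iso_if_bij_cmp[OF c])
    \<comment> \<open>Cancellation: \<open>k\<close> kills \<open>g' = c \<cdot> v\<close>, so it
      factors as \<open>k' \<cdot> h'\<close>. Then \<open>k'\<close> kills \<open>w\<close>, hence
      on each summand it extends along \<open>\<Sigma>a 1 (f i)\<close>; the extensions assemble to
      \<open>k' = m \<cdot> \<Sigma>a 1 u\<close>, and \<open>\<Sigma>a 1 u \<cdot> h'\<close>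
      vanishes.\<close>
    fix k assume k: "k \<in> Mor T Z' Z'" and kc: "k \<cdot> c = azero T CZ Z'"
    have "k \<cdot> g' = k \<cdot> c \<cdot> v" using cv k c v by simp
    also have "\<dots> = azero T CY Z'" unfolding kc using v T' by simp
    finally obtain k' where k': "k' \<in> Mor T (\<Sigma>o 1 CX) Z'" "k' \<cdot> h' = k"
      using triangle_coexact2[OF D' k] by metis
    have "k' \<cdot> w = k' \<cdot> h' \<cdot> c" unfolding hc[symmetric] using k'(1) c T' by simp
    then have k'w: "k' \<cdot> w = azero T CZ Z'" using kc k'(2) by simp
    have "\<exists>m. m \<in> Mor T (\<Sigma>o 1 (Y i)) Z' \<and> m \<cdot> \<Sigma>a 1 (f i) = k' \<cdot> \<Sigma>a 1 (\<iota>X i)" if i: "i \<in> I" for i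
    proof -
      have "k' \<cdot> \<Sigma>a 1 (\<iota>X i) \<cdot> h i = k' \<cdot> (w \<cdot> \<iota>Z i)" using w_\<iota>[OF i] k' \<iota>X[OF i] XYZ[OF i] by simp
      also have "\<dots> = azero T (Z i) Z'" using cmp_eqD[OF k'w, of "\<iota>Z i"] k' w \<iota>Z[OF i] T' by simp
      finally show ?thesis
        using triangle_coexact3[OF D[OF i], of "k' \<cdot> \<Sigma>a 1 (\<iota>X i)" Z'] k' \<iota>X[OF i] by auto
    qed
    then obtain m' where m': "\<And>i. i \<in> I \<Longrightarrow> m' i \<in> Mor T (\<Sigma>o 1 (Y i)) Z'"
        "\<And>i. i \<in> I \<Longrightarrow> m' i \<cdot> \<Sigma>a 1 (f i) = k' \<cdot> \<Sigma>a 1 (\<iota>X i)"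
      by metis
    obtain m where m: "m \<in> Mor T (\<Sigma>o 1 CY) Z'" "\<And>i. i \<in> I \<Longrightarrow> m \<cdot> \<Sigma>a 1 (\<iota>Y i) = m' i"
      using coprod_ex[OF SY T'(6) m'(1)] by metis
    have "k' = m \<cdot> \<Sigma>a 1 u"
    proof (rule coprod_eqI[OF SX k'(1)])
      show "m \<cdot> \<Sigma>a 1 u \<in> Mor T (\<Sigma>o 1 CX) Z'" using m u by simp
      fix i assume i: "i \<in> I"
      have "m \<cdot> \<Sigma>a 1 u \<cdot> \<Sigma>a 1 (\<iota>X i) = m \<cdot> \<Sigma>a 1 (u \<cdot> \<iota>X i)" using m u \<iota>X[OF i] by simp
      also have "\<dots> = m \<cdot> \<Sigma>a 1 (\<iota>Y i) \<cdot> \<Sigma>a 1 (f i)" unfolding u_\<iota>[OF i] using m(1) \<iota>Y[OF i] XYZ[OF i] by simp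
      finally show "k' \<cdot> \<Sigma>a 1 (\<iota>X i) = m \<cdot> \<Sigma>a 1 u \<cdot> \<Sigma>a 1 (\<iota>X i)" using m(2)[OF i] m'(2)[OF i] by simp
    qed
    then have "k = m \<cdot> \<Sigma>a 1 u \<cdot> h'" using k'(2) by simp
    then have "k = m \<cdot> (\<Sigma>a 1 u \<cdot> h')" using m(1) u T' by simp
    then show "k = azero T Z' Z'" using triangle_cmp_zero'(2)[OF D'] m T' by simp
  next
    have "v \<cdot> u = azero T CX CZ"
    proof (rule coprod_zeroI[OF CX cmp_mor[OF u v]])
      fix i assume i: "i \<in> I"
      have "v \<cdot> u \<cdot> \<iota>X i = v \<cdot> \<iota>Y i \<cdot> f i" using u_\<iota>[OF i] u v \<iota>X[OF i] \<iota>Y[OF i] XYZ[OF i] by simp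
      also have "\<dots> = \<iota>Z i \<cdot> (g i \<cdot> f i)" unfolding v_\<iota>[OF i] using \<iota>Z[OF i] XYZ[OF i] by simp
      also have "\<dots> = azero T (X i) CZ" using triangle_cmp_zero[OF D[OF i]] \<iota>Z[OF i] XYZ[OF i] by simp
      finally show "v \<cdot> u \<cdot> \<iota>X i = azero T (X i) CZ" .
    qed
    then obtain s where s: "s \<in> Mor T Z' CZ" "s \<cdot> g' = v" using triangle_coexact[OF D' v] by metis
    \<comment> \<open>\<open>e\<close> is the defect of \<open>s\<close> as a left inverse of
      \<open>c\<close>. It kills \<open>v\<close>, so it factors through
      \<open>w = h' \<cdot> c\<close>, and adding this factor to \<open>s\<close> repairs the
      defect.\<close>
    define e where "e = idt T CZ \<boxplus> \<boxminus> (s \<cdot> c)"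
    have e: "e \<in> Mor T CZ CZ" using s c C by (simp add: e_def)
    have ev: "e \<cdot> v = azero T CY CZ" using s v c C cv by (simp add: e_def)
    have "\<exists>m. m \<in> Mor T (\<Sigma>o 1 (X i)) CZ \<and> m \<cdot> h i = e \<cdot> \<iota>Z i" if i: "i \<in> I" for i
    proof -
      have "e \<cdot> \<iota>Z i \<cdot> g i = e \<cdot> (v \<cdot> \<iota>Y i)" using v_\<iota>[OF i] e \<iota>Z[OF i] XYZ[OF i] by simp
      also have "\<dots> = azero T (Y i) CZ" using cmp_eqD[OF ev, of "\<iota>Y i"] e v \<iota>Y[OF i] C by simp
      finally show ?thesis
        using triangle_coexact2[OF D[OF i], of "e \<cdot> \<iota>Z i" CZ] e \<iota>Z[OF i] by auto
    qed
    then obtain m' where m': "\<And>i. i \<in> I \<Longrightarrow> m' i \<in> Mor T (\<Sigma>o 1 (X i)) CZ"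
        "\<And>i. i \<in> I \<Longrightarrow> m' i \<cdot> h i = e \<cdot> \<iota>Z i"
      by metis
    obtain m where m: "m \<in> Mor T (\<Sigma>o 1 CX) CZ" "\<And>i. i \<in> I \<Longrightarrow> m \<cdot> \<Sigma>a 1 (\<iota>X i) = m' i"
      using coprod_ex[OF SX C(3) m'(1)] by metis
    have "e = m \<cdot> w"
    proof (rule coprod_eqI[OF CZ e cmp_mor[OF w m(1)]])
      fix i assume i: "i \<in> I"
      have "m \<cdot> w \<cdot> \<iota>Z i = m \<cdot> \<Sigma>a 1 (\<iota>X i) \<cdot> h i" using w_\<iota>[OF i] m(1) w \<iota>Z[OF i] \<iota>X[OF i] XYZ[OF i] by simp
      then show "e \<cdot> \<iota>Z i = m \<cdot> w \<cdot> \<iota>Z i" using m(2)[OF i] m'(2)[OF i] by simp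
    qed
    then have "m \<cdot> h' \<cdot> c = e" using hc m(1) T' c by simp
    moreover have "s \<cdot> c \<in> Mor T CZ CZ" using s c by simp
    ultimately have "(s \<boxplus> m \<cdot> h') \<cdot> c = e \<boxplus> s \<cdot> c"
      using s(1) m(1) T' c e aadd_commute[of "s \<cdot> c" e] by simp
    also have "\<dots> = idt T CZ"
      unfolding e_def by (rule minus_cancel) (use s c C in simp_all)
    finally show "\<exists>k. k \<in> Mor T Z' CZ \<and> k \<cdot> c = idt T CZ"
      using s(1) m(1) T' by (intro exI[of _ "s \<boxplus> m \<cdot> h'"]) auto
  qed
  then obtain d where d: "d \<in> Mor T Z' CZ" "d \<cdot> c = idt T CZ" "c \<cdot> d = idt T Z'" using is_isoE[OF _ c] by metis
  have "triangle u v w CX CY CZ"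
  proof (rule triangle_iso[OF D' u v w idt_mor[OF C(1)] idt_mor[OF C(2)] d(1)])
    show "is_iso T d" using d c by (intro is_isoI)
    show "d \<cdot> g' = v \<cdot> idt T CY" using cmp_eqD[OF d(2), of v] d c v C cv by simp
    have "w \<cdot> d = h'" unfolding hc[symmetric] using d c T' by simp
    then show "\<Sigma>a 1 (idt T CX) \<cdot> h' = w \<cdot> d" using C T' by simp
  qed (use idt_iso C u in auto)
  then show ?thesis using that by blast
qed

text \<open>The diagonal \<open>b \<cdot> f = f' \<cdot> a\<close> has a cone \<open>Q\<close>, and
  the octahedral axiom for its two factorizations gives triangles \<open>Z -> Q -> B\<close> and
  \<open>A -> Q -> Z'\<close>. A third use, for the composite \<open>Z -> Q -> Z'\<close>, relates
  their ends.\<close>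

lemma triangle_3x3:
  assumes f: "triangle f g h X Y Z" and f': "triangle f' g' h' X' Y' Z'"
    and a: "triangle a a1 a2 X X' A" and b: "triangle b b1 b2 Y Y' B" and eq: "b \<cdot> f = f' \<cdot> a"
  obtains M p q r p' q' r' where "triangle p q r Z Z' M" "triangle p' q' r' A B M"
proof -
  have "b \<cdot> f \<in> Mor T X Y'" using triangleD[OF f] triangleD[OF b] by simp
  then obtain w w' Q where w: "triangle (b \<cdot> f) w w' X Y' Q" by (rule cone_ex)
  obtain j k x where j: "triangle j k x Z Q B" using triangle_octahedral[OF f b w] by metis
  obtain j' k' x' where j': "triangle j' k' x' A Q Z'" using triangle_octahedral[OF a f' w[unfolded eq]] by metis
  have "k' \<cdot> j \<in> Mor T Z Z'" using triangleD[OF j] triangleD[OF j'] by simp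
  then obtain q r M where q: "triangle (k' \<cdot> j) q r Z Z' M" by (rule cone_ex)
  obtain m n y where m: "triangle m n y B M (\<Sigma>o 1 A)" using triangle_octahedral[OF j triangle_rot[OF j'] q] by metis
  have "triangle (\<boxminus> \<Sigma>a (- 1) y) m n A B M" using triangle_unrot'[OF m] triangleD[OF j'] by simp
  then show ?thesis using that q by blast
qed

section \<open>Triangulated and localizing subcategories\<close>

lemma triangulated_subcatI:
  assumes "S \<subseteq> obj T" "S \<noteq> {}"
    and "\<And>X Y. X \<in> S \<Longrightarrow> isomorphic T X Y \<Longrightarrow> Y \<in> S"
    and "\<And>X. X \<in> S \<Longrightarrow> \<Sigma>o 1 X \<in> S" "\<And>X. X \<in> S \<Longrightarrow> \<Sigma>o (- 1) X \<in> S"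
    and "\<And>f g h X Y Z. triangle f g h X Y Z \<Longrightarrow> X \<in> S \<Longrightarrow> Y \<in> S \<Longrightarrow> Z \<in> S"
  shows "triangulated_subcat T S"
  unfolding triangulated_subcat_def
proof (intro conjI ballI impI)
  show "X \<in> S \<longleftrightarrow> susp_obj T X \<in> S" if "X \<in> obj T" for X
    using assms(4)[of X] assms(5)[of "\<Sigma>o 1 X"] that by (auto simp: susp_obj_eq)
  show "case t of (f, g, h) \<Rightarrow> src T f \<in> S \<longrightarrow> tgt T f \<in> S \<longrightarrow> tgt T g \<in> S" if "t \<in> tri T" for t
    using assms(6) triangle_tri that by (cases t) blast
qed (use assms in blast)+

context
  fixes S assumes S: "triangulated_subcat T S"
begin

lemma tsub_obj: "X \<in> S \<Longrightarrow> X \<in> obj T"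
  using S by (auto simp: triangulated_subcat_def)

lemma tsub_iso: "X \<in> S \<Longrightarrow> isomorphic T X Y \<Longrightarrow> Y \<in> S"
  using S isomorphic_obj unfolding triangulated_subcat_def by blast

lemma tsub_pow: assumes "X \<in> obj T" shows "\<Sigma>o n X \<in> S \<longleftrightarrow> X \<in> S"
proof (induction n rule: pow_induct)
  case (2 n)
  have "\<Sigma>o n X \<in> S \<longleftrightarrow> \<Sigma>o 1 (\<Sigma>o n X) \<in> S"
    using S assms unfolding triangulated_subcat_def susp_obj_eq by (metis obj_pow_obj)
  then show ?case using 2 assms by (simp add: add.commute)
next
  case (3 n)
  have "\<Sigma>o n X \<in> S \<longleftrightarrow> \<Sigma>o 1 (\<Sigma>o n X) \<in> S"
    using S assms unfolding triangulated_subcat_def susp_obj_eq by (metis obj_pow_obj)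
  then show ?case using 3 assms by (simp add: add.commute)
qed simp

lemma tsub_cone:
  assumes D: "triangle f g h X Y Z" and XY: "X \<in> S" "Y \<in> S" shows "Z \<in> S"
proof -
  have D': "(f, g, h) \<in> tri T" "src T f = X" "tgt T f = Y" "tgt T g = Z" using D unfolding triangle_iff by auto
  have "\<forall>(f, g, h)\<in>tri T. src T f \<in> S \<longrightarrow> tgt T f \<in> S \<longrightarrow> tgt T g \<in> S"
    using S by (simp add: triangulated_subcat_def)
  then show ?thesis using D'(1) XY unfolding D'(2-4)[symmetric] by blast
qed

lemma tsub_fst:
  assumes D: "triangle f g h X Y Z" and YZ: "Y \<in> S" "Z \<in> S" shows "X \<in> S"
  using tsub_cone[OF triangle_rot[OF D] YZ] tsub_pow[OF triangleD(4)[OF D]] by simp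

lemma tsub_snd:
  assumes D: "triangle f g h X Y Z" and XZ: "X \<in> S" "Z \<in> S" shows "Y \<in> S"
  using tsub_cone[OF triangle_rot[OF triangle_rot[OF D]] XZ(2)] XZ(1) tsub_pow[OF triangleD(4)[OF D]]
    tsub_pow[OF triangleD(5)[OF D]] by simp

lemma tsub_zero: assumes "is_zero_obj T Z" shows "Z \<in> S"
proof -
  obtain X where X: "X \<in> S" using S by (auto simp: triangulated_subcat_def)
  obtain g h N where N: "triangle (idt T X) g h X X N" using cone_ex[OF idt_mor[OF tsub_obj[OF X]]] .
  have N0: "is_zero_obj T N"
    unfolding triangle_zero_iso[OF N] by (rule idt_iso[OF tsub_obj[OF X]])
  have NS: "N \<in> S" by (rule tsub_cone[OF N X X])
  have NZ: "N \<in> obj T" "idt T N = azero T N N" "Z \<in> obj T" "idt T Z = azero T Z Z"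
    using N0 assms by (simp_all only: is_zero_obj_iff)
  then have "azero T N Z \<in> Mor T N Z" by simp
  moreover have "is_iso T (azero T N Z)"
    by (rule is_isoI[of _ N Z "azero T Z N"]) (use NZ in simp_all)
  ultimately have "isomorphic T N Z" unfolding isomorphic_def by blast
  then show ?thesis by (rule tsub_iso[OF NS])
qed

end

section \<open>Orthogonal objects and classes of extensions\<close>

definition orth where
  "orth A = {X \<in> obj T. \<forall>Y\<in>A. Mor T Y X = {azero T Y X}}"

lemma orth_zero: "X \<in> orth A \<Longrightarrow> Y \<in> A \<Longrightarrow> w \<in> Mor T Y X \<Longrightarrow> w = azero T Y X"
  by (auto simp: orth_def simp del: Mor_def)

lemma orthI:
  assumes "X \<in> obj T" "A \<subseteq> obj T" "\<And>Y w. Y \<in> A \<Longrightarrow> w \<in> Mor T Y X \<Longrightarrow> w = azero T Y X"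
  shows "X \<in> orth A"
proof -
  have "Mor T Y X = {azero T Y X}" if "Y \<in> A" for Y
    using assms(3)[OF that] azero_simps[of Y X] assms(1,2) that by auto
  then show ?thesis using assms(1) by (simp add: orth_def)
qed

lemma orth_pow:
  assumes A: "triangulated_subcat T A" and X: "X \<in> orth A"
  shows "\<Sigma>o n X \<in> orth A"
proof (rule orthI)
  have Xo: "X \<in> obj T" using X by (simp add: orth_def)
  then show "\<Sigma>o n X \<in> obj T" by simp
  fix Y w assume Y: "Y \<in> A" and w: "w \<in> Mor T Y (\<Sigma>o n X)"
  obtain v where v: "v \<in> Mor T (\<Sigma>o (- n) Y) X" "\<Sigma>a n v = w" using Mor_pow_lift[OF w Xo] .
  have "\<Sigma>o (- n) Y \<in> A" using Y tsub_pow[OF A] tsub_obj[OF A] by simp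
  then have "v = azero T (\<Sigma>o (- n) Y) X" using orth_zero[OF X] v by blast
  then show "w = azero T Y (\<Sigma>o n X)" using v Xo tsub_obj[OF A Y] by auto
qed (use tsub_obj[OF A] in blast)

text \<open>The kernel of composition with \<open>f\<close> comes from maps into
  \<open>\<Sigma>o (- 1) L\<close>, which vanish. With the next two lemmas this makes
  \<open>G -> X\<close> universal among maps from \<open>A\<close> and \<open>X -> L\<close>
  universal among maps to \<open>orth A\<close>.\<close>

lemma triangle_orth_mono:
  assumes A: "triangulated_subcat T A" and D: "triangle f g h G X L" and L: "L \<in> orth A"
    and W: "W \<in> A" "w \<in> Mor T W G" and eq: "f \<cdot> w = azero T W X"
  shows "w = azero T W G"
proof -
  obtain v where v: "v \<in> Mor T W (\<Sigma>o (- 1) L)" "(\<boxminus> \<Sigma>a (- 1) h) \<cdot> v = w"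
    using triangle_exact[OF triangle_unrot'[OF D] W(2) eq] .
  have "v = azero T W (\<Sigma>o (- 1) L)" using orth_zero[OF orth_pow[OF A L] W(1) v(1)] .
  then show ?thesis using v triangleD[OF D] tsub_obj[OF A W(1)] by simp
qed

lemma triangle_orth_epi:
  assumes A: "triangulated_subcat T A" and D: "triangle f g h G X L" and G: "G \<in> A"
    and W: "W \<in> orth A" "w \<in> Mor T L W" and eq: "w \<cdot> g = azero T X W"
  shows "w = azero T L W"
proof -
  obtain v where v: "v \<in> Mor T (\<Sigma>o 1 G) W" "v \<cdot> h = w"
    using triangle_coexact2[OF D W(2) eq] .
  have "v = azero T (\<Sigma>o 1 G) W" using orth_zero[OF W(1) _ v(1)] G tsub_pow[OF A] tsub_obj[OF A] by simp
  then show ?thesis using v triangleD[OF D] Mor_objD[OF W(2)] by simp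
qed

lemma triangle_orth_lift:
  assumes D: "triangle f g h G X L" and L: "L \<in> orth A" and W: "W \<in> A" "w \<in> Mor T W X"
  obtains v where "v \<in> Mor T W G" "f \<cdot> v = w"
  using triangle_exact[OF D W(2)] orth_zero[OF L W(1)] triangleD[OF D] cmp_mor[OF W(2)] by metis

text \<open>The universal properties give comparison maps in both directions; each composite differs
  from the identity by an arrow that the same properties force to be zero.\<close>

lemma triangle_orth_unique:
  assumes A: "triangulated_subcat T A"
    and D: "triangle f g h G X L" "G \<in> A" "L \<in> orth A" and D': "triangle f' g' h' G' X L'" "G' \<in> A" "L' \<in> orth A"
  shows "isomorphic T G G'" "isomorphic T L L'"
proof -
  note E = triangleD[OF D(1)] and E' = triangleD[OF D'(1)]
  obtain a where a: "a \<in> Mor T G G'" "f' \<cdot> a = f" using triangle_orth_lift[OF D'(1,3) D(2) E(1)] .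
  obtain b where b: "b \<in> Mor T G' G" "f \<cdot> b = f'" using triangle_orth_lift[OF D(1,3) D'(2) E'(1)] .
  have "b \<cdot> a \<boxplus> \<boxminus> idt T G = azero T G G"
    by (rule triangle_orth_mono[OF A D(1,3,2)]) (use a b E E' cmp_eqD[OF b(2), of a] in auto)
  then have 1: "b \<cdot> a = idt T G" using a b E minus_eq_zero_iff[of "b \<cdot> a" G G "idt T G"] by simp
  have "a \<cdot> b \<boxplus> \<boxminus> idt T G' = azero T G' G'"
    by (rule triangle_orth_mono[OF A D'(1,3,2)]) (use a b E E' cmp_eqD[OF a(2), of b] in auto)
  then have 2: "a \<cdot> b = idt T G'" using a b E' minus_eq_zero_iff[of "a \<cdot> b" G' G' "idt T G'"] by simp
  show "isomorphic T G G'" using is_isoI[OF a(1) b(1) 1 2] a(1) by (auto simp: isomorphic_def simp del: Mor_def)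
  have gf: "g' \<cdot> f = azero T G L'" "g \<cdot> f' = azero T G' L"
    using orth_zero[OF D'(3) D(2)] orth_zero[OF D(3) D'(2)] E E' by auto
  obtain c where c: "c \<in> Mor T L L'" "c \<cdot> g = g'" using triangle_coexact[OF D(1) E'(2) gf(1)] .
  obtain d where d: "d \<in> Mor T L' L" "d \<cdot> g' = g" using triangle_coexact[OF D'(1) E(2) gf(2)] .
  have "d \<cdot> c \<boxplus> \<boxminus> idt T L = azero T L L"
    by (rule triangle_orth_epi[OF A D(1,2,3)]) (use c d E E' in auto)
  then have 1: "d \<cdot> c = idt T L" using c d E minus_eq_zero_iff[of "d \<cdot> c" L L "idt T L"] by simp
  have "c \<cdot> d \<boxplus> \<boxminus> idt T L' = azero T L' L'"
    by (rule triangle_orth_epi[OF A D'(1,2,3)]) (use c d E E' in auto)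
  then have 2: "c \<cdot> d = idt T L'" using c d E' minus_eq_zero_iff[of "c \<cdot> d" L' L' "idt T L'"] by simp
  show "isomorphic T L L'" using is_isoI[OF c(1) d(1) 1 2] c(1) by (auto simp: isomorphic_def simp del: Mor_def)
qed

text \<open>The class commonly written \<open>U * V\<close>: middle terms of triangles that begin in
  \<open>U\<close> and end in \<open>V\<close>.\<close>

definition extensions where
  "extensions U V = {X. \<exists>f g h G L. triangle f g h G X L \<and> G \<in> U \<and> L \<in> V}"

lemma extensionsE:
  assumes "X \<in> extensions U V" obtains f g h G L where "triangle f g h G X L" "G \<in> U" "L \<in> V"
  using assms by (auto simp: extensions_def)

lemma extensionsI: "triangle f g h G X L \<Longrightarrow> G \<in> U \<Longrightarrow> L \<in> V \<Longrightarrow> X \<in> extensions U V"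
  unfolding extensions_def by blast

text \<open>Vanishing of maps from \<open>U\<close> to \<open>V\<close> lifts
  \<open>u \<cdot> f\<close> to a map \<open>G -> G'\<close> over \<open>u : X -> Y\<close>. The 3x3
  lemma then places the cone of \<open>u\<close> between a cone of \<open>G -> G'\<close> and a cone
  of a map \<open>L -> L'\<close>.\<close>

lemma extensions_triangulated:
  assumes U: "triangulated_subcat T U" and V: "triangulated_subcat T V"
    and UV: "\<And>G L w. G \<in> U \<Longrightarrow> L \<in> V \<Longrightarrow> w \<in> Mor T G L \<Longrightarrow> w = azero T G L"
  shows "triangulated_subcat T (extensions U V)"
proof (rule triangulated_subcatI)
  show "extensions U V \<subseteq> obj T" by (blast elim: extensionsE intro: triangleD(5))
  obtain N where N: "is_zero_obj T N" "N \<in> obj T" by (rule zero_obtain)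
  show "extensions U V \<noteq> {}"
    using extensionsI[OF triangle_idt[OF N(2,1)] tsub_zero[OF U N(1)] tsub_zero[OF V N(1)]] by blast
next
  fix X Y assume X: "X \<in> extensions U V" and iso: "isomorphic T X Y"
  obtain f g h G L where D: "triangle f g h G X L" "G \<in> U" "L \<in> V" using X by (rule extensionsE)
  note E = triangleD[OF D(1)]
  obtain b where b: "b \<in> Mor T X Y" "is_iso T b" using iso by (auto simp: isomorphic_def simp del: Mor_def)
  then obtain b' where b': "b' \<in> Mor T Y X" "b' \<cdot> b = idt T X" "b \<cdot> b' = idt T Y" using is_isoE by metis
  have "triangle (b \<cdot> f) (g \<cdot> b') h G Y L"
    by (rule triangle_iso[OF D(1) _ _ E(3) idt_mor[OF E(4)] b(1) idt_mor[OF E(6)] _ b(2)])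
      (use b(1) b' E idt_iso in simp_all)
  then show "Y \<in> extensions U V" using D(2,3) by (rule extensionsI)
next
  fix X assume X: "X \<in> extensions U V"
  obtain f g h G L where D: "triangle f g h G X L" "G \<in> U" "L \<in> V" using X by (rule extensionsE)
  note E = triangleD[OF D(1)]
  show "\<Sigma>o 1 X \<in> extensions U V"
    using extensionsI[OF triangle_shift[OF D(1)]] tsub_pow[OF U E(4)] tsub_pow[OF V E(6)] D(2,3) by simp
  show "\<Sigma>o (- 1) X \<in> extensions U V"
    using extensionsI[OF triangle_unshift[OF D(1)]] tsub_pow[OF U E(4)] tsub_pow[OF V E(6)] D(2,3) by simp
next
  fix u v w X Y Z assume D: "triangle u v w X Y Z" and X: "X \<in> extensions U V" and Y: "Y \<in> extensions U V"
  obtain f g h G L where X: "triangle f g h G X L" "G \<in> U" "L \<in> V" using X by (rule extensionsE)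
  obtain f' g' h' G' L' where Y: "triangle f' g' h' G' Y L'" "G' \<in> U" "L' \<in> V" using Y by (rule extensionsE)
  have uf: "u \<cdot> f \<in> Mor T G Y" using triangleD[OF D] triangleD[OF X(1)] by simp
  have "g' \<cdot> (u \<cdot> f) = azero T G L'" by (rule UV[OF X(2) Y(3)]) (use uf triangleD[OF Y(1)] in simp)
  then obtain a where a: "a \<in> Mor T G G'" "f' \<cdot> a = u \<cdot> f" using triangle_exact[OF Y(1) uf] by metis
  obtain a1 a2 A where A: "triangle a a1 a2 G G' A" using cone_ex[OF a(1)] .
  obtain M p q r p' q' r' where M: "triangle p q r L L' M" "triangle p' q' r' A Z M"
    using triangle_3x3[OF X(1) Y(1) A D a(2)[symmetric]] .
  show "Z \<in> extensions U V"
    by (rule extensionsI[OF M(2) tsub_cone[OF U A X(2) Y(2)] tsub_cone[OF V M(1) X(3) Y(3)]])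
qed

end

text \<open>A set smaller than \<open>\<kappa>\<close> injects into \<open>Field \<kappa>\<close>,
  so it is in bijection with a small set of the type on which \<open>\<kappa>\<close> lives.\<close>

lemma card_reindex:
  fixes \<kappa> :: "'i rel" and J :: "'j set"
  assumes \<kappa>: "Card_order \<kappa>" and J: "|J| <o \<kappa>"
  obtains I :: "'i set" and e where "bij_betw e I J" "|I| <o \<kappa>"
proof -
  have "|J| \<le>o |Field \<kappa>|"
    by (rule ordLeq_ordIso_trans[OF ordLess_imp_ordLeq[OF J] ordIso_symmetric[OF card_of_Field_ordIso[OF \<kappa>]]])
  then obtain f where f: "inj_on f J" "f ` J \<subseteq> Field \<kappa>" unfolding card_of_ordLeq[symmetric] by blast
  have I: "|f ` J| <o \<kappa>" by (rule ordLeq_ordLess_trans[OF card_of_image J])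
  have "bij_betw (inv_into J f) (f ` J) J" by (rule bij_betw_inv_into[OF inj_on_imp_bij_betw[OF f(1)]])
  then show ?thesis using I by (rule that)
qed

section \<open>Small coproducts and localizing subcategories\<close>

locale coproduct_cat = triangulated_cat T for \<kappa> :: "'i rel" and T :: "('o, 'a, 'x) tricat_scheme" (structure) +
  assumes Card_order_\<kappa>: "Card_order \<kappa>" and nat_less_\<kappa>: "natLeq <o \<kappa>"
    and has_coprods: "has_coproducts \<kappa> T"
begin

lemma coprod_obtain:
  fixes J :: "'j set"
  assumes "|J| <o \<kappa>" "\<And>j. j \<in> J \<Longrightarrow> X j \<in> obj T"
  obtains C \<iota> where "is_coproduct T J X C \<iota>"
proof -
  obtain I :: "'i set" and e where e: "bij_betw e I J" "|I| <o \<kappa>" using card_reindex[OF Card_order_\<kappa> assms(1)] .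
  have "(X \<circ> e) ` I \<subseteq> obj T" using assms(2) bij_betwE[OF e(1)] by auto
  then obtain C \<iota> where C: "is_coproduct T I (X \<circ> e) C \<iota>"
    using has_coprods e(2) unfolding has_coproducts_def by blast
  let ?e = "inv_into I e"
  have "is_coproduct T J (X \<circ> e \<circ> ?e) C (\<iota> \<circ> ?e)"
    by (rule coprod_reindex[OF bij_betw_inv_into[OF e(1)] C])
  then have "is_coproduct T J X C (\<iota> \<circ> ?e)"
    by (rule coprod_cong) (use e(1) in \<open>auto simp: bij_betw_inv_into_right\<close>)
  then show ?thesis by (rule that)
qed

abbreviation is_localizing where "is_localizing \<equiv> localizing \<kappa> T"
abbreviation Loc_of where "Loc_of \<equiv> Loc \<kappa> T"

lemma localizingI:
  assumes "triangulated_subcat T S"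
    and "\<And>(I :: 'i set) X C \<iota>. |I| <o \<kappa> \<Longrightarrow> (\<And>i. i \<in> I \<Longrightarrow> X i \<in> S) \<Longrightarrow> is_coproduct T I X C \<iota> \<Longrightarrow> C \<in> S"
  shows "is_localizing S"
  using assms unfolding localizing_def by blast

lemma localizing_triangulated: "is_localizing S \<Longrightarrow> triangulated_subcat T S"
  by (simp add: localizing_def)

lemma localizing_coprod:
  fixes J :: "'j set"
  assumes "is_localizing S" "|J| <o \<kappa>" "\<And>j. j \<in> J \<Longrightarrow> X j \<in> S" "is_coproduct T J X C \<iota>"
  shows "C \<in> S"
proof -
  obtain I :: "'i set" and e where e: "bij_betw e I J" "|I| <o \<kappa>" using card_reindex[OF Card_order_\<kappa> assms(2)] .
  have "(X \<circ> e) ` I \<subseteq> S" using assms(3) bij_betwE[OF e(1)] by auto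
  then show ?thesis
    using assms(1) e(2) coprod_reindex[OF e(1) assms(4)] unfolding localizing_def by blast
qed

lemma localizing_obj: "is_localizing (obj T)"
proof (rule localizingI[OF triangulated_subcatI])
  show "obj T \<noteq> {}" using ex_zero_obj is_zero_obj_obj by blast
  show "Z \<in> obj T" if "triangle f g h X Y Z" for f g h X Y Z using triangleD(6)[OF that] .
  show "Y \<in> obj T" if "isomorphic T X Y" for X Y using isomorphic_obj(2)[OF that] .
  show "C \<in> obj T" if "is_coproduct T I X C \<iota>" for I :: "'i set" and X C \<iota> using coprod_obj[OF that] .
qed auto

lemma localizing_Int: assumes "is_localizing S" "is_localizing S'" shows "is_localizing (S \<inter> S')"
proof (rule localizingI[OF triangulated_subcatI])
  note t = localizing_triangulated[OF assms(1)] localizing_triangulated[OF assms(2)]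
  show "S \<inter> S' \<subseteq> obj T" using tsub_obj[OF t(1)] by blast
  obtain N where N: "is_zero_obj T N" using ex_zero_obj by blast
  show "S \<inter> S' \<noteq> {}" using tsub_zero[OF t(1) N] tsub_zero[OF t(2) N] by blast
  show "Y \<in> S \<inter> S'" if "X \<in> S \<inter> S'" "isomorphic T X Y" for X Y
    using tsub_iso[OF t(1) _ that(2)] tsub_iso[OF t(2) _ that(2)] that(1) by simp
  show "\<Sigma>o 1 X \<in> S \<inter> S'" "\<Sigma>o (- 1) X \<in> S \<inter> S'" if "X \<in> S \<inter> S'" for X
    using that tsub_pow[OF t(1)] tsub_pow[OF t(2)] tsub_obj[OF t(1)] by auto
  show "Z \<in> S \<inter> S'" if "triangle f g h X Y Z" "X \<in> S \<inter> S'" "Y \<in> S \<inter> S'" for f g h X Y Z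
    using tsub_cone[OF t(1) that(1)] tsub_cone[OF t(2) that(1)] that(2,3) by simp
  show "C \<in> S \<inter> S'" if "|I| <o \<kappa>" "\<And>i. i \<in> I \<Longrightarrow> X i \<in> S \<inter> S'" "is_coproduct T I X C \<iota>"
    for I :: "'i set" and X C \<iota>
    using localizing_coprod[OF assms(1) that(1) _ that(3)] localizing_coprod[OF assms(2) that(1) _ that(3)] that(2) by simp
qed

lemma Loc_localizing: assumes "A \<subseteq> obj T" shows "is_localizing (Loc_of A)"
proof (rule localizingI[OF triangulated_subcatI])
  show "Loc_of A \<subseteq> obj T" using assms localizing_obj unfolding Loc_def by blast
  obtain N where N: "is_zero_obj T N" using ex_zero_obj by blast
  have "N \<in> Loc_of A" using tsub_zero[OF localizing_triangulated N] unfolding Loc_def by blast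
  then show "Loc_of A \<noteq> {}" by blast
  show "Y \<in> Loc_of A" if "X \<in> Loc_of A" "isomorphic T X Y" for X Y
    using that(1) tsub_iso[OF localizing_triangulated _ that(2)] unfolding Loc_def by simp
  have "X \<in> obj T" if "X \<in> Loc_of A" for X using that assms localizing_obj unfolding Loc_def by blast
  then show "\<Sigma>o 1 X \<in> Loc_of A" "\<Sigma>o (- 1) X \<in> Loc_of A" if "X \<in> Loc_of A" for X
    using that tsub_pow[OF localizing_triangulated] unfolding Loc_def by simp_all
  show "Z \<in> Loc_of A" if "triangle f g h X Y Z" "X \<in> Loc_of A" "Y \<in> Loc_of A" for f g h X Y Z
    using that(2,3) tsub_cone[OF localizing_triangulated that(1)] unfolding Loc_def by simp
  show "C \<in> Loc_of A" if "|I| <o \<kappa>" "\<And>i. i \<in> I \<Longrightarrow> X i \<in> Loc_of A" "is_coproduct T I X C \<iota>"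
    for I :: "'i set" and X C \<iota>
    unfolding Loc_def
  proof clarsimp
    fix S assume S: "is_localizing S" "A \<subseteq> S"
    then have "X i \<in> S" if "i \<in> I" for i using \<open>\<And>i. i \<in> I \<Longrightarrow> X i \<in> Loc_of A\<close>[OF that] unfolding Loc_def by blast
    then show "C \<in> S" using localizing_coprod[OF S(1) that(1) _ that(3)] by blast
  qed
qed

lemma Loc_incl: "A \<subseteq> Loc_of A"
  unfolding Loc_def by blast

lemma Loc_min: "is_localizing S \<Longrightarrow> A \<subseteq> S \<Longrightarrow> Loc_of A \<subseteq> S"
  unfolding Loc_def by blast

lemma Loc_self: "X \<in> Loc_of {X}"
  using Loc_incl by blast

text \<open>Maps into a fixed object turn triangles into exact sequences and coproducts into
  products. The exact sequence of a cone involves \<open>\<Sigma>o 1 X\<close>, whence the closure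
  of \<open>V\<close> under shifts.\<close>

lemma lorth_localizing:
  assumes V: "V \<subseteq> obj T" "\<And>X n. X \<in> V \<Longrightarrow> \<Sigma>o n X \<in> V"
  shows "is_localizing {Y \<in> obj T. \<forall>X\<in>V. \<forall>w\<in>Mor T Y X. w = azero T Y X}" (is "is_localizing ?S")
proof (rule localizingI[OF triangulated_subcatI])
  obtain N where N: "is_zero_obj T N" "N \<in> obj T" by (rule zero_obtain)
  then have "N \<in> ?S" using zero_src_eq by blast
  then show "?S \<noteq> {}" by blast
  show "Y \<in> ?S" if "X \<in> ?S" "isomorphic T X Y" for X Y
  proof -
    obtain f where f: "f \<in> Mor T X Y" "is_iso T f"
      using \<open>isomorphic T X Y\<close> by (auto simp: isomorphic_def simp del: Mor_def)
    then obtain f' where f': "f' \<in> Mor T Y X" "f \<cdot> f' = idt T Y" using is_isoE by metis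
    have "w = azero T Y W" if W: "W \<in> V" "w \<in> Mor T Y W" for W w
    proof -
      have "w \<cdot> f = azero T X W" using \<open>X \<in> ?S\<close> W cmp_mor[OF f(1) W(2)] by blast
      then have "w \<cdot> f \<cdot> f' = azero T Y W" using f' Mor_objD[OF f(1)] Mor_objD[OF W(2)] by simp
      then show ?thesis using f f' W by simp
    qed
    then show ?thesis using that isomorphic_obj by blast
  qed
  have pow: "\<Sigma>o n Y \<in> ?S" if Y: "Y \<in> ?S" for Y n
  proof -
    have "w = azero T (\<Sigma>o n Y) X" if X: "X \<in> V" "w \<in> Mor T (\<Sigma>o n Y) X" for X w
    proof -
      have "\<Sigma>a (- n) w \<in> Mor T Y (\<Sigma>o (- n) X)" using X Y by simp
      then have "\<Sigma>a (- n) w = azero T Y (\<Sigma>o (- n) X)" using Y V(2)[OF X(1)] by blast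
      then have "\<Sigma>a n (\<Sigma>a (- n) w) = \<Sigma>a n (azero T Y (\<Sigma>o (- n) X))" by simp
      then show ?thesis using X Y V by auto
    qed
    then show ?thesis using Y by (simp del: Mor_def)
  qed
  then show "\<Sigma>o 1 X \<in> ?S" "\<Sigma>o (- 1) X \<in> ?S" if "X \<in> ?S" for X using that by blast+
  show "Z \<in> ?S" if D: "triangle f g h X Y Z" and X: "X \<in> ?S" and Y: "Y \<in> ?S" for f g h X Y Z
  proof -
    note E = triangleD[OF D]
    have "w = azero T Z W" if W: "W \<in> V" "w \<in> Mor T Z W" for W w
    proof -
      have "w \<cdot> g = azero T Y W" using Y W cmp_mor[OF E(2) W(2)] by blast
      then obtain v where v: "v \<in> Mor T (\<Sigma>o 1 X) W" "v \<cdot> h = w" using triangle_coexact2[OF D W(2)] by blast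
      then have "v = azero T (\<Sigma>o 1 X) W" using pow[OF X] W by blast
      then show ?thesis using v E Mor_objD[OF W(2)] by simp
    qed
    then show ?thesis using E by blast
  qed
  show "C \<in> ?S" if "|I| <o \<kappa>" "\<And>i. i \<in> I \<Longrightarrow> X i \<in> ?S" "is_coproduct T I X C \<iota>"
    for I :: "'i set" and X C \<iota>
  proof -
    have "w = azero T C W" if W: "W \<in> V" "w \<in> Mor T C W" for W w
    proof (rule coprod_zeroI[OF \<open>is_coproduct T I X C \<iota>\<close> W(2)])
      fix i assume i: "i \<in> I"
      show "w \<cdot> \<iota> i = azero T (X i) W"
        using \<open>\<And>i. i \<in> I \<Longrightarrow> X i \<in> ?S\<close>[OF i] W cmp_mor[OF coprod_inj[OF \<open>is_coproduct T I X C \<iota>\<close> i] W(2)] by blast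
    qed
    then show ?thesis using coprod_obj[OF that(3)] by blast
  qed
qed auto

text \<open>Triangles chosen for the summands have a coproduct triangle with middle term
  \<open>C\<close>, whose outer terms stay in \<open>U\<close> and in \<open>V\<close>.\<close>

lemma extensions_localizing:
  assumes U: "is_localizing U" and V: "is_localizing V"
    and UV: "\<And>G L w. G \<in> U \<Longrightarrow> L \<in> V \<Longrightarrow> w \<in> Mor T G L \<Longrightarrow> w = azero T G L"
  shows "is_localizing (extensions U V)"
proof (rule localizingI[OF extensions_triangulated[OF localizing_triangulated[OF U] localizing_triangulated[OF V] UV]])
  fix I :: "'i set" and X C \<iota> assume I: "|I| <o \<kappa>" and X: "\<And>i. i \<in> I \<Longrightarrow> X i \<in> extensions U V" and C: "is_coproduct T I X C \<iota>"
  have "\<forall>i\<in>I. \<exists>f g h G L. triangle f g h G (X i) L \<and> G \<in> U \<and> L \<in> V" using X by (simp add: extensions_def)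
  then obtain f g h G L where D: "\<And>i. i \<in> I \<Longrightarrow> triangle (f i) (g i) (h i) (G i) (X i) (L i)"
      and G: "\<And>i. i \<in> I \<Longrightarrow> G i \<in> U" and L: "\<And>i. i \<in> I \<Longrightarrow> L i \<in> V"
    by metis
  obtain CG \<iota>G where CG: "is_coproduct T I G CG \<iota>G" using coprod_obtain[OF I triangleD(4)[OF D]] .
  obtain CL \<iota>L where CL: "is_coproduct T I L CL \<iota>L" using coprod_obtain[OF I triangleD(6)[OF D]] .
  obtain u where u: "u \<in> Mor T CG C" "\<And>i. i \<in> I \<Longrightarrow> u \<cdot> \<iota>G i = \<iota> i \<cdot> f i"
    using coprod_ex[OF CG coprod_obj[OF C] cmp_mor[OF triangleD(1)[OF D] coprod_inj[OF C]]] by metis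
  obtain v w where "triangle u v w CG C CL" using coprod_triangle[OF D CG C CL u] .
  then show "C \<in> extensions U V" using localizing_coprod[OF U I G CG] localizing_coprod[OF V I L CL] by (rule extensionsI)
qed

section \<open>Smashing localizations\<close>

text \<open>Three conditions at once: every object has a torsion and a local part, the local objects
  are closed under small coproducts, and the torsion part of \<open>X\<close> is built from
  \<open>X\<close>. The last one makes the notion stable under intersection.\<close>

definition smashing where
  "smashing A \<longleftrightarrow> is_localizing A \<and> is_localizing (orth A) \<and>
     (\<forall>X\<in>obj T. \<exists>f g h G L. triangle f g h G X L \<and> G \<in> A \<and> G \<in> Loc_of {X} \<and> L \<in> orth A)"

lemma smashingE:
  assumes "smashing A" "X \<in> obj T"
  obtains f g h G L where "triangle f g h G X L" "G \<in> A" "G \<in> Loc_of {X}" "L \<in> orth A"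
  using assms unfolding smashing_def by blast

text \<open>Take the \<open>B\<close>-torsion part \<open>G\<close> of \<open>X\<close> and then the
  \<open>A\<close>-torsion part \<open>G'\<close> of \<open>G\<close>. It stays in \<open>B\<close>
  because \<open>G' \<in> Loc_of {G}\<close>. By the octahedral axiom the cone of
  \<open>G' -> X\<close> is an extension of the \<open>B\<close>-local \<open>L\<close> by an
  \<open>A\<close>-local object of \<open>B\<close>.\<close>

lemma smashing_Int:
  assumes A: "smashing A" and B: "smashing B" shows "smashing (A \<inter> B)"
proof -
  have lA: "is_localizing A" "is_localizing (orth A)" and lB: "is_localizing B" "is_localizing (orth B)" using A B by (auto simp: smashing_def)
  note tA = localizing_triangulated[OF lA(1)] and tB = localizing_triangulated[OF lB(1)]
  note lAB = localizing_Int[OF lA(1) lB(1)]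
  note tAB = localizing_triangulated[OF lAB]
  \<comment> \<open>This class will turn out to be the orthogonal of \<open>A \<inter> B\<close>. As
    a class of extensions with no nonzero maps from the first part to the second, it is seen to be
    localizing before that is known.\<close>
  let ?O = "extensions (B \<inter> orth A) (orth B)"
  have lO: "is_localizing ?O"
  proof (rule extensions_localizing[OF localizing_Int[OF lB(1) lA(2)] lB(2)])
    show "w = azero T G L" if "G \<in> B \<inter> orth A" "L \<in> orth B" "w \<in> Mor T G L" for G L w
      using orth_zero[OF that(2) _ that(3)] that(1) by simp
  qed
  have O_sub: "?O \<subseteq> orth (A \<inter> B)"
  proof
    fix X assume "X \<in> ?O"
    then obtain f g h G L where D: "triangle f g h G X L" "G \<in> B \<inter> orth A" "L \<in> orth B" by (rule extensionsE)
    show "X \<in> orth (A \<inter> B)"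
    proof (rule orthI)
      show "X \<in> obj T" using triangleD(5)[OF D(1)] .
      show "A \<inter> B \<subseteq> obj T" using tsub_obj[OF tA] by blast
      fix Y w assume Y: "Y \<in> A \<inter> B" "w \<in> Mor T Y X"
      have YAB: "Y \<in> A" "Y \<in> B" and G: "G \<in> orth A" using Y D(2) by simp_all
      obtain v where v: "v \<in> Mor T Y G" "f \<cdot> v = w" using triangle_orth_lift[OF D(1,3) YAB(2) Y(2)] .
      have "v = azero T Y G" by (rule orth_zero[OF G YAB(1) v(1)])
      then show "w = azero T Y X" using v triangleD[OF D(1)] Mor_objD[OF Y(2)] by simp
    qed
  qed
  have tri: "\<exists>f g h G L. triangle f g h G X L \<and> G \<in> A \<inter> B \<and> G \<in> Loc_of {X} \<and> L \<in> ?O" if X: "X \<in> obj T" for X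
  proof -
    obtain f g h G L where D: "triangle f g h G X L" "G \<in> B" "G \<in> Loc_of {X}" "L \<in> orth B" using smashingE[OF B X] .
    note E = triangleD[OF D(1)]
    obtain f' g' h' G' L' where D': "triangle f' g' h' G' G L'" "G' \<in> A" "G' \<in> Loc_of {G}" "L' \<in> orth A"
      using smashingE[OF A E(4)] .
    note E' = triangleD[OF D'(1)]
    have sub: "Loc_of {G} \<subseteq> B" by (rule Loc_min[OF lB(1)]) (use D(2) in simp)
    have sub': "Loc_of {G} \<subseteq> Loc_of {X}" by (rule Loc_min[OF Loc_localizing]) (use D(3) X in simp_all)
    have "f \<cdot> f' \<in> Mor T G' X" using E E' by simp
    then obtain w w' U where w: "triangle (f \<cdot> f') w w' G' X U" by (rule cone_ex)
    obtain j k l where j: "triangle j k l L' U L" using triangle_octahedral[OF D'(1) D(1) w] by metis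
    have G': "G' \<in> B" "G' \<in> Loc_of {X}" using D'(3) sub sub' by auto
    have "L' \<in> B" by (rule tsub_cone[OF tB D'(1) G'(1) D(2)])
    then have "U \<in> ?O" using D(4) D'(4) by (intro extensionsI[OF j]) auto
    then show ?thesis using w D'(2) G' by (intro exI conjI IntI)
  qed
  have "orth (A \<inter> B) \<subseteq> ?O"
  proof
    fix X assume X: "X \<in> orth (A \<inter> B)"
    then have Xo: "X \<in> obj T" by (simp add: orth_def)
    obtain f g h G L where D: "triangle f g h G X L" "G \<in> A \<inter> B" "L \<in> ?O" using tri[OF Xo] by blast
    note E = triangleD[OF D(1)]
    \<comment> \<open>\<open>X\<close> receives no nonzero map from its torsion part, while
      \<open>f\<close> can be cancelled on maps out of torsion objects; so \<open>G\<close> is zero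
      and \<open>X\<close> is isomorphic to \<open>L\<close>.\<close>
    have "f = azero T G X" using orth_zero[OF X D(2) E(1)] .
    then have "f \<cdot> idt T G = azero T G X" using E by simp
    moreover have "L \<in> orth (A \<inter> B)" using D(3) O_sub by blast
    ultimately have "idt T G = azero T G G"
      using triangle_orth_mono[OF tAB D(1) _ D(2) idt_mor[OF E(4)]] by simp
    then have "is_iso T g" using triangle_zero_fst[OF D(1)] E by (simp add: is_zero_obj_iff)
    then have "isomorphic T X L" using E(2) by (auto simp: isomorphic_def simp del: Mor_def)
    then show "X \<in> ?O" using tsub_iso[OF localizing_triangulated[OF lO] D(3)] isomorphic_sym by blast
  qed
  then have "orth (A \<inter> B) = ?O" using O_sub by (rule subset_antisym)
  then have "is_localizing (orth (A \<inter> B))" "\<forall>X\<in>obj T. \<exists>f g h G L. triangle f g h G X L \<and> G \<in> A \<inter> B \<and> G \<in> Loc_of {X} \<and> L \<in> orth (A \<inter> B)"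
    using lO tri by (simp_all only:) blast
  then show ?thesis unfolding smashing_def using lAB by (intro conjI)
qed

end

context coproduct_cat
begin

section \<open>Telescopes\<close>

fun transition :: "_ \<Rightarrow> _ \<Rightarrow> nat \<Rightarrow> nat \<Rightarrow> _" where
  "transition X x n 0 = idt T (X n)"
| "transition X x n (Suc k) = x (n + k) \<cdot> transition X x n k"

text \<open>Homotopy colimit of the sequence \<open>X\<close>, as the cone of identity minus shift
  on the coproduct \<open>A\<close>. The canonical map from stage \<open>n\<close> is
  \<open>c \<cdot> \<iota> n\<close>.\<close>

definition telescope where
  "telescope X x A \<iota> s c d H \<longleftrightarrow> (\<forall>n. x n \<in> Mor T (X n) (X (Suc n))) \<and>
     is_coproduct T (UNIV :: nat set) X A \<iota> \<and> s \<in> Mor T A A \<and> (\<forall>n. s \<cdot> \<iota> n = \<iota> (Suc n) \<cdot> x n) \<and>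
     triangle (idt T A \<boxplus> \<boxminus> s) c d A A H"

lemma nat_small: "|UNIV :: nat set| <o \<kappa>"
  using ordIso_ordLess_trans[OF card_of_nat nat_less_\<kappa>] .

lemma telescope_ex:
  assumes x: "\<And>n :: nat. x n \<in> Mor T (X n) (X (Suc n))"
  obtains A \<iota> s c d H where "telescope X x A \<iota> s c d H"
proof -
  obtain A \<iota> where A: "is_coproduct T (UNIV :: nat set) X A \<iota>"
    using coprod_obtain[OF nat_small Mor_objD(1)[OF x]] .
  note \<iota> = coprod_inj[OF A UNIV_I] and Ao = coprod_obj[OF A]
  obtain s where s: "s \<in> Mor T A A" "\<And>n. s \<cdot> \<iota> n = \<iota> (Suc n) \<cdot> x n"
    using coprod_ex[OF A Ao, of "\<lambda>n. \<iota> (Suc n) \<cdot> x n"] cmp_mor[OF x \<iota>] by (metis UNIV_I)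
  have "idt T A \<boxplus> \<boxminus> s \<in> Mor T A A" using s Ao by simp
  then obtain c d H where "triangle (idt T A \<boxplus> \<boxminus> s) c d A A H" by (rule cone_ex)
  then show ?thesis using that A s x unfolding telescope_def by blast
qed

context
  fixes X x A \<iota> s c d H
  assumes tel: "telescope X x A \<iota> s c d H"
begin

lemma tel_x: "x n \<in> Mor T (X n) (X (Suc n))"
  and tel_A: "is_coproduct T (UNIV :: nat set) X A \<iota>"
  and tel_s: "s \<in> Mor T A A" "s \<cdot> \<iota> n = \<iota> (Suc n) \<cdot> x n"
  and tel_triangle: "triangle (idt T A \<boxplus> \<boxminus> s) c d A A H"
  using tel unfolding telescope_def by blast+

lemmas tel_D = triangleD[OF tel_triangle]
lemmas tel_\<iota> = coprod_inj[OF tel_A UNIV_I]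

lemma tel_X: "X n \<in> obj T"
  using Mor_objD(1)[OF tel_x] .

lemma transition_Mor: "transition X x n k \<in> Mor T (X n) (X (n + k))"
proof (induction k)
  case (Suc k)
  then show ?case using tel_x[of "n + k"] by simp
qed (use tel_X in simp)

lemma tel_j: "c \<cdot> \<iota> n \<in> Mor T (X n) H"
  using tel_\<iota> tel_D by simp

lemma tel_cs: "c \<cdot> s = c"
proof -
  have "c \<cdot> (idt T A \<boxplus> \<boxminus> s) = azero T A H" by (rule triangle_cmp_zero[OF tel_triangle])
  then have "c \<boxplus> \<boxminus> (c \<cdot> s) = azero T A H" using tel_D tel_s(1) by simp
  then show ?thesis using minus_eq_zero_iff[of c A H "c \<cdot> s"] tel_D tel_s(1) by simp
qed

lemma tel_jx: "c \<cdot> \<iota> (Suc n) \<cdot> x n = c \<cdot> \<iota> n"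
proof -
  have "c \<cdot> \<iota> (Suc n) \<cdot> x n = c \<cdot> (s \<cdot> \<iota> n)" unfolding tel_s(2) using tel_D(2) tel_\<iota> tel_x by simp
  also have "\<dots> = c \<cdot> \<iota> n" using cmp_eqD[OF tel_cs, of "\<iota> n"] tel_D(2) tel_\<iota> tel_s(1) by simp
  finally show ?thesis .
qed

lemma tel_jtransition: "c \<cdot> \<iota> (n + k) \<cdot> transition X x n k = c \<cdot> \<iota> n"
proof (induction k)
  case 0
  then show ?case using tel_j[of n] by simp
next
  case (Suc k)
  have "c \<cdot> \<iota> (n + Suc k) \<cdot> transition X x n (Suc k) = c \<cdot> \<iota> (Suc (n + k)) \<cdot> x (n + k) \<cdot> transition X x n k"
    using tel_j tel_x[of "n + k"] transition_Mor[of n k] by (simp del: assoc flip: assoc)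
  then show ?case unfolding tel_jx using Suc by simp
qed

text \<open>A compatible family is a map \<open>u\<close> on the coproduct with
  \<open>u \<cdot> s = u\<close>; it kills identity minus shift and so extends over the cone. A
  homotopy colimit guarantees existence of the extension only.\<close>

lemma tel_desc:
  assumes g: "\<And>n. g n \<in> Mor T (X n) W" and gx: "\<And>n. g (Suc n) \<cdot> x n = g n"
  obtains v where "v \<in> Mor T H W" "\<And>n. v \<cdot> (c \<cdot> \<iota> n) = g n"
proof -
  have W: "W \<in> obj T" using Mor_objD(2)[OF g] .
  obtain u where u: "u \<in> Mor T A W" "\<And>n. u \<cdot> \<iota> n = g n" using coprod_ex[OF tel_A W, of g] g by (metis UNIV_I)
  have "u \<cdot> s = u"
  proof (rule coprod_eqI[OF tel_A cmp_mor[OF tel_s(1) u(1)] u(1)])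
    fix n
    have "u \<cdot> s \<cdot> \<iota> n = u \<cdot> \<iota> (Suc n) \<cdot> x n"
      using u(1) tel_s tel_\<iota> tel_x by simp
    then show "u \<cdot> s \<cdot> \<iota> n = u \<cdot> \<iota> n" using u(2) gx by simp
  qed
  then have "u \<cdot> (idt T A \<boxplus> \<boxminus> s) = azero T A W" using u(1) tel_s(1) tel_D W by simp
  then obtain v where v: "v \<in> Mor T H W" "v \<cdot> c = u" using triangle_coexact[OF tel_triangle u(1)] by metis
  have "v \<cdot> (c \<cdot> \<iota> n) = g n" for n
    using cmp_eqD[OF v(2), of "\<iota> n"] v(1) tel_\<iota> tel_D(2) u(2) by simp
  then show ?thesis using that v(1) by blast
qed

text \<open>Coordinates on the coproduct: \<open>\<pi> n\<close> is the identity on summand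
  \<open>n\<close> and zero on the others. The shift carries coordinate \<open>n\<close> along
  \<open>x n\<close> to coordinate \<open>Suc n\<close> and leaves coordinate \<open>0\<close>
  empty.\<close>

lemma tel_proj:
  obtains \<pi> where "\<And>n. \<pi> n \<in> Mor T A (X n)"
    "\<And>n m. \<pi> n \<cdot> \<iota> m = (if m = n then idt T (X n) else azero T (X m) (X n))"
    "\<And>n. \<pi> (Suc n) \<cdot> s = x n \<cdot> \<pi> n" "\<pi> 0 \<cdot> s = azero T A (X 0)"
proof -
  have "\<exists>p. p \<in> Mor T A (X n) \<and> (\<forall>m. p \<cdot> \<iota> m = (if m = n then idt T (X n) else azero T (X m) (X n)))" for n
  proof -
    have "(if m = n then idt T (X n) else azero T (X m) (X n)) \<in> Mor T (X m) (X n)" for m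
      using tel_X by simp
    then show ?thesis
      using coprod_ex[OF tel_A tel_X, of "\<lambda>m. if m = n then idt T (X n) else azero T (X m) (X n)" n]
      by (metis (no_types, lifting) UNIV_I)
  qed
  then obtain \<pi> where \<pi>: "\<And>n. \<pi> n \<in> Mor T A (X n)"
    "\<And>n m. \<pi> n \<cdot> \<iota> m = (if m = n then idt T (X n) else azero T (X m) (X n))" by metis
  have "\<pi> (Suc n) \<cdot> s = x n \<cdot> \<pi> n" for n
  proof (rule coprod_eqI[OF tel_A cmp_mor[OF tel_s(1) \<pi>(1)] cmp_mor[OF \<pi>(1) tel_x]])
    fix m
    have "\<pi> (Suc n) \<cdot> s \<cdot> \<iota> m = \<pi> (Suc n) \<cdot> \<iota> (Suc m) \<cdot> x m" using \<pi>(1) tel_s tel_\<iota> tel_x by simp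
    moreover have "x n \<cdot> \<pi> n \<cdot> \<iota> m = x n \<cdot> (\<pi> n \<cdot> \<iota> m)" using \<pi>(1) tel_\<iota> tel_x by simp
    ultimately show "\<pi> (Suc n) \<cdot> s \<cdot> \<iota> m = x n \<cdot> \<pi> n \<cdot> \<iota> m"
      unfolding \<pi>(2) using tel_x[of m] tel_x[of n] tel_X by simp
  qed
  moreover have "\<pi> 0 \<cdot> s = azero T A (X 0)"
  proof (rule coprod_zeroI[OF tel_A cmp_mor[OF tel_s(1) \<pi>(1)]])
    fix m
    have "\<pi> 0 \<cdot> s \<cdot> \<iota> m = \<pi> 0 \<cdot> \<iota> (Suc m) \<cdot> x m" using \<pi>(1) tel_s tel_\<iota> tel_x by simp
    then show "\<pi> 0 \<cdot> s \<cdot> \<iota> m = azero T (X m) (X 0)" unfolding \<pi>(2) using tel_x[of m] tel_X by simp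
  qed
  ultimately show ?thesis using that \<pi> by blast
qed

end

text \<open>For a constant sequence identity minus shift has a left inverse, so the connecting map
  \<open>d\<close> vanishes. Arrows out of \<open>H\<close> are then determined on \<open>A\<close>,
  where all canonical maps \<open>c \<cdot> \<iota> n\<close> coincide.\<close>

lemma telescope_const:
  assumes tel: "telescope (\<lambda>n. X) (\<lambda>n. idt T X) A \<iota> s c d H"
  shows "isomorphic T X H"
proof -
  note D = tel_D[OF tel] and \<iota> = tel_\<iota>[OF tel] and s = tel_s[OF tel] and j = tel_j[OF tel]
  have X: "X \<in> obj T" using tel_X[OF tel] .
  have s\<iota>: "s \<cdot> \<iota> n = \<iota> (Suc n)" for n using s(2)[of n] \<iota>[of "Suc n"] X by simp
  obtain q where q: "q \<in> Mor T H X" "\<And>n. q \<cdot> (c \<cdot> \<iota> n) = idt T X"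
    using tel_desc[OF tel, of "\<lambda>n. idt T X" X] X by auto
  have jn: "c \<cdot> \<iota> n = c \<cdot> \<iota> 0" for n
  proof (induction n)
    case (Suc n)
    have "c \<cdot> \<iota> (Suc n) = c \<cdot> \<iota> n" using tel_jx[OF tel, of n] j[of "Suc n"] X by simp
    then show ?case using Suc by simp
  qed simp
  \<comment> \<open>\<open>\<rho>' n\<close> is minus the sum of \<open>\<iota> 0\<close> up to
    \<open>\<iota> (n - 1)\<close>, the solution of \<open>\<rho> - \<rho> \<cdot> s = 1\<close>
    obtained summand by summand: its value at \<open>n\<close> minus its value at
    \<open>Suc n\<close> is \<open>\<iota> n\<close>.\<close>
  define \<rho>' where "\<rho>' = rec_nat (azero T X A) (\<lambda>n r. r \<boxplus> \<boxminus> \<iota> n)"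
  have \<rho>'_Suc: "\<rho>' (Suc n) = \<rho>' n \<boxplus> \<boxminus> \<iota> n" for n by (simp add: \<rho>'_def)
  have \<rho>': "\<rho>' n \<in> Mor T X A" for n
  proof (induction n)
    case 0 show ?case using X D by (simp add: \<rho>'_def)
  next
    case (Suc n) then show ?case using \<iota>[of n] by (simp add: \<rho>'_Suc)
  qed
  obtain \<rho> where \<rho>: "\<rho> \<in> Mor T A A" "\<And>n. \<rho> \<cdot> \<iota> n = \<rho>' n" using coprod_ex[OF tel_A[OF tel] D(4), of \<rho>'] \<rho>' by (metis UNIV_I)
  have "\<rho> \<cdot> (idt T A \<boxplus> \<boxminus> s) = idt T A"
  proof (rule coprod_eqI[OF tel_A[OF tel]])
    fix n
    have "\<rho> \<cdot> (idt T A \<boxplus> \<boxminus> s) \<cdot> \<iota> n = \<rho> \<cdot> \<iota> n \<boxplus> \<boxminus> (\<rho> \<cdot> (s \<cdot> \<iota> n))"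
      using \<rho>(1) s(1) \<iota> D by simp
    also have "\<dots> = \<rho>' n \<boxplus> \<boxminus> (\<rho>' n \<boxplus> \<boxminus> \<iota> n)" unfolding s\<iota> \<rho>(2) \<rho>'_Suc by simp
    also have "\<dots> = \<iota> n"
    proof -
      have "\<iota> n \<boxplus> (\<rho>' n \<boxplus> \<boxminus> \<iota> n) = \<rho>' n"
        using \<rho>'[of n] \<iota>[of n] aadd_commute[of "\<iota> n" "\<rho>' n \<boxplus> \<boxminus> \<iota> n"] minus_cancel[of "\<rho>' n" X A "\<iota> n"] by simp
      then have "\<rho>' n \<boxplus> \<boxminus> (\<rho>' n \<boxplus> \<boxminus> \<iota> n) = \<iota> n \<boxplus> (\<rho>' n \<boxplus> \<boxminus> \<iota> n) \<boxplus> \<boxminus> (\<rho>' n \<boxplus> \<boxminus> \<iota> n)" by simp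
      also have "\<dots> = \<iota> n"
        using \<rho>'[of n] \<iota>[of n] by (subst aadd_assoc) simp_all
      finally show ?thesis .
    qed
    finally show "\<rho> \<cdot> (idt T A \<boxplus> \<boxminus> s) \<cdot> \<iota> n = idt T A \<cdot> \<iota> n" using \<iota>[of n] D by simp
  qed (use \<rho>(1) s(1) D in simp_all)
  then have split: "\<Sigma>a 1 \<rho> \<cdot> \<Sigma>a 1 (idt T A \<boxplus> \<boxminus> s) = idt T (\<Sigma>o 1 A)"
    using arr_pow_cmp[of "idt T A \<boxplus> \<boxminus> s" \<rho> 1] \<rho>(1) s(1) D(4) by (simp del: arr_pow_aadd arr_pow_cmp flip: arr_pow_cmp)
  have "\<Sigma>a 1 \<rho> \<cdot> (\<Sigma>a 1 (idt T A \<boxplus> \<boxminus> s) \<cdot> d) = d"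
    using cmp_eqD[OF split, of d] \<rho>(1) s(1) D by simp
  then have d0: "d = azero T H (\<Sigma>o 1 A)"
    using triangle_cmp_zero'(2)[OF tel_triangle[OF tel]] \<rho>(1) D by simp
  define k where "k = c \<cdot> \<iota> 0"
  have k: "k \<in> Mor T X H" using j by (simp add: k_def)
  have qk: "q \<cdot> k = idt T X" using q(2) by (simp add: k_def)
  have "k \<cdot> q \<cdot> c = c"
  proof (rule coprod_eqI[OF tel_A[OF tel]])
    fix n
    have "k \<cdot> q \<cdot> c \<cdot> \<iota> n = k \<cdot> (q \<cdot> (c \<cdot> \<iota> n))" using k q(1) D \<iota>[of n] by simp
    then show "k \<cdot> q \<cdot> c \<cdot> \<iota> n = c \<cdot> \<iota> n" unfolding q(2) jn[of n] using k X by (simp add: k_def)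
  qed (use k q D in simp_all)
  then have "(k \<cdot> q \<boxplus> \<boxminus> idt T H) \<cdot> c = azero T A H" using k q(1) D by simp
  then obtain v where v: "v \<in> Mor T (\<Sigma>o 1 A) H" "v \<cdot> d = k \<cdot> q \<boxplus> \<boxminus> idt T H"
    using triangle_coexact2[OF tel_triangle[OF tel], of "k \<cdot> q \<boxplus> \<boxminus> idt T H" H] k q(1) D by auto
  have "k \<cdot> q \<boxplus> \<boxminus> idt T H = azero T H H" unfolding v(2)[symmetric] d0 using v(1) D by simp
  then have "k \<cdot> q = idt T H" using minus_eq_zero_iff[of "k \<cdot> q" H H "idt T H"] k q(1) D by simp
  then have "is_iso T k" using is_isoI[OF k q(1) qk] by simp
  then show ?thesis using k unfolding isomorphic_def by blast
qed

lemma triangle_iso_fst: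
  assumes D: "triangle f g h X Y Z" and iso: "isomorphic T X' X"
  obtains f' h' where "triangle f' g h' X' Y Z"
proof -
  obtain a where a: "a \<in> Mor T X' X" "is_iso T a" using iso unfolding isomorphic_def by blast
  obtain b where b: "b \<in> Mor T X X'" "b \<cdot> a = idt T X'" "a \<cdot> b = idt T X" using is_isoE[OF a(2,1)] .
  note E = triangleD[OF D]
  have "triangle (f \<cdot> a) g (\<Sigma>a 1 b \<cdot> h) X' Y Z"
    by (rule triangle_iso[OF D _ E(2) _ b(1) idt_mor[OF E(5)] idt_mor[OF E(6)] is_isoI[OF b(1) a(1) b(3,2)]])
      (use a(1) b E idt_iso in simp_all)
  then show ?thesis by (rule that)
qed

text \<open>The telescope of \<open>X\<close> is compared with the constant telescope on \<open>X 0\<close>, whose cone is \<open>X 0\<close>;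
  the 3x3 lemma then puts the cone of \<open>X 0 \<rightarrow> H\<close> into \<open>S\<close>.\<close>

lemma telescope_cone:
  assumes tel: "telescope X x A \<iota> s c d H" and S: "is_localizing S"
    and cones: "\<And>n. \<exists>g h N. triangle (x n) g h (X n) (X (Suc n)) N \<and> N \<in> S"
  obtains f g h G where "triangle f g h G (X 0) H" "G \<in> S"
proof -
  note tS = localizing_triangulated[OF S]
  note X = tel_X[OF tel] and D = tel_D[OF tel] and \<iota> = tel_\<iota>[OF tel] and s = tel_s[OF tel] and x = tel_x[OF tel]
  let ?t = "transition X x 0"
  have t: "?t n \<in> Mor T (X 0) (X n)" for n using transition_Mor[OF tel, of 0 n] by simp
  \<comment> \<open>The octahedral axiom along \<open>?t (Suc n) = x n \<cdot> ?t n\<close> keeps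
    the cones of all composites from stage \<open>0\<close> in \<open>S\<close>.\<close>
  have cn: "\<exists>g h N. triangle (?t n) g h (X 0) (X n) N \<and> N \<in> S" for n
  proof (induction n)
    case 0
    obtain N where N: "is_zero_obj T N" "N \<in> obj T" by (rule zero_obtain)
    have "triangle (?t 0) (azero T (X 0) N) (azero T N (\<Sigma>o 1 (X 0))) (X 0) (X 0) N" using triangle_idt[OF X N(1)] by simp
    then show ?case using tsub_zero[OF tS N(1)] by blast
  next
    case (Suc n)
    obtain g h N where 1: "triangle (?t n) g h (X 0) (X n) N" "N \<in> S" using Suc by blast
    obtain g' h' N' where 2: "triangle (x n) g' h' (X n) (X (Suc n)) N'" "N' \<in> S" using cones by blast
    obtain g'' h'' N'' where 3: "triangle (?t (Suc n)) g'' h'' (X 0) (X (Suc n)) N''" using cone_ex[OF t] .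
    have oct: "triangle (x n \<cdot> ?t n) g'' h'' (X 0) (X (Suc n)) N''" using 3 by simp
    obtain j k l where "triangle j k l N N'' N'" using triangle_octahedral[OF 1(1) 2(1) oct] by metis
    then have "N'' \<in> S" using tsub_snd[OF tS] 1(2) 2(2) by blast
    then show ?case using 3 by blast
  qed
  obtain g h N where N: "\<And>n. triangle (?t n) (g n) (h n) (X 0) (X n) (N n)" "\<And>n. N n \<in> S" using cn by metis
  obtain CN \<iota>N where CN: "is_coproduct T (UNIV :: nat set) N CN \<iota>N"
    using coprod_obtain[OF nat_small triangleD(6)[OF N(1)]] .
  have CNS: "CN \<in> S" by (rule localizing_coprod[OF S nat_small N(2) CN])
  obtain A0 \<iota>0 s0 c0 d0 H0 where tel0: "telescope (\<lambda>n. X 0) (\<lambda>n. idt T (X 0)) A0 \<iota>0 s0 c0 d0 H0"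
    using telescope_ex[of "\<lambda>n. idt T (X 0)" "\<lambda>n. X 0"] idt_mor[OF X] by metis
  note \<iota>0 = tel_\<iota>[OF tel0] and s0 = tel_s[OF tel0] and D0 = tel_D[OF tel0]
  have s0\<iota>: "s0 \<cdot> \<iota>0 n = \<iota>0 (Suc n)" for n using s0(2)[of n] \<iota>0[of "Suc n"] by simp
  obtain a where a: "a \<in> Mor T A0 A" "\<And>n. a \<cdot> \<iota>0 n = \<iota> n \<cdot> ?t n"
    using coprod_ex[OF tel_A[OF tel0] D(4), of "\<lambda>n. \<iota> n \<cdot> ?t n"] cmp_mor[OF t \<iota>] by (metis UNIV_I)
  obtain v w where va: "triangle a v w A0 A CN"
    using coprod_triangle[OF N(1) tel_A[OF tel0] tel_A[OF tel] CN a(1) a(2)] .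
  have "s \<cdot> a = a \<cdot> s0"
  proof (rule coprod_eqI[OF tel_A[OF tel0] cmp_mor[OF a(1) s(1)] cmp_mor[OF s0(1) a(1)]])
    fix n
    have "s \<cdot> a \<cdot> \<iota>0 n = s \<cdot> \<iota> n \<cdot> ?t n" using a s(1) \<iota>0[of n] \<iota>[of n] t[of n] by simp
    also have "\<dots> = \<iota> (Suc n) \<cdot> ?t (Suc n)" unfolding s(2) using \<iota>[of "Suc n"] x[of n] t[of n] by simp
    also have "\<dots> = a \<cdot> (s0 \<cdot> \<iota>0 n)" unfolding s0\<iota> a(2) by simp
    finally show "s \<cdot> a \<cdot> \<iota>0 n = a \<cdot> s0 \<cdot> \<iota>0 n" using a(1) s0(1) \<iota>0[of n] by simp
  qed
  then have "a \<cdot> (idt T A0 \<boxplus> \<boxminus> s0) = (idt T A \<boxplus> \<boxminus> s) \<cdot> a" using a(1) s(1) s0(1) D D0 by simp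
  \<comment> \<open>Here \<open>a\<close>, with cone \<open>CN\<close>, serves as both vertical maps
    between the two arrows identity minus shift. So \<open>M\<close> is the cone of an endomorphism
    of \<open>CN\<close> as well as the cone of a map \<open>H0 -> H\<close>.\<close>
  then obtain M p q r p' q' r' where M: "triangle p q r H0 H M" "triangle p' q' r' CN CN M"
    using triangle_3x3[OF tel_triangle[OF tel0] tel_triangle[OF tel] va va] by metis
  have MS: "M \<in> S" by (rule tsub_cone[OF tS M(2) CNS CNS])
  obtain p'' r'' where "triangle p'' q r'' (X 0) H M" using triangle_iso_fst[OF M(1) telescope_const[OF tel0]] .
  from triangle_unrot'[OF this] show ?thesis
    by (rule that) (use tsub_pow[OF tS triangleD(6)[OF M(1)]] MS in simp)
qed

end

text \<open>Compactness enters as an induction rule: every map from \<open>C\<close> into a small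
  coproduct is a finite sum of maps through single summands. The generators are closed under shifts
  so that statements in degree zero cover all degrees.\<close>

locale generated_cat = coproduct_cat \<kappa> T for \<kappa> :: "'i rel" and T :: "('o, 'a, 'x) tricat_scheme" (structure) +
  fixes K :: "'o set"
  assumes K_obj: "C \<in> K \<Longrightarrow> C \<in> obj T"
    and K_pow: "C \<in> K \<Longrightarrow> \<Sigma>o n C \<in> K"
    and K_compact: "\<And>(I :: 'i set) X S \<iota> e P. C \<in> K \<Longrightarrow> |I| <o \<kappa> \<Longrightarrow> is_coproduct T I X S \<iota> \<Longrightarrow>
      (\<And>i. i \<in> I \<Longrightarrow> X i \<in> obj T) \<Longrightarrow> e \<in> Mor T C S \<Longrightarrow> P (azero T C S) \<Longrightarrow>
      (\<And>i f. i \<in> I \<Longrightarrow> f \<in> Mor T C (X i) \<Longrightarrow> P (\<iota> i \<cdot> f)) \<Longrightarrow>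
      (\<And>u v. u \<in> Mor T C S \<Longrightarrow> v \<in> Mor T C S \<Longrightarrow> P u \<Longrightarrow> P v \<Longrightarrow> P (u \<boxplus> v)) \<Longrightarrow> P e"
    and K_gen: "Loc_of K = obj T"
begin

text \<open>The rule of the locale for index sets of any type, as required for telescopes indexed by
  natural numbers.\<close>

lemma K_induct:
  fixes J :: "'j set"
  assumes C: "C \<in> K" and J: "|J| <o \<kappa>" and S: "is_coproduct T J X S \<iota>" and X: "\<And>j. j \<in> J \<Longrightarrow> X j \<in> obj T"
    and e: "e \<in> Mor T C S" and zero: "P (azero T C S)"
    and inj: "\<And>j f. j \<in> J \<Longrightarrow> f \<in> Mor T C (X j) \<Longrightarrow> P (\<iota> j \<cdot> f)"
    and add: "\<And>u v. u \<in> Mor T C S \<Longrightarrow> v \<in> Mor T C S \<Longrightarrow> P u \<Longrightarrow> P v \<Longrightarrow> P (u \<boxplus> v)"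
  shows "P e"
proof -
  obtain I :: "'i set" and b where b: "bij_betw b I J" "|I| <o \<kappa>" using card_reindex[OF Card_order_\<kappa> J] .
  have bJ: "b i \<in> J" if "i \<in> I" for i using bij_betwE[OF b(1)] that by blast
  show ?thesis
  proof (rule K_compact[OF C b(2) coprod_reindex[OF b(1) S] _ e, of P])
    show "(X \<circ> b) i \<in> obj T" if "i \<in> I" for i using X[OF bJ[OF that]] by simp
    show "P ((\<iota> \<circ> b) i \<cdot> f)" if "i \<in> I" "f \<in> Mor T C ((X \<circ> b) i)" for i f
      using inj[OF bJ[OF that(1)]] that(2) by (simp del: Mor_def)
  qed (fact zero add)+
qed

text \<open>The objects without nonzero maps to any shift of \<open>X\<close> form a localizing
  subcategory. It contains \<open>K\<close>, hence every object, in particular \<open>X\<close>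
  itself; so the identity of \<open>X\<close> is zero.\<close>

lemma K_conservative:
  assumes X: "X \<in> obj T" and 0: "\<And>C w. C \<in> K \<Longrightarrow> w \<in> Mor T C X \<Longrightarrow> w = azero T C X"
  shows "is_zero_obj T X"
proof -
  let ?S = "{Y \<in> obj T. \<forall>W\<in>range (\<lambda>n. \<Sigma>o n X). \<forall>w\<in>Mor T Y W. w = azero T Y W}"
  have S: "is_localizing ?S"
  proof (rule lorth_localizing)
    show "range (\<lambda>n. \<Sigma>o n X) \<subseteq> obj T" using X by auto
    show "\<Sigma>o n W \<in> range (\<lambda>n. \<Sigma>o n X)" if "W \<in> range (\<lambda>n. \<Sigma>o n X)" for W n
      using that X by auto
  qed
  have "w = azero T C (\<Sigma>o n X)" if C: "C \<in> K" and w: "w \<in> Mor T C (\<Sigma>o n X)" for C n w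
  proof -
    obtain v where v: "v \<in> Mor T (\<Sigma>o (- n) C) X" "\<Sigma>a n v = w" using Mor_pow_lift[OF w X] .
    have "v = azero T (\<Sigma>o (- n) C) X" by (rule 0[OF K_pow[OF C] v(1)])
    then show ?thesis using v(2) K_obj[OF C] X by simp
  qed
  then have "C \<in> ?S" if "C \<in> K" for C using K_obj[OF that] that by (simp del: Mor_def)
  then have "K \<subseteq> ?S" by (rule subsetI)
  from Loc_min[OF S this] X have "X \<in> ?S" unfolding K_gen by (rule subsetD)
  then have "\<forall>W\<in>range (\<lambda>n. \<Sigma>o n X). \<forall>w\<in>Mor T X W. w = azero T X W"
    unfolding mem_Collect_eq by (rule conjunct2)
  then have "\<forall>w\<in>Mor T X X. w = azero T X X"
    by (rule bspec) (rule range_eqI[of _ _ 0], simp)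
  then have "idt T X = azero T X X" using idt_mor[OF X] by (rule bspec)
  then show ?thesis using X by (simp add: is_zero_obj_iff)
qed

text \<open>The cone of \<open>f\<close> receives no nonzero map from \<open>K\<close>: its boundary
  is killed by \<open>\<Sigma>a 1 f\<close>, hence zero by injectivity on a shifted generator, so
  the map comes from \<open>Y\<close>, by surjectivity from \<open>X\<close>, and dies.\<close>

lemma K_isoI:
  assumes f: "f \<in> Mor T X Y"
    and inj: "\<And>C w. C \<in> K \<Longrightarrow> w \<in> Mor T C X \<Longrightarrow> f \<cdot> w = azero T C Y \<Longrightarrow> w = azero T C X"
    and surj: "\<And>C w. C \<in> K \<Longrightarrow> w \<in> Mor T C Y \<Longrightarrow> \<exists>v\<in>Mor T C X. f \<cdot> v = w"
  shows "is_iso T f"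
proof -
  obtain g h Z where D: "triangle f g h X Y Z" using cone_ex[OF f] .
  note E = triangleD[OF D]
  have "is_zero_obj T Z"
  proof (rule K_conservative[OF E(6)])
    fix C w assume C: "C \<in> K" and w: "w \<in> Mor T C Z"
    note Co = K_obj[OF C]
    have "h \<cdot> w \<in> Mor T C (\<Sigma>o 1 X)" using w E by simp
    then obtain v where v: "v \<in> Mor T (\<Sigma>o (- 1) C) X" "\<Sigma>a 1 v = h \<cdot> w" using Mor_pow_lift E(4) by metis
    have "\<Sigma>a 1 (f \<cdot> v) = \<Sigma>a 1 f \<cdot> (h \<cdot> w)" using v(1) E by (simp flip: v(2))
    also have "\<dots> = azero T C (\<Sigma>o 1 Y)" using cmp_eqD[OF triangle_cmp_zero'(2)[OF D], of w] w E Co by simp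
    finally have "\<Sigma>a 1 (f \<cdot> v) = azero T (\<Sigma>o 1 (\<Sigma>o (- 1) C)) (\<Sigma>o 1 Y)" using Co by simp
    then have "f \<cdot> v = azero T (\<Sigma>o (- 1) C) Y" using arr_pow_eq_zero_iff[of "f \<cdot> v" "\<Sigma>o (- 1) C" Y 1] v(1) E by simp
    then have "v = azero T (\<Sigma>o (- 1) C) X" by (rule inj[OF K_pow[OF C] v(1)])
    then have "h \<cdot> w = azero T C (\<Sigma>o 1 X)" using E Co by (simp flip: v(2))
    then obtain u where u: "u \<in> Mor T C Y" "g \<cdot> u = w" using triangle_exact2[OF D w] by metis
    obtain t where t: "t \<in> Mor T C X" "f \<cdot> t = u" using surj[OF C u(1)] by metis
    have "g \<cdot> (f \<cdot> t) = azero T C Z" using cmp_eqD[OF triangle_cmp_zero[OF D], of t] t(1) E by simp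
    then show "w = azero T C Z" using t(2) u(2) by simp
  qed
  then show ?thesis by (rule triangle_zero_iso[OF D, THEN iffD1])
qed

section \<open>Maps from the generators into a telescope\<close>

context
  fixes X x A \<iota> s c d H
  assumes tel: "telescope X x A \<iota> s c d H"
begin

text \<open>Identity minus shift is injective on maps from \<open>C\<close>: if
  \<open>s \<cdot> e = e\<close>, coordinate \<open>0\<close> of \<open>e\<close> vanishes and each
  coordinate is the image of the previous one. By compactness \<open>e\<close> involves finitely
  many summands, so vanishing coordinates force \<open>e\<close> to vanish.\<close>

lemma tel_K_zero:
  assumes C: "C \<in> K" and e: "e \<in> Mor T C A" and se: "s \<cdot> e = e"
  shows "e = azero T C A"
proof -
  note XX = tel_X[OF tel] and D = tel_D[OF tel] and \<iota> = tel_\<iota>[OF tel] and s = tel_s[OF tel] and x = tel_x[OF tel]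
  note Co = K_obj[OF C]
  obtain \<pi> where \<pi>: "\<And>n. \<pi> n \<in> Mor T A (X n)"
    "\<And>n m. \<pi> n \<cdot> \<iota> m = (if m = n then idt T (X n) else azero T (X m) (X n))"
    "\<And>n. \<pi> (Suc n) \<cdot> s = x n \<cdot> \<pi> n" "\<pi> 0 \<cdot> s = azero T A (X 0)" using tel_proj[OF tel] by metis
  have \<pi>0: "\<pi> n \<cdot> e = azero T C (X n)" for n
  proof (induction n)
    case 0
    have "\<pi> 0 \<cdot> (s \<cdot> e) = azero T C (X 0)" using cmp_eqD[OF \<pi>(4), of e] \<pi>(1)[of 0] s(1) e XX by simp
    then show ?case unfolding se .
  next
    case (Suc n)
    have "\<pi> (Suc n) \<cdot> (s \<cdot> e) = x n \<cdot> (\<pi> n \<cdot> e)"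
      using cmp_eqD[OF \<pi>(3)[of n], of e] \<pi>(1) s(1) e x[of n] by simp
    also have "\<dots> = azero T C (X (Suc n))" unfolding Suc using x[of n] Co by simp
    finally show ?case unfolding se .
  qed
  \<comment> \<open>\<open>p n\<close> projects the coproduct onto its first \<open>n\<close>
    summands; compactness gives \<open>p n \<cdot> e = e\<close> for large \<open>n\<close>.\<close>
  define p where "p = rec_nat (azero T A A) (\<lambda>n r. r \<boxplus> \<iota> n \<cdot> \<pi> n)"
  have p_Suc: "p (Suc n) = p n \<boxplus> \<iota> n \<cdot> \<pi> n" for n by (simp add: p_def)
  have p: "p n \<in> Mor T A A" for n
  proof (induction n)
    case 0 show ?case using D by (simp add: p_def)
  next
    case (Suc n) then show ?case using \<iota>[of n] \<pi>(1)[of n] by (simp add: p_Suc)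
  qed
  have p\<iota>: "p n \<cdot> \<iota> m = (if m < n then \<iota> m else azero T (X m) A)" for n m
  proof (induction n)
    case 0 show ?case using D \<iota>[of m] by (simp add: p_def)
  next
    case (Suc n)
    have "p (Suc n) \<cdot> \<iota> m = p n \<cdot> \<iota> m \<boxplus> \<iota> n \<cdot> (\<pi> n \<cdot> \<iota> m)"
      unfolding p_Suc using p[of n] \<iota>[of n] \<iota>[of m] \<pi>(1)[of n] by simp
    then show ?case unfolding Suc \<pi>(2) using \<iota>[of n] \<iota>[of m] XX D by (auto simp: less_Suc_eq)
  qed
  have "\<exists>N. \<forall>n\<ge>N. p n \<cdot> e = e"
  proof (rule K_induct[OF C nat_small tel_A[OF tel] XX e, of "\<lambda>e. \<exists>N. \<forall>n\<ge>N. p n \<cdot> e = e"])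
    show "\<exists>N. \<forall>n\<ge>N. p n \<cdot> azero T C A = azero T C A" using p Co by simp
  next
    fix j f assume f: "f \<in> Mor T C (X j)"
    have "p n \<cdot> (\<iota> j \<cdot> f) = \<iota> j \<cdot> f" if "n \<ge> Suc j" for n
      using cmp_eqD[OF p\<iota>[of n j], of f] p[of n] \<iota>[of j] f that by simp
    then show "\<exists>N. \<forall>n\<ge>N. p n \<cdot> (\<iota> j \<cdot> f) = \<iota> j \<cdot> f" by blast
  next
    fix u v assume u: "u \<in> Mor T C A" and v: "v \<in> Mor T C A"
      and "\<exists>N. \<forall>n\<ge>N. p n \<cdot> u = u" "\<exists>N. \<forall>n\<ge>N. p n \<cdot> v = v"
    then obtain N N' where N: "\<And>n. n \<ge> N \<Longrightarrow> p n \<cdot> u = u" "\<And>n. n \<ge> N' \<Longrightarrow> p n \<cdot> v = v" by blast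
    have "p n \<cdot> (u \<boxplus> v) = u \<boxplus> v" if "n \<ge> max N N'" for n
      using N[of n] that p[of n] u v by simp
    then show "\<exists>N. \<forall>n\<ge>N. p n \<cdot> (u \<boxplus> v) = u \<boxplus> v" by blast
  qed
  moreover have "p n \<cdot> e = azero T C A" for n
  proof (induction n)
    case 0 show ?case using D e Co by (simp add: p_def)
  next
    case (Suc n)
    have "p (Suc n) \<cdot> e = p n \<cdot> e \<boxplus> \<iota> n \<cdot> (\<pi> n \<cdot> e)"
      unfolding p_Suc using p[of n] \<iota>[of n] e \<pi>(1)[of n] by simp
    then show ?case unfolding Suc \<pi>0 using \<iota>[of n] Co D by simp
  qed
  ultimately show ?thesis by auto
qed

text \<open>The boundary \<open>d \<cdot> e\<close> is the suspension of a map fixed by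
  \<open>s\<close>, hence zero by the previous lemma, so \<open>e\<close> comes from the coproduct.
  Its finitely many components can be pushed to one common stage.\<close>

lemma tel_K_surj:
  assumes C: "C \<in> K" and e: "e \<in> Mor T C H"
  obtains n f where "f \<in> Mor T C (X n)" "c \<cdot> \<iota> n \<cdot> f = e"
proof -
  note XX = tel_X[OF tel] and D = tel_D[OF tel] and \<iota> = tel_\<iota>[OF tel] and s = tel_s[OF tel] and x = tel_x[OF tel]
  note Co = K_obj[OF C] and j = tel_j[OF tel] and t = transition_Mor[OF tel]
  let ?\<delta> = "idt T A \<boxplus> \<boxminus> s"
  have "d \<cdot> e \<in> Mor T C (\<Sigma>o 1 A)" using e D by simp
  then obtain v where v: "v \<in> Mor T (\<Sigma>o (- 1) C) A" "\<Sigma>a 1 v = d \<cdot> e" using Mor_pow_lift D(4) by metis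
  have "\<Sigma>a 1 (?\<delta> \<cdot> v) = \<Sigma>a 1 ?\<delta> \<cdot> (d \<cdot> e)"
    unfolding v(2)[symmetric] by (rule arr_pow_cmp) (use v(1) D in simp_all)
  also have "\<dots> = azero T C (\<Sigma>o 1 A)" using cmp_eqD[OF triangle_cmp_zero'(2)[OF tel_triangle[OF tel]], of e] e D Co by simp
  finally have "\<Sigma>a 1 (?\<delta> \<cdot> v) = azero T (\<Sigma>o 1 (\<Sigma>o (- 1) C)) (\<Sigma>o 1 A)" using Co by simp
  then have "?\<delta> \<cdot> v = azero T (\<Sigma>o (- 1) C) A"
    using arr_pow_eq_zero_iff[OF cmp_mor[OF v(1) D(1)], of 1] by simp
  then have "v \<boxplus> \<boxminus> (s \<cdot> v) = azero T (\<Sigma>o (- 1) C) A" using v(1) s(1) D by simp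
  then have "s \<cdot> v = v" using minus_eq_zero_iff[of v "\<Sigma>o (- 1) C" A "s \<cdot> v"] v(1) s(1) by simp
  then have "v = azero T (\<Sigma>o (- 1) C) A" by (rule tel_K_zero[OF K_pow[OF C] v(1)])
  then have "d \<cdot> e = azero T C (\<Sigma>o 1 A)" using D Co by (simp flip: v(2))
  then obtain u where u: "u \<in> Mor T C A" "c \<cdot> u = e" using triangle_exact2[OF tel_triangle[OF tel] e] by metis
  \<comment> \<open>Passing to a later stage does not change the map into \<open>H\<close>; two
    representatives from stages \<open>n\<close> and \<open>m\<close> meet at stage
    \<open>n + m\<close>.\<close>
  have up: "\<exists>f\<in>Mor T C (X (n + k)). c \<cdot> \<iota> (n + k) \<cdot> f = c \<cdot> \<iota> n \<cdot> g" if g: "g \<in> Mor T C (X n)" for g n k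
  proof (rule bexI[of _ "transition X x n k \<cdot> g"])
    have "c \<cdot> \<iota> (n + k) \<cdot> transition X x n k \<cdot> g = c \<cdot> \<iota> (n + k) \<cdot> (transition X x n k \<cdot> g)"
      by (rule assoc) (use j[of "n + k"] t[of n k] g in simp_all)
    then show "c \<cdot> \<iota> (n + k) \<cdot> (transition X x n k \<cdot> g) = c \<cdot> \<iota> n \<cdot> g" unfolding tel_jtransition[OF tel] by simp
  qed (use t g in simp)
  have "\<exists>n. \<exists>f\<in>Mor T C (X n). c \<cdot> \<iota> n \<cdot> f = c \<cdot> u"
  proof (rule K_induct[OF C nat_small tel_A[OF tel] XX u(1), of "\<lambda>u. \<exists>n. \<exists>f\<in>Mor T C (X n). c \<cdot> \<iota> n \<cdot> f = c \<cdot> u"])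
    have "azero T C (X 0) \<in> Mor T C (X 0)" "c \<cdot> \<iota> 0 \<cdot> azero T C (X 0) = c \<cdot> azero T C A"
      using j[of 0] Co XX D \<iota> by simp_all
    then show "\<exists>n. \<exists>f\<in>Mor T C (X n). c \<cdot> \<iota> n \<cdot> f = c \<cdot> azero T C A" by blast
  next
    fix n f assume f: "f \<in> Mor T C (X n)"
    have "c \<cdot> \<iota> n \<cdot> f = c \<cdot> (\<iota> n \<cdot> f)" by (rule assoc) (use f \<iota>[of n] D in simp_all)
    then show "\<exists>m. \<exists>g\<in>Mor T C (X m). c \<cdot> \<iota> m \<cdot> g = c \<cdot> (\<iota> n \<cdot> f)" using f by blast
  next
    fix u v assume u: "u \<in> Mor T C A" and v: "v \<in> Mor T C A"
      and "\<exists>n. \<exists>f\<in>Mor T C (X n). c \<cdot> \<iota> n \<cdot> f = c \<cdot> u" "\<exists>n. \<exists>f\<in>Mor T C (X n). c \<cdot> \<iota> n \<cdot> f = c \<cdot> v"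
    then obtain n f m g where f: "f \<in> Mor T C (X n)" "c \<cdot> \<iota> n \<cdot> f = c \<cdot> u"
      and g: "g \<in> Mor T C (X m)" "c \<cdot> \<iota> m \<cdot> g = c \<cdot> v" by blast
    obtain f' where f': "f' \<in> Mor T C (X (n + m))" "c \<cdot> \<iota> (n + m) \<cdot> f' = c \<cdot> u"
      using up[OF f(1), of m] f(2) by auto
    obtain g' where g': "g' \<in> Mor T C (X (n + m))" "c \<cdot> \<iota> (n + m) \<cdot> g' = c \<cdot> v"
      using up[OF g(1), of n] g(2) by (auto simp: add.commute)
    have "c \<cdot> \<iota> (n + m) \<cdot> (f' \<boxplus> g') = c \<cdot> \<iota> (n + m) \<cdot> f' \<boxplus> c \<cdot> \<iota> (n + m) \<cdot> g'"
      by (rule cmp_aadd'[of f' g']) (use f'(1) g'(1) j[of "n + m"] in simp_all)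
    also have "\<dots> = c \<cdot> (u \<boxplus> v)" unfolding f'(2) g'(2) using u v D by simp
    finally show "\<exists>n. \<exists>f\<in>Mor T C (X n). c \<cdot> \<iota> n \<cdot> f = c \<cdot> (u \<boxplus> v)"
      using f'(1) g'(1) by (intro exI[of _ "n + m"] bexI[of _ "f' \<boxplus> g'"]) simp_all
  qed
  then show ?thesis using that u(2) by blast
qed

text \<open>If \<open>\<iota> n \<cdot> f\<close> equals \<open>e - s \<cdot> e\<close>, then
  \<open>e\<close> has zero coordinates below \<open>n\<close> and coordinate
  \<open>transition X x n k \<cdot> f\<close> at \<open>n + k\<close>. Compactness makes almost all
  coordinates of \<open>e\<close> vanish. Together with the previous lemma, maps from
  \<open>C\<close> into \<open>H\<close> are the colimit of the maps into the stages.\<close>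

lemma tel_K_inj:
  assumes C: "C \<in> K" and f: "f \<in> Mor T C (X n)" and jf: "c \<cdot> \<iota> n \<cdot> f = azero T C H"
  obtains k where "transition X x n k \<cdot> f = azero T C (X (n + k))"
proof -
  note XX = tel_X[OF tel] and D = tel_D[OF tel] and \<iota> = tel_\<iota>[OF tel] and s = tel_s[OF tel] and x = tel_x[OF tel]
  note Co = K_obj[OF C] and j = tel_j[OF tel] and t = transition_Mor[OF tel]
  obtain \<pi> where \<pi>: "\<And>n. \<pi> n \<in> Mor T A (X n)"
    "\<And>n m. \<pi> n \<cdot> \<iota> m = (if m = n then idt T (X n) else azero T (X m) (X n))"
    "\<And>n. \<pi> (Suc n) \<cdot> s = x n \<cdot> \<pi> n" "\<pi> 0 \<cdot> s = azero T A (X 0)" using tel_proj[OF tel] by metis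
  have "c \<cdot> (\<iota> n \<cdot> f) = azero T C H" using jf f \<iota>[of n] D by simp
  then obtain e where e: "e \<in> Mor T C A" "(idt T A \<boxplus> \<boxminus> s) \<cdot> e = \<iota> n \<cdot> f"
    using triangle_exact[OF tel_triangle[OF tel] cmp_mor[OF f \<iota>]] by metis
  have e2: "e \<boxplus> \<boxminus> (s \<cdot> e) = \<iota> n \<cdot> f" using e s(1) D by simp
  have \<pi>e: "\<pi> m \<cdot> e \<boxplus> \<boxminus> (\<pi> m \<cdot> (s \<cdot> e)) = (if m = n then f else azero T C (X m))" for m
  proof -
    have "\<pi> m \<cdot> e \<boxplus> \<boxminus> (\<pi> m \<cdot> (s \<cdot> e)) = \<pi> m \<cdot> (e \<boxplus> \<boxminus> (s \<cdot> e))" using \<pi>(1)[of m] e(1) s(1) by simp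
    also have "\<dots> = \<pi> m \<cdot> \<iota> n \<cdot> f" unfolding e2 using \<pi>(1)[of m] \<iota>[of n] f by simp
    also have "\<dots> = (if m = n then f else azero T C (X m))" unfolding \<pi>(2) using f XX by simp
    finally show ?thesis .
  qed
  have \<pi>Suc: "\<pi> (Suc m) \<cdot> (s \<cdot> e) = x m \<cdot> (\<pi> m \<cdot> e)" for m
    using cmp_eqD[OF \<pi>(3)[of m], of e] \<pi>(1) s(1) e(1) x[of m] by simp
  have \<pi>0: "\<pi> 0 \<cdot> (s \<cdot> e) = azero T C (X 0)" using cmp_eqD[OF \<pi>(4), of e] \<pi>(1)[of 0] s(1) e(1) XX by simp
  have \<pi>e_Mor: "\<pi> m \<cdot> e \<in> Mor T C (X m)" for m using \<pi>(1)[of m] e(1) by simp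
  have less: "\<pi> m \<cdot> e = azero T C (X m)" if "m < n" for m
    using that
  proof (induction m)
    case 0
    then show ?case using \<pi>e[of 0] \<pi>0 \<pi>e_Mor[of 0] Co XX by simp
  next
    case (Suc m)
    then have "\<pi> (Suc m) \<cdot> (s \<cdot> e) = azero T C (X (Suc m))" using \<pi>Suc[of m] x[of m] Co by simp
    then show ?case using \<pi>e[of "Suc m"] \<pi>e_Mor[of "Suc m"] Suc.prems Co XX by simp
  qed
  have tr: "\<pi> (n + k) \<cdot> e = transition X x n k \<cdot> f" for k
  proof (induction k)
    case 0
    have "\<pi> n \<cdot> (s \<cdot> e) = azero T C (X n)"
    proof (cases n)
      case (Suc m)
      then show ?thesis using \<pi>Suc[of m] less[of m] x[of m] Co by simp
    qed (use \<pi>0 in simp)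
    then show ?case using \<pi>e[of n] \<pi>e_Mor[of n] f Co XX by simp
  next
    case (Suc k)
    have eq: "\<pi> (Suc (n + k)) \<cdot> (s \<cdot> e) = transition X x n (Suc k) \<cdot> f"
      using \<pi>Suc[of "n + k"] Suc x[of "n + k"] t[of n k] f by simp
    have "\<pi> (Suc (n + k)) \<cdot> e \<boxplus> \<boxminus> (\<pi> (Suc (n + k)) \<cdot> (s \<cdot> e)) = azero T C (X (Suc (n + k)))"
      using \<pi>e[of "Suc (n + k)"] by simp
    then have "\<pi> (Suc (n + k)) \<cdot> e = \<pi> (Suc (n + k)) \<cdot> (s \<cdot> e)"
      using minus_eq_zero_iff[OF \<pi>e_Mor[of "Suc (n + k)"], of "\<pi> (Suc (n + k)) \<cdot> (s \<cdot> e)"] \<pi>(1)[of "Suc (n + k)"] s(1) e(1) by simp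
    then show ?case using eq by simp
  qed
  have "\<exists>N. \<forall>m\<ge>N. \<pi> m \<cdot> e = azero T C (X m)"
  proof (rule K_induct[OF C nat_small tel_A[OF tel] XX e(1), of "\<lambda>e. \<exists>N. \<forall>m\<ge>N. \<pi> m \<cdot> e = azero T C (X m)"])
    show "\<exists>N. \<forall>m\<ge>N. \<pi> m \<cdot> azero T C A = azero T C (X m)" using \<pi>(1) Co by simp
  next
    fix i g assume g: "g \<in> Mor T C (X i)"
    have "\<pi> m \<cdot> (\<iota> i \<cdot> g) = azero T C (X m)" if "m \<ge> Suc i" for m
      using cmp_eqD[OF \<pi>(2)[of m i], of g] \<pi>(1)[of m] \<iota>[of i] g that XX by simp
    then show "\<exists>N. \<forall>m\<ge>N. \<pi> m \<cdot> (\<iota> i \<cdot> g) = azero T C (X m)" by blast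
  next
    fix u v assume u: "u \<in> Mor T C A" and v: "v \<in> Mor T C A"
      and "\<exists>N. \<forall>m\<ge>N. \<pi> m \<cdot> u = azero T C (X m)" "\<exists>N. \<forall>m\<ge>N. \<pi> m \<cdot> v = azero T C (X m)"
    then obtain N N' where N: "\<And>m. m \<ge> N \<Longrightarrow> \<pi> m \<cdot> u = azero T C (X m)" "\<And>m. m \<ge> N' \<Longrightarrow> \<pi> m \<cdot> v = azero T C (X m)" by blast
    have "\<pi> m \<cdot> (u \<boxplus> v) = azero T C (X m)" if "m \<ge> max N N'" for m
      using N[of m] that \<pi>(1)[of m] u v Co XX by simp
    then show "\<exists>N. \<forall>m\<ge>N. \<pi> m \<cdot> (u \<boxplus> v) = azero T C (X m)" by blast
  qed
  then obtain N where "\<forall>m\<ge>N. \<pi> m \<cdot> e = azero T C (X m)" by blast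
  then have "transition X x n N \<cdot> f = azero T C (X (n + N))" using tr[of N] by simp
  then show ?thesis by (rule that)
qed

end

end

section \<open>Localization at central elements\<close>

context triangulated_cat
begin

lemma zero_obj_iso:
  assumes f: "f \<in> Mor T X Y" and X: "is_zero_obj T X" and Y: "is_zero_obj T Y"
  shows "is_iso T f"
proof -
  have o: "X \<in> obj T" "Y \<in> obj T" "idt T X = azero T X X" "idt T Y = azero T Y Y"
    using X Y by (simp_all only: is_zero_obj_iff)
  show ?thesis by (rule is_isoI[OF f, of "azero T Y X"]) (use f o in simp_all)
qed

context
  fixes n \<theta> assumes \<theta>: "\<theta> \<in> center T n"
begin

lemma center_Mor: "X \<in> obj T \<Longrightarrow> \<theta> X \<in> Mor T X (\<Sigma>o n X)"
  using \<theta> by (simp add: center_def)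

lemma center_nat: "f \<in> Mor T X Y \<Longrightarrow> \<Sigma>a n f \<cdot> \<theta> X = \<theta> Y \<cdot> f"
  using \<theta> unfolding center_def by blast

lemma center_Suc: "X \<in> obj T \<Longrightarrow> \<theta> (\<Sigma>o 1 X) = \<Sigma>a 1 (\<theta> X) \<or> \<theta> (\<Sigma>o 1 X) = \<boxminus> \<Sigma>a 1 (\<theta> X)"
  using \<theta> by (cases "even n") (simp_all add: center_def susp_obj_eq susp_arr_eq)

lemma center_simps:
  assumes "X \<in> obj T"
  shows "\<theta> X \<in> arr T" "src T (\<theta> X) = X" "tgt T (\<theta> X) = \<Sigma>o n X"
  using center_Mor[OF assms] by simp_all

text \<open>Every suspension of odd degree elements introduces a sign. Carrying an undetermined sign
  is enough, because vanishing and invertibility, the only properties used later, do not see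
  it.\<close>

lemma center_pow:
  assumes X: "X \<in> obj T"
  shows "\<theta> (\<Sigma>o m X) = \<Sigma>a m (\<theta> X) \<or> \<theta> (\<Sigma>o m X) = \<boxminus> \<Sigma>a m (\<theta> X)"
proof (induction m rule: pow_induct)
  case (2 m)
  have "\<theta> (\<Sigma>o (m + 1) X) = \<Sigma>a 1 (\<theta> (\<Sigma>o m X)) \<or> \<theta> (\<Sigma>o (m + 1) X) = \<boxminus> \<Sigma>a 1 (\<theta> (\<Sigma>o m X))"
    using center_Suc[of "\<Sigma>o m X"] X by (simp add: add.commute)
  then show ?case using 2 center_simps[OF X] by (auto simp: add.commute)
next
  case (3 m)
  note s = center_simps[OF X] and s' = center_simps[of "\<Sigma>o m X"]
  have "\<theta> (\<Sigma>o (m + 1) X) = \<Sigma>a 1 (\<theta> (\<Sigma>o m X)) \<or> \<theta> (\<Sigma>o (m + 1) X) = \<boxminus> \<Sigma>a 1 (\<theta> (\<Sigma>o m X))"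
    using center_Suc[of "\<Sigma>o m X"] X by (simp add: add.commute)
  moreover have "\<Sigma>a (m + 1) (\<theta> X) = \<Sigma>a 1 (\<Sigma>a m (\<theta> X))" using s by (simp add: add.commute)
  ultimately have "\<Sigma>a 1 (\<theta> (\<Sigma>o m X)) = \<Sigma>a 1 (\<Sigma>a m (\<theta> X)) \<or> \<Sigma>a 1 (\<theta> (\<Sigma>o m X)) = \<boxminus> \<Sigma>a 1 (\<Sigma>a m (\<theta> X))"
    using 3 s s' X aneg_aneg[of "\<Sigma>a 1 (\<theta> (\<Sigma>o m X))"] aneg_aneg[of "\<Sigma>a 1 (\<Sigma>a m (\<theta> X))"] by (metis arr_pow_arr obj_pow_obj)
  then have "\<Sigma>a 1 (\<theta> (\<Sigma>o m X)) = \<Sigma>a 1 (\<Sigma>a m (\<theta> X)) \<or> \<Sigma>a 1 (\<theta> (\<Sigma>o m X)) = \<Sigma>a 1 (\<boxminus> \<Sigma>a m (\<theta> X))"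
    using s by (simp only: arr_pow_aneg arr_pow_arr)
  then show ?case using arr_pow_eqD[of 1 "\<theta> (\<Sigma>o m X)"] s s' X by (metis aneg_simps(1) arr_pow_arr obj_pow_obj)
qed simp

lemma center_pow_zero:
  assumes X: "X \<in> obj T" and w: "w \<in> Mor T W (\<Sigma>o m X)"
  shows "\<theta> (\<Sigma>o m X) \<cdot> w = azero T W (\<Sigma>o (n + m) X) \<longleftrightarrow> \<Sigma>a m (\<theta> X) \<cdot> w = azero T W (\<Sigma>o (n + m) X)"
proof -
  note s = center_simps[OF X]
  have "\<Sigma>a m (\<theta> X) \<cdot> w \<in> Mor T W (\<Sigma>o (n + m) X)" using s w X by (simp add: add.commute)
  note z = aneg_eq_zero_iff[OF this]
  have "(\<boxminus> \<Sigma>a m (\<theta> X)) \<cdot> w = \<boxminus> (\<Sigma>a m (\<theta> X) \<cdot> w)" using s w by simp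
  then show ?thesis using center_pow[OF X, of m] z by metis
qed

lemma center_pow_zero':
  assumes X: "X \<in> obj T" and w: "w \<in> Mor T (\<Sigma>o (n + m) X) W"
  shows "w \<cdot> \<theta> (\<Sigma>o m X) = azero T (\<Sigma>o m X) W \<longleftrightarrow> w \<cdot> \<Sigma>a m (\<theta> X) = azero T (\<Sigma>o m X) W"
proof -
  note s = center_simps[OF X]
  have "w \<cdot> \<Sigma>a m (\<theta> X) \<in> Mor T (\<Sigma>o m X) W" using s w X by (simp add: add.commute)
  note z = aneg_eq_zero_iff[OF this]
  have "w \<cdot> (\<boxminus> \<Sigma>a m (\<theta> X)) = \<boxminus> (w \<cdot> \<Sigma>a m (\<theta> X))" using s w X by (simp add: add.commute)
  then show ?thesis using center_pow[OF X, of m] z by metis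
qed

lemma center_iso_pow:
  assumes X: "X \<in> obj T" and iso: "is_iso T (\<theta> X)"
  shows "is_iso T (\<theta> (\<Sigma>o m X))"
  using center_pow[OF X, of m] arr_pow_iso[OF iso, of m] aneg_iso[OF arr_pow_iso[OF iso, of m]] by metis

lemma center_iso_transfer:
  assumes f: "f \<in> Mor T X Y" "is_iso T f" and iso: "is_iso T (\<theta> X)"
  shows "is_iso T (\<theta> Y)"
proof -
  obtain g where g: "g \<in> Mor T Y X" "g \<cdot> f = idt T X" "f \<cdot> g = idt T Y" using is_isoE[OF f(2,1)] .
  note o = Mor_objD[OF f(1)]
  have gi: "is_iso T g" by (rule is_isoI[OF g(1) f(1) g(3,2)])
  have "\<theta> Y = \<theta> Y \<cdot> (f \<cdot> g)" using g(3) center_simps[OF o(2)] by simp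
  also have "\<dots> = \<theta> Y \<cdot> f \<cdot> g" using center_simps[OF o(2)] f(1) g(1) by simp
  also have "\<dots> = \<Sigma>a n f \<cdot> \<theta> X \<cdot> g" using center_nat[OF f(1)] by simp
  finally have eq: "\<theta> Y = \<Sigma>a n f \<cdot> \<theta> X \<cdot> g" .
  show ?thesis unfolding eq
    by (intro cmp_iso gi iso arr_pow_iso f(2)) (use center_simps[OF o(1)] f(1) g(1) in simp_all)
qed

text \<open>Five lemma by a chase. The three components of \<open>\<theta>\<close> form a map of
  triangles only up to sign, so the chase uses naturality along \<open>f\<close>, \<open>g\<close>
  and \<open>h\<close>, with the components at \<open>\<Sigma>o 1 X\<close> and
  \<open>\<Sigma>o 1 Y\<close>, instead of a map of triangles.\<close>

lemma center_iso_cone: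
  assumes D: "triangle f g h X Y Z" and X: "is_iso T (\<theta> X)" and Y: "is_iso T (\<theta> Y)"
  shows "is_iso T (\<theta> Z)"
proof (rule iso_if_bij_cmp'[OF center_Mor])
  note E = triangleD[OF D]
  show "Z \<in> obj T" by (rule E(6))
  note sX = center_simps[OF E(4)] and sY = center_simps[OF E(5)] and sZ = center_simps[OF E(6)]
  have SX: "is_iso T (\<theta> (\<Sigma>o 1 X))" and SY: "is_iso T (\<theta> (\<Sigma>o 1 Y))"
    using center_iso_pow E X Y by blast+
  note sSX = center_simps[OF obj_pow_obj[OF E(4), of 1]] and sSY = center_simps[OF obj_pow_obj[OF E(5), of 1]]
  note nf = center_nat[OF E(1)] and ng = center_nat[OF E(2)] and nh = center_nat[OF E(3)]
  have lift: "\<exists>v\<in>Mor T W V. \<theta> V \<cdot> v = w" if iso: "is_iso T (\<theta> V)" and V: "V \<in> obj T" and w: "w \<in> Mor T W (\<Sigma>o n V)" for V W w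
  proof -
    obtain k where k: "k \<in> Mor T (\<Sigma>o n V) V" "\<theta> V \<cdot> k = idt T (\<Sigma>o n V)"
      using is_isoE[OF iso center_Mor[OF V]] by metis
    have "\<theta> V \<cdot> (k \<cdot> w) = w" using cmp_eqD[OF k(2), of w] center_simps[OF V] k(1) w by simp
    then show ?thesis using k(1) w by (intro bexI[of _ "k \<cdot> w"]) simp_all
  qed
  show "w = azero T Z Z" if w: "w \<in> Mor T Z Z" and tw: "\<theta> Z \<cdot> w = azero T Z (\<Sigma>o n Z)" for w
  proof -
    have "\<theta> (\<Sigma>o 1 X) \<cdot> (h \<cdot> w) = \<Sigma>a n h \<cdot> \<theta> Z \<cdot> w"
      unfolding nh using sSX E(3) w by simp
    also have "\<dots> = azero T Z (\<Sigma>o (n + 1) X)" using tw sZ E w by simp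
    finally have "h \<cdot> w = azero T Z (\<Sigma>o 1 X)"
      using iso_cmp_zeroD[OF SX, of "h \<cdot> w" Z] sSX E w by simp
    then obtain u where u: "u \<in> Mor T Z Y" "g \<cdot> u = w" using triangle_exact2[OF D w] by metis
    have "\<Sigma>a n g \<cdot> (\<theta> Y \<cdot> u) = \<theta> Z \<cdot> w" using cmp_eqD[OF ng, of u] u sY sZ E by simp
    then have "\<Sigma>a n g \<cdot> (\<theta> Y \<cdot> u) = azero T Z (\<Sigma>o n Z)" using tw by simp
    then obtain e where e: "e \<in> Mor T Z (\<Sigma>o n X)" "\<Sigma>a n f \<cdot> e = \<theta> Y \<cdot> u"
      using triangle_exact_pow[OF D, of "\<theta> Y \<cdot> u" Z n] sY u by auto
    obtain e' where e': "e' \<in> Mor T Z X" "\<theta> X \<cdot> e' = e" using lift[OF X E(4) e(1)] by blast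
    have "\<theta> Y \<cdot> (f \<cdot> e') = \<theta> Y \<cdot> u" using cmp_eqD[OF nf, of e'] e e' sX sY E by simp
    then have "\<theta> Y \<cdot> (f \<cdot> e' \<boxplus> \<boxminus> u) = azero T Z (\<Sigma>o n Y)" using sY e'(1) u(1) E by simp
    then have "f \<cdot> e' \<boxplus> \<boxminus> u = azero T Z Y"
      using iso_cmp_zeroD[OF Y, of "f \<cdot> e' \<boxplus> \<boxminus> u" Z] sY e'(1) u(1) E by simp
    then have "f \<cdot> e' = u" using minus_eq_zero_iff[of "f \<cdot> e'" Z Y u] e'(1) u(1) E by simp
    then have "w = g \<cdot> (f \<cdot> e')" using u(2) by simp
    then show ?thesis using cmp_eqD[OF triangle_cmp_zero[OF D], of e'] e'(1) E by simp
  qed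
  show "\<exists>w. w \<in> Mor T (\<Sigma>o n Z) Z \<and> \<theta> Z \<cdot> w = idt T (\<Sigma>o n Z)"
  proof -
    let ?i = "idt T (\<Sigma>o n Z)"
    have "\<Sigma>a n h \<in> Mor T (\<Sigma>o n Z) (\<Sigma>o n (\<Sigma>o 1 X))" using E by simp
    then obtain w1 where w1: "w1 \<in> Mor T (\<Sigma>o n Z) (\<Sigma>o 1 X)" "\<theta> (\<Sigma>o 1 X) \<cdot> w1 = \<Sigma>a n h"
      using lift[OF SX obj_pow_obj[OF E(4)]] by blast
    have "\<theta> (\<Sigma>o 1 Y) \<cdot> (\<Sigma>a 1 f \<cdot> w1) = \<Sigma>a n (\<Sigma>a 1 f) \<cdot> \<Sigma>a n h"
      using cmp_eqD[OF center_nat[of "\<Sigma>a 1 f"], of "\<Sigma>o 1 X" "\<Sigma>o 1 Y" w1] w1 sSX sSY E by simp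
    also have "\<dots> = \<Sigma>a n (\<Sigma>a 1 f \<cdot> h)" using E by simp
    also have "\<dots> = azero T (\<Sigma>o n Z) (\<Sigma>o (n + 1) Y)" unfolding triangle_cmp_zero'(2)[OF D] using E by simp
    finally have "\<Sigma>a 1 f \<cdot> w1 = azero T (\<Sigma>o n Z) (\<Sigma>o 1 Y)"
      using iso_cmp_zeroD[OF SY, of "\<Sigma>a 1 f \<cdot> w1" "\<Sigma>o n Z"] sSY w1(1) E by simp
    then obtain w2 where w2: "w2 \<in> Mor T (\<Sigma>o n Z) Z" "h \<cdot> w2 = w1" using triangle_exact3[OF D w1(1)] by metis
    \<comment> \<open>\<open>w2\<close> lifts the identity up to the error \<open>r\<close>. The
      error dies under \<open>\<Sigma>a n h\<close>, hence comes from \<open>Y\<close>, where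
      \<open>\<theta>\<close> is invertible; the resulting correction \<open>g \<cdot> e'\<close> is
      added to \<open>w2\<close>.\<close>
    define r where "r = ?i \<boxplus> \<boxminus> (\<theta> Z \<cdot> w2)"
    have r: "r \<in> Mor T (\<Sigma>o n Z) (\<Sigma>o n Z)" using sZ w2(1) E by (simp add: r_def)
    have "\<Sigma>a n h \<cdot> (\<theta> Z \<cdot> w2) = \<Sigma>a n h" using cmp_eqD[OF nh, of w2] sSX sZ w2 w1 E by simp
    then have "\<Sigma>a n h \<cdot> r = azero T (\<Sigma>o n Z) (\<Sigma>o (n + 1) X)"
      unfolding r_def using sZ w2(1) E by simp
    then obtain e where e: "e \<in> Mor T (\<Sigma>o n Z) (\<Sigma>o n Y)" "\<Sigma>a n g \<cdot> e = r"
      using triangle_exact2_pow[OF D r] by metis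
    obtain e' where e': "e' \<in> Mor T (\<Sigma>o n Z) Y" "\<theta> Y \<cdot> e' = e" using lift[OF Y E(5) e(1)] by blast
    have "\<theta> Z \<cdot> (g \<cdot> e') = r" using cmp_eqD[OF ng, of e'] e e' sY sZ E by simp
    then have "\<theta> Z \<cdot> (g \<cdot> e' \<boxplus> w2) = r \<boxplus> \<theta> Z \<cdot> w2" using sZ e'(1) w2(1) E by simp
    also have "\<dots> = ?i" unfolding r_def by (rule minus_cancel) (use sZ w2(1) E in simp_all)
    finally show ?thesis using e'(1) w2(1) E by (intro exI[of _ "g \<cdot> e' \<boxplus> w2"]) simp_all
  qed
qed

text \<open>Suspension preserves coproducts, so the inverses on the summands assemble to a map out
  of \<open>\<Sigma>o n S\<close>.\<close>

lemma center_iso_coprod: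
  assumes S: "is_coproduct T I X S \<iota>" and X: "\<And>i. i \<in> I \<Longrightarrow> X i \<in> obj T" "\<And>i. i \<in> I \<Longrightarrow> is_iso T (\<theta> (X i))"
  shows "is_iso T (\<theta> S)"
proof -
  note So = coprod_obj[OF S]
  note s = center_simps[OF So] and \<iota> = coprod_inj[OF S]
  have "\<exists>k. k \<in> Mor T (\<Sigma>o n (X i)) (X i) \<and> k \<cdot> \<theta> (X i) = idt T (X i) \<and> \<theta> (X i) \<cdot> k = idt T (\<Sigma>o n (X i))" if "i \<in> I" for i
    using is_isoE[OF X(2)[OF that] center_Mor[OF X(1)[OF that]]] by metis
  then obtain k where k: "\<And>i. i \<in> I \<Longrightarrow> k i \<in> Mor T (\<Sigma>o n (X i)) (X i)"
    "\<And>i. i \<in> I \<Longrightarrow> k i \<cdot> \<theta> (X i) = idt T (X i)" "\<And>i. i \<in> I \<Longrightarrow> \<theta> (X i) \<cdot> k i = idt T (\<Sigma>o n (X i))" by metis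
  note SS = coprod_pow[OF S X(1), of n]
  have ty: "\<And>i. i \<in> I \<Longrightarrow> (\<lambda>i. \<iota> i \<cdot> k i) i \<in> Mor T (\<Sigma>o n (X i)) S" using cmp_mor[OF k(1) \<iota>] by simp
  obtain u where u: "u \<in> Mor T (\<Sigma>o n S) S" "\<And>i. i \<in> I \<Longrightarrow> u \<cdot> \<Sigma>a n (\<iota> i) = \<iota> i \<cdot> k i"
    using coprod_ex[OF SS So ty] by metis
  have "u \<cdot> \<theta> S = idt T S"
  proof (rule coprod_eqI[OF S])
    fix i assume i: "i \<in> I"
    note si = center_simps[OF X(1)[OF i]]
    have "u \<cdot> \<theta> S \<cdot> \<iota> i = u \<cdot> (\<Sigma>a n (\<iota> i) \<cdot> \<theta> (X i))" unfolding center_nat[OF \<iota>[OF i]] using u(1) s \<iota>[OF i] by simp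
    also have "\<dots> = \<iota> i \<cdot> (k i \<cdot> \<theta> (X i))" using cmp_eqD[OF u(2)[OF i], of "\<theta> (X i)"] u(1) si \<iota>[OF i] k(1)[OF i] by simp
    finally show "u \<cdot> \<theta> S \<cdot> \<iota> i = idt T S \<cdot> \<iota> i" unfolding k(2)[OF i] using \<iota>[OF i] So by simp
  qed (use u(1) s So in simp_all)
  moreover have "\<theta> S \<cdot> u = idt T (\<Sigma>o n S)"
  proof (rule coprod_eqI[OF SS])
    fix i assume i: "i \<in> I"
    note si = center_simps[OF X(1)[OF i]]
    have "\<theta> S \<cdot> u \<cdot> \<Sigma>a n (\<iota> i) = \<theta> S \<cdot> \<iota> i \<cdot> k i" using u(1) u(2)[OF i] s \<iota>[OF i] k(1)[OF i] by simp
    also have "\<dots> = \<Sigma>a n (\<iota> i) \<cdot> (\<theta> (X i) \<cdot> k i)" unfolding center_nat[OF \<iota>[OF i], symmetric] using \<iota>[OF i] si k(1)[OF i] by simp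
    finally show "\<theta> S \<cdot> u \<cdot> \<Sigma>a n (\<iota> i) = idt T (\<Sigma>o n S) \<cdot> \<Sigma>a n (\<iota> i)" unfolding k(3)[OF i] using \<iota>[OF i] So by simp
  qed (use u(1) s So in simp_all)
  ultimately show ?thesis using is_isoI[OF center_Mor[OF So] u(1)] by blast
qed

text \<open>On its own cone \<open>\<theta>\<close> acts with square zero. Naturality along
  \<open>u\<close> gives \<open>\<theta> D \<cdot> u = 0\<close>, so
  \<open>\<theta> D = w \<cdot> v\<close>; naturality along \<open>w\<close> moves the second factor
  onto \<open>v\<close>, where it is \<open>\<Sigma>a 1 (\<theta> X) \<cdot> v\<close> up to sign,
  which is zero.\<close>

lemma center_cone_nilpotent:
  assumes D: "triangle (\<theta> X) u v X (\<Sigma>o n X) D"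
  shows "\<theta> (\<Sigma>o n D) \<cdot> \<theta> D = azero T D (\<Sigma>o (n + n) D)"
proof -
  note E = triangleD[OF D]
  note sX = center_simps[OF E(4)] and sD = center_simps[OF E(6)]
    and sSX = center_simps[OF obj_pow_obj[OF E(4), of n]] and sSD = center_simps[OF obj_pow_obj[OF E(6), of n]]
    and s1X = center_simps[OF obj_pow_obj[OF E(4), of 1]]
  have "\<Sigma>a n u \<cdot> \<Sigma>a n (\<theta> X) = \<Sigma>a n (u \<cdot> \<theta> X)" using E sX by simp
  also have "\<dots> = azero T (\<Sigma>o n X) (\<Sigma>o n D)" unfolding triangle_cmp_zero[OF D] using E by simp
  finally have "\<Sigma>a n u \<cdot> \<theta> (\<Sigma>o n X) = azero T (\<Sigma>o n X) (\<Sigma>o n D)"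
    using center_pow_zero'[OF E(4), of "\<Sigma>a n u" n] E by simp
  then have "\<theta> D \<cdot> u = azero T (\<Sigma>o n X) (\<Sigma>o n D)" using center_nat[OF E(2)] by simp
  then obtain w where w: "w \<in> Mor T (\<Sigma>o 1 X) (\<Sigma>o n D)" "w \<cdot> v = \<theta> D"
    using triangle_coexact2[OF D center_Mor[OF E(6)]] by metis
  have "\<theta> (\<Sigma>o 1 X) \<cdot> v = azero T D (\<Sigma>o (n + 1) X)"
    using center_pow_zero[OF E(4), of v D 1] triangle_cmp_zero'(2)[OF D] E by (simp add: add.commute)
  then have "\<Sigma>a n w \<cdot> (\<theta> (\<Sigma>o 1 X) \<cdot> v) = azero T D (\<Sigma>o (n + n) D)" using w(1) E by simp
  moreover have "\<theta> (\<Sigma>o n D) \<cdot> (w \<cdot> v) = \<Sigma>a n w \<cdot> (\<theta> (\<Sigma>o 1 X) \<cdot> v)"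
    using cmp_eqD[OF center_nat[OF w(1)], of v] w(1) s1X sSD E by simp
  ultimately show ?thesis using w(2) by simp
qed

end

end

text \<open>A multiplicative system of central elements, each stored with its degree. Smallness
  allows one coproduct over the whole family; closure under products makes the maps killed by some
  member a subgroup.\<close>

locale central_family = generated_cat \<kappa> T K
  for \<kappa> :: "'i rel" and T :: "('o, 'a, 'x) tricat_scheme" (structure) and K +
  fixes \<Theta> :: "(int \<times> ('o \<Rightarrow> 'a)) set"
  assumes \<Theta>_center: "(n, \<theta>) \<in> \<Theta> \<Longrightarrow> \<theta> \<in> center T n"
    and \<Theta>_nonempty: "\<Theta> \<noteq> {}"
    and \<Theta>_mult: "(m, \<theta>) \<in> \<Theta> \<Longrightarrow> (n, \<eta>) \<in> \<Theta> \<Longrightarrow>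
      \<exists>\<zeta>. (m + n, \<zeta>) \<in> \<Theta> \<and> (\<forall>X\<in>obj T. \<zeta> X = \<Sigma>a n (\<theta> X) \<cdot> \<eta> X)"
    and \<Theta>_small: "|\<Theta>| <o \<kappa>"
begin

section \<open>Torsion objects and local objects of a central family\<close>

definition killed where
  "killed X f \<longleftrightarrow> (\<exists>n \<theta>. (n, \<theta>) \<in> \<Theta> \<and> \<theta> X \<cdot> f = azero T (src T f) (\<Sigma>o n X))"

definition tors where
  "tors = {X \<in> obj T. \<forall>C\<in>K. \<forall>f\<in>Mor T C X. killed X f}"

definition invs where
  "invs = {X \<in> obj T. \<forall>(n, \<theta>)\<in>\<Theta>. is_iso T (\<theta> X)}"

lemma torsD: "X \<in> tors \<Longrightarrow> C \<in> K \<Longrightarrow> f \<in> Mor T C X \<Longrightarrow> killed X f"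
  unfolding tors_def by blast

lemma tors_obj: "X \<in> tors \<Longrightarrow> X \<in> obj T"
  unfolding tors_def by blast

lemma invs_iso: "X \<in> invs \<Longrightarrow> (n, \<theta>) \<in> \<Theta> \<Longrightarrow> is_iso T (\<theta> X)"
  unfolding invs_def by blast

lemma invs_obj: "X \<in> invs \<Longrightarrow> X \<in> obj T"
  unfolding invs_def by blast

lemma killed_zero: "X \<in> obj T \<Longrightarrow> W \<in> obj T \<Longrightarrow> killed X (azero T W X)"
proof -
  assume X: "X \<in> obj T" "W \<in> obj T"
  obtain n \<theta> where "(n, \<theta>) \<in> \<Theta>" using \<Theta>_nonempty by auto
  then show ?thesis using X center_simps[OF \<Theta>_center] unfolding killed_def by (intro exI[of _ n] exI[of _ \<theta>]) simp
qed

text \<open>The product \<open>\<zeta>\<close> of the two killing elements kills both summands,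
  since naturality lets either factor be applied first.\<close>

lemma killed_add:
  assumes f: "f \<in> Mor T W X" and g: "g \<in> Mor T W X" and kf: "killed X f" and kg: "killed X g"
  shows "killed X (f \<boxplus> g)"
proof -
  obtain m \<theta> where \<theta>: "(m, \<theta>) \<in> \<Theta>" "\<theta> X \<cdot> f = azero T W (\<Sigma>o m X)" using kf f unfolding killed_def by auto
  obtain n \<eta> where \<eta>: "(n, \<eta>) \<in> \<Theta>" "\<eta> X \<cdot> g = azero T W (\<Sigma>o n X)" using kg g unfolding killed_def by auto
  note o = Mor_objD[OF f]
  obtain \<zeta> where \<zeta>: "(m + n, \<zeta>) \<in> \<Theta>" "\<zeta> X = \<Sigma>a n (\<theta> X) \<cdot> \<eta> X" using \<Theta>_mult[OF \<theta>(1) \<eta>(1)] o(2) by blast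
  note c\<theta> = \<Theta>_center[OF \<theta>(1)] and c\<eta> = \<Theta>_center[OF \<eta>(1)]
  note s = center_simps[OF c\<theta> o(2)] center_simps[OF c\<eta> o(2)]
  have \<zeta>': "\<zeta> X = \<eta> (\<Sigma>o m X) \<cdot> \<theta> X" using center_nat[OF c\<eta> center_Mor[OF c\<theta> o(2)]] \<zeta>(2) by simp
  have "\<zeta> X \<cdot> g = \<Sigma>a n (\<theta> X) \<cdot> (\<eta> X \<cdot> g)" unfolding \<zeta>(2) using s g by simp
  then have 1: "\<zeta> X \<cdot> g = azero T W (\<Sigma>o (m + n) X)" unfolding \<eta>(2) using s o by (simp add: add.commute)
  have "\<zeta> X \<cdot> f = \<eta> (\<Sigma>o m X) \<cdot> (\<theta> X \<cdot> f)" unfolding \<zeta>' using s f center_simps[OF c\<eta>, of "\<Sigma>o m X"] o by simp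
  then have 2: "\<zeta> X \<cdot> f = azero T W (\<Sigma>o (m + n) X)"
    unfolding \<theta>(2) using center_simps[OF c\<eta>, of "\<Sigma>o m X"] o by (simp add: add.commute)
  have "\<zeta> X \<cdot> (f \<boxplus> g) = azero T W (\<Sigma>o (m + n) X)"
    using 1 2 f g o center_simps[OF \<Theta>_center[OF \<zeta>(1)] o(2)] by simp
  then show ?thesis unfolding killed_def using \<zeta>(1) f g by (intro exI[of _ "m + n"] exI[of _ \<zeta>]) simp
qed

lemma killed_cmp:
  assumes f: "f \<in> Mor T W X" and g: "g \<in> Mor T X Y" and k: "killed X f"
  shows "killed Y (g \<cdot> f)"
proof -
  obtain m \<theta> where \<theta>: "(m, \<theta>) \<in> \<Theta>" "\<theta> X \<cdot> f = azero T W (\<Sigma>o m X)" using k f unfolding killed_def by auto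
  note c = \<Theta>_center[OF \<theta>(1)] and o = Mor_objD[OF f] Mor_objD[OF g]
  have "\<theta> Y \<cdot> (g \<cdot> f) = \<Sigma>a m g \<cdot> (\<theta> X \<cdot> f)"
    using cmp_eqD[OF center_nat[OF c g], of f] center_simps[OF c] f g o by simp
  then have "\<theta> Y \<cdot> (g \<cdot> f) = azero T W (\<Sigma>o m Y)" unfolding \<theta>(2) using g o by simp
  then show ?thesis unfolding killed_def using \<theta>(1) f g by (intro exI[of _ m] exI[of _ \<theta>]) simp
qed

lemma killed_pow:
  assumes f: "f \<in> Mor T W X" and k: "killed X f"
  shows "killed (\<Sigma>o m X) (\<Sigma>a m f)"
proof -
  obtain n \<theta> where \<theta>: "(n, \<theta>) \<in> \<Theta>" "\<theta> X \<cdot> f = azero T W (\<Sigma>o n X)" using k f unfolding killed_def by auto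
  note c = \<Theta>_center[OF \<theta>(1)] and o = Mor_objD[OF f]
  have "\<Sigma>a m (\<theta> X) \<cdot> \<Sigma>a m f = \<Sigma>a m (\<theta> X \<cdot> f)" using center_simps[OF c o(2)] f by simp
  then have "\<Sigma>a m (\<theta> X) \<cdot> \<Sigma>a m f = azero T (\<Sigma>o m W) (\<Sigma>o (n + m) X)" unfolding \<theta>(2) using o by (simp add: add.commute)
  then have "\<theta> (\<Sigma>o m X) \<cdot> \<Sigma>a m f = azero T (\<Sigma>o m W) (\<Sigma>o (n + m) X)"
    using center_pow_zero[OF c o(2) arr_pow_Mor[OF f]] by blast
  then show ?thesis unfolding killed_def using \<theta>(1) f o by (intro exI[of _ n] exI[of _ \<theta>]) simp
qed

text \<open>The product of \<open>\<theta>\<close> with an element killing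
  \<open>\<theta> X \<cdot> f\<close> kills \<open>f\<close>.\<close>

lemma killed_killed:
  assumes f: "f \<in> Mor T W X" and \<theta>: "(n, \<theta>) \<in> \<Theta>" and k: "killed (\<Sigma>o n X) (\<theta> X \<cdot> f)"
  shows "killed X f"
proof -
  note o = Mor_objD[OF f] and c = \<Theta>_center[OF \<theta>]
  note s = center_simps[OF c o(2)]
  obtain m \<eta> where \<eta>: "(m, \<eta>) \<in> \<Theta>" "\<eta> (\<Sigma>o n X) \<cdot> (\<theta> X \<cdot> f) = azero T W (\<Sigma>o m (\<Sigma>o n X))"
    using k f s unfolding killed_def by auto
  note c' = \<Theta>_center[OF \<eta>(1)]
  obtain \<zeta> where \<zeta>: "(n + m, \<zeta>) \<in> \<Theta>" "\<zeta> X = \<Sigma>a m (\<theta> X) \<cdot> \<eta> X" using \<Theta>_mult[OF \<theta> \<eta>(1)] o(2) by blast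
  have \<zeta>': "\<zeta> X = \<eta> (\<Sigma>o n X) \<cdot> \<theta> X" using center_nat[OF c' center_Mor[OF c o(2)]] \<zeta>(2) by simp
  have "\<zeta> X \<cdot> f = \<eta> (\<Sigma>o n X) \<cdot> (\<theta> X \<cdot> f)" unfolding \<zeta>' using s f center_simps[OF c', of "\<Sigma>o n X"] o by simp
  then have "\<zeta> X \<cdot> f = azero T W (\<Sigma>o (n + m) X)" unfolding \<eta>(2) using o by (simp add: add.commute)
  then show ?thesis unfolding killed_def using \<zeta>(1) f by (intro exI[of _ "n + m"] exI[of _ \<zeta>]) simp
qed

lemma tors_pow: assumes X: "X \<in> tors" shows "\<Sigma>o n X \<in> tors"
proof -
  have "killed (\<Sigma>o n X) f" if C: "C \<in> K" and f: "f \<in> Mor T C (\<Sigma>o n X)" for C f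
  proof -
    obtain v where v: "v \<in> Mor T (\<Sigma>o (- n) C) X" "\<Sigma>a n v = f" using Mor_pow_lift[OF f tors_obj[OF X]] .
    show ?thesis using killed_pow[OF v(1) torsD[OF X K_pow[OF C] v(1)], of n] unfolding v(2) .
  qed
  then show ?thesis unfolding tors_def using tors_obj[OF X] by (simp del: Mor_def)
qed

lemma tors_localizing: "is_localizing tors"
proof (rule localizingI[OF triangulated_subcatI])
  show "tors \<subseteq> obj T" using tors_obj by blast
  obtain N where N: "is_zero_obj T N" "N \<in> obj T" by (rule zero_obtain)
  have "killed N f" if "C \<in> K" "f \<in> Mor T C N" for C f
    using zero_tgt_eq[OF N(1) that(2)] killed_zero[OF N(2) K_obj[OF that(1)]] by simp
  then have "N \<in> tors" using N(2) unfolding tors_def by blast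
  then show "tors \<noteq> {}" by blast
next
  fix X Y assume X: "X \<in> tors" and iso: "isomorphic T X Y"
  obtain f where f: "f \<in> Mor T X Y" "is_iso T f" using iso unfolding isomorphic_def by blast
  obtain g where g: "g \<in> Mor T Y X" "g \<cdot> f = idt T X" "f \<cdot> g = idt T Y" using is_isoE[OF f(2,1)] .
  have "killed Y w" if C: "C \<in> K" and w: "w \<in> Mor T C Y" for C w
  proof -
    have gw: "g \<cdot> w \<in> Mor T C X" using g w by simp
    have "f \<cdot> (g \<cdot> w) = w" using cmp_eqD[OF g(3), of w] f(1) g(1) w by simp
    then show ?thesis using killed_cmp[OF gw f(1) torsD[OF X C gw]] by simp
  qed
  then show "Y \<in> tors" using isomorphic_obj(2)[OF iso] unfolding tors_def by blast
next
  fix X assume X: "X \<in> tors"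
  show "\<Sigma>o 1 X \<in> tors" "\<Sigma>o (- 1) X \<in> tors" using tors_pow[OF X] by blast+
next
  fix f g h X Y Z assume D: "triangle f g h X Y Z" and X: "X \<in> tors" and Y: "Y \<in> tors"
  note E = triangleD[OF D]
  \<comment> \<open>Some \<open>\<theta>\<close> kills the boundary \<open>h \<cdot> w\<close>. Then
    \<open>\<theta> Z \<cdot> w\<close> comes from a shift of \<open>Y\<close>, is killed by a
    second element, and the product of both kills \<open>w\<close>.\<close>
  have "killed Z w" if C: "C \<in> K" and w: "w \<in> Mor T C Z" for C w
  proof -
    note Co = K_obj[OF C]
    have hw: "h \<cdot> w \<in> Mor T C (\<Sigma>o 1 X)" using w E by simp
    obtain n \<theta> where \<theta>: "(n, \<theta>) \<in> \<Theta>" "\<theta> (\<Sigma>o 1 X) \<cdot> (h \<cdot> w) = azero T C (\<Sigma>o n (\<Sigma>o 1 X))"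
      using torsD[OF tors_pow[OF X] C hw] hw unfolding killed_def by auto
    note c = \<Theta>_center[OF \<theta>(1)]
    have "\<Sigma>a n h \<cdot> (\<theta> Z \<cdot> w) = \<theta> (\<Sigma>o 1 X) \<cdot> (h \<cdot> w)"
      using cmp_eqD[OF center_nat[OF c E(3)], of w] center_simps[OF c] w E by simp
    then have "\<Sigma>a n h \<cdot> (\<theta> Z \<cdot> w) = azero T C (\<Sigma>o (n + 1) X)" unfolding \<theta>(2) using E by simp
    moreover have tw: "\<theta> Z \<cdot> w \<in> Mor T C (\<Sigma>o n Z)" using center_simps[OF c] w E by simp
    ultimately obtain e where e: "e \<in> Mor T C (\<Sigma>o n Y)" "\<Sigma>a n g \<cdot> e = \<theta> Z \<cdot> w" using triangle_exact2_pow[OF D] by metis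
    have "killed (\<Sigma>o n Z) (\<Sigma>a n g \<cdot> e)"
      by (rule killed_cmp[OF e(1) arr_pow_Mor[OF E(2)] torsD[OF tors_pow[OF Y] C e(1)]])
    then show ?thesis using killed_killed[OF w \<theta>(1)] e(2) by simp
  qed
  then show "Z \<in> tors" using E(6) unfolding tors_def by blast
next
  fix I :: "'i set" and X S \<iota> assume I: "|I| <o \<kappa>" and X: "\<And>i. i \<in> I \<Longrightarrow> X i \<in> tors" and S: "is_coproduct T I X S \<iota>"
  have "killed S w" if C: "C \<in> K" and w: "w \<in> Mor T C S" for C w
  proof (rule K_induct[OF C I S tors_obj[OF X] w])
    show "killed S (azero T C S)" by (rule killed_zero[OF coprod_obj[OF S] K_obj[OF C]])
    show "killed S (\<iota> i \<cdot> f)" if "i \<in> I" "f \<in> Mor T C (X i)" for i f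
      by (rule killed_cmp[OF that(2) coprod_inj[OF S that(1)] torsD[OF X[OF that(1)] C that(2)]])
    show "killed S (u \<boxplus> v)" if "u \<in> Mor T C S" "v \<in> Mor T C S" "killed S u" "killed S v" for u v
      by (rule killed_add[OF that])
  qed
  then show "S \<in> tors" using coprod_obj[OF S] unfolding tors_def by blast
qed

lemma invsI: "X \<in> obj T \<Longrightarrow> (\<And>n \<theta>. (n, \<theta>) \<in> \<Theta> \<Longrightarrow> is_iso T (\<theta> X)) \<Longrightarrow> X \<in> invs"
  unfolding invs_def by blast

lemma invs_pow: "X \<in> invs \<Longrightarrow> \<Sigma>o n X \<in> invs"
proof -
  assume X: "X \<in> invs"
  show ?thesis
    by (rule invsI[OF obj_pow_obj[OF invs_obj[OF X]]])
      (rule center_iso_pow[OF \<Theta>_center invs_obj[OF X] invs_iso[OF X]])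
qed

lemma invs_localizing: "is_localizing invs"
proof (rule localizingI[OF triangulated_subcatI])
  show "invs \<subseteq> obj T" using invs_obj by blast
  obtain N where N: "is_zero_obj T N" "N \<in> obj T" by (rule zero_obtain)
  have "N \<in> invs"
  proof (rule invsI[OF N(2)])
    fix n \<theta> assume \<theta>: "(n, \<theta>) \<in> \<Theta>"
    show "is_iso T (\<theta> N)"
      by (rule zero_obj_iso[OF center_Mor[OF \<Theta>_center[OF \<theta>] N(2)] N(1) zero_obj_pow[OF N(1)]])
  qed
  then show "invs \<noteq> {}" by blast
next
  fix X Y assume X: "X \<in> invs" and iso: "isomorphic T X Y"
  obtain f where f: "f \<in> Mor T X Y" "is_iso T f" using iso unfolding isomorphic_def by blast
  show "Y \<in> invs"
    by (rule invsI[OF isomorphic_obj(2)[OF iso]]) (rule center_iso_transfer[OF \<Theta>_center f invs_iso[OF X]])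
next
  fix X assume X: "X \<in> invs"
  show "\<Sigma>o 1 X \<in> invs" "\<Sigma>o (- 1) X \<in> invs" using invs_pow[OF X] by blast+
next
  fix f g h X Y Z assume D: "triangle f g h X Y Z" and X: "X \<in> invs" and Y: "Y \<in> invs"
  show "Z \<in> invs"
    by (rule invsI[OF triangleD(6)[OF D]]) (rule center_iso_cone[OF \<Theta>_center D invs_iso[OF X] invs_iso[OF Y]])
next
  fix I :: "'i set" and X S \<iota> assume I: "|I| <o \<kappa>" and X: "\<And>i. i \<in> I \<Longrightarrow> X i \<in> invs" and S: "is_coproduct T I X S \<iota>"
  show "S \<in> invs"
    by (rule invsI[OF coprod_obj[OF S]]) (rule center_iso_coprod[OF \<Theta>_center S invs_obj[OF X] invs_iso[OF X]])
qed

text \<open>The element \<open>\<theta>\<close> applied twice is zero on its cone, so it kills every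
  map into the cone after one application of \<open>\<theta>\<close>.\<close>

lemma cone_tors:
  assumes \<theta>: "(n, \<theta>) \<in> \<Theta>" and D: "triangle (\<theta> X) u v X (\<Sigma>o n X) D"
  shows "D \<in> tors"
proof -
  note E = triangleD[OF D] and c = \<Theta>_center[OF \<theta>]
  note s = center_simps[OF c E(6)] center_simps[OF c obj_pow_obj[OF E(6), of n]]
  have "killed D w" if C: "C \<in> K" and w: "w \<in> Mor T C D" for C w
  proof (rule killed_killed[OF w \<theta>])
    have "\<theta> (\<Sigma>o n D) \<cdot> (\<theta> D \<cdot> w) = azero T C (\<Sigma>o n (\<Sigma>o n D))"
      using cmp_eqD[OF center_cone_nilpotent[OF c D], of w] s w E by simp
    then show "killed (\<Sigma>o n D) (\<theta> D \<cdot> w)"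
      unfolding killed_def using \<theta> s w by (intro exI[of _ n] exI[of _ \<theta>]) simp
  qed
  then show ?thesis using E(6) unfolding tors_def by blast
qed

text \<open>Naturality moves two applications of \<open>\<theta>\<close> from \<open>W\<close>,
  where they are invertible, to the cone, where they give zero.\<close>

lemma cone_invs_zero:
  assumes \<theta>: "(n, \<theta>) \<in> \<Theta>" and D: "triangle (\<theta> X) u v X (\<Sigma>o n X) D" and W: "W \<in> invs" and w: "w \<in> Mor T D W"
  shows "w = azero T D W"
proof -
  note E = triangleD[OF D] and c = \<Theta>_center[OF \<theta>] and Wo = invs_obj[OF W]
  note s = center_simps[OF c E(6)] center_simps[OF c obj_pow_obj[OF E(6), of n]]
    center_simps[OF c Wo] center_simps[OF c obj_pow_obj[OF Wo, of n]]
  have "\<theta> (\<Sigma>o n W) \<cdot> (\<theta> W \<cdot> w) = \<theta> (\<Sigma>o n W) \<cdot> \<Sigma>a n w \<cdot> \<theta> D"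
    unfolding center_nat[OF c w, symmetric] using s w by simp
  also have "\<dots> = \<Sigma>a n (\<Sigma>a n w) \<cdot> (\<theta> (\<Sigma>o n D) \<cdot> \<theta> D)"
    unfolding center_nat[OF c arr_pow_Mor[OF w, of n], symmetric] using s w E Wo by simp
  also have "\<dots> = azero T D (\<Sigma>o n (\<Sigma>o n W))"
    unfolding center_cone_nilpotent[OF c D] using w E Wo by simp
  finally have "\<theta> W \<cdot> w = azero T D (\<Sigma>o n W)"
    using iso_cmp_zeroD[OF invs_iso[OF invs_pow[OF W] \<theta>], of "\<theta> W \<cdot> w" D n] s w Wo by simp
  then show ?thesis using iso_cmp_zeroD[OF invs_iso[OF W \<theta>], of w D] s w by simp
qed

text \<open>One stage of the localization. The fibre is torsion, built from \<open>X\<close> and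
  invisible to local objects; moreover \<open>x\<close> factors through every
  \<open>\<theta> X\<close>, which is what inverts the members of the family in the limit.\<close>

definition step where
  "step X X' x \<longleftrightarrow> (\<exists>k h F. triangle k x h F X X' \<and> F \<in> tors \<and> F \<in> Loc_of {X} \<and>
      (\<forall>W\<in>invs. \<forall>w\<in>Mor T F W. w = azero T F W)) \<and>
    (\<forall>n \<theta>. (n, \<theta>) \<in> \<Theta> \<longrightarrow> (\<exists>t\<in>Mor T (\<Sigma>o n X) X'. t \<cdot> \<theta> X = x))"

text \<open>\<open>X'\<close> is the cone of the coproduct, over all members of the family, of the
  fibres of their actions on \<open>X\<close>.\<close>

lemma step_ex:
  assumes X: "X \<in> obj T"
  obtains X' x where "step X X' x"
proof -
  have LX: "is_localizing (Loc_of {X})" using Loc_localizing[of "{X}"] X by simp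
  note tLX = localizing_triangulated[OF LX] and tt = localizing_triangulated[OF tors_localizing]
  have XL: "\<Sigma>o n X \<in> Loc_of {X}" for n using tsub_pow[OF tLX X] Loc_self by simp
  have "\<exists>k h F. triangle k (snd p X) h F X (\<Sigma>o (fst p) X) \<and> F \<in> tors \<and> F \<in> Loc_of {X} \<and>
      (\<forall>W\<in>invs. \<forall>w\<in>Mor T F W. w = azero T F W)" if p: "p \<in> \<Theta>" for p
  proof -
    obtain n \<theta> where n: "p = (n, \<theta>)" by (cases p)
    have \<theta>: "(n, \<theta>) \<in> \<Theta>" using p n by simp
    obtain u v D where D: "triangle (\<theta> X) u v X (\<Sigma>o n X) D" using cone_ex[OF center_Mor[OF \<Theta>_center[OF \<theta>] X]] .
    let ?F = "\<Sigma>o (- 1) D"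
    have F: "triangle (\<boxminus> \<Sigma>a (- 1) v) (\<theta> X) u ?F X (\<Sigma>o n X)" by (rule triangle_unrot'[OF D])
    have "?F \<in> tors" by (rule tors_pow[OF cone_tors[OF \<theta> D]])
    moreover have "?F \<in> Loc_of {X}" by (rule tsub_fst[OF tLX F Loc_self XL])
    moreover have "w = azero T ?F W" if W: "W \<in> invs" and w: "w \<in> Mor T ?F W" for W w
    proof -
      have "\<Sigma>a 1 w \<in> Mor T D (\<Sigma>o 1 W)" using w triangleD(6)[OF D] by simp
      then have "\<Sigma>a 1 w = azero T (\<Sigma>o 1 ?F) (\<Sigma>o 1 W)"
        using cone_invs_zero[OF \<theta> D invs_pow[OF W, of 1]] triangleD(6)[OF D] by simp
      then show ?thesis using arr_pow_eq_zero_iff[OF w] by simp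
    qed
    ultimately show ?thesis using F n by (intro exI conjI ballI) simp_all
  qed
  then obtain k h F where F: "\<And>p. p \<in> \<Theta> \<Longrightarrow> triangle (k p) (snd p X) (h p) (F p) X (\<Sigma>o (fst p) X)"
    "\<And>p. p \<in> \<Theta> \<Longrightarrow> F p \<in> tors" "\<And>p. p \<in> \<Theta> \<Longrightarrow> F p \<in> Loc_of {X}"
    "\<And>p W w. p \<in> \<Theta> \<Longrightarrow> W \<in> invs \<Longrightarrow> w \<in> Mor T (F p) W \<Longrightarrow> w = azero T (F p) W"
    by metis
  obtain CF \<iota> where CF: "is_coproduct T \<Theta> F CF \<iota>" using coprod_obtain[OF \<Theta>_small triangleD(4)[OF F(1)]] .
  note \<iota> = coprod_inj[OF CF]
  obtain q where q: "q \<in> Mor T CF X" "\<And>p. p \<in> \<Theta> \<Longrightarrow> q \<cdot> \<iota> p = k p"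
    using coprod_ex[OF CF X triangleD(1)[OF F(1)]] by metis
  obtain x r X' where D: "triangle q x r CF X X'" using cone_ex[OF q(1)] .
  note E = triangleD[OF D]
  have "w = azero T CF W" if W: "W \<in> invs" and w: "w \<in> Mor T CF W" for W w
    by (rule coprod_zeroI[OF CF w]) (rule F(4)[OF _ W cmp_mor[OF \<iota> w]])
  moreover have "CF \<in> tors" "CF \<in> Loc_of {X}"
    using localizing_coprod[OF tors_localizing \<Theta>_small F(2) CF] localizing_coprod[OF LX \<Theta>_small F(3) CF] by blast+
  moreover have "\<exists>t\<in>Mor T (\<Sigma>o n X) X'. t \<cdot> \<theta> X = x" if \<theta>: "(n, \<theta>) \<in> \<Theta>" for n \<theta>
  proof -
    \<comment> \<open>On the summand of \<open>\<theta>\<close> the arrow \<open>x\<close> kills the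
      fibre of \<open>\<theta> X\<close>, hence factors through \<open>\<theta> X\<close>.\<close>
    have "x \<cdot> q \<cdot> \<iota> (n, \<theta>) = azero T (F (n, \<theta>)) X'"
      unfolding triangle_cmp_zero[OF D] using \<iota>[OF \<theta>] E by simp
    then have "x \<cdot> k (n, \<theta>) = azero T (F (n, \<theta>)) X'" using q \<theta> \<iota>[OF \<theta>] E by simp
    then show ?thesis using triangle_coexact[OF F(1)[OF \<theta>] E(2)] by (metis fst_conv snd_conv)
  qed
  ultimately have "step X X' x" unfolding step_def using D by blast
  then show ?thesis by (rule that)
qed

lemma step_seq:
  assumes X: "X \<in> obj T"
  obtains Y y A \<iota> s c d H where "Y 0 = X" "\<And>n. step (Y n) (Y (Suc n)) (y n)" "telescope Y y A \<iota> s c d H"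
proof -
  have "\<exists>N x. step X N x" if "X \<in> obj T" for X using step_ex[OF that] by metis
  then obtain N x where Nx: "\<And>X. X \<in> obj T \<Longrightarrow> step X (N X) (x X)" by metis
  have step_Mor: "x \<in> Mor T X X'" if "step X X' x" for X X' x
    using that triangleD(2) unfolding step_def by blast
  define Y where "Y = (\<lambda>n. (N ^^ n) X)"
  have Yo: "Y n \<in> obj T" for n
  proof (induction n)
    case (Suc n)
    then show ?case using Mor_objD(2)[OF step_Mor[OF Nx]] by (simp add: Y_def)
  qed (use X in \<open>simp add: Y_def\<close>)
  have st: "step (Y n) (Y (Suc n)) (x (Y n))" for n using Nx[OF Yo[of n]] by (simp add: Y_def)
  obtain A \<iota> s c d H where "telescope Y (\<lambda>n. x (Y n)) A \<iota> s c d H"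
    using telescope_ex[of "\<lambda>n. x (Y n)" Y] step_Mor[OF st] by metis
  then show ?thesis using that[of Y "\<lambda>n. x (Y n)"] st by (simp add: Y_def)
qed

text \<open>Maps from generators into \<open>H\<close> live at finite stages, and every transition
  \<open>y n\<close> factors as \<open>t \<cdot> \<theta> (Y n)\<close>. A map killed by
  \<open>\<theta>\<close> therefore dies one transition later, and the arrows \<open>t\<close>
  supply preimages.\<close>

lemma step_telescope_invs:
  assumes st: "\<And>n. step (Y n) (Y (Suc n)) (y n)" and tel: "telescope Y y A \<iota> s c d H"
  shows "H \<in> invs"
proof (rule invsI)
  note D = tel_D[OF tel] and j = tel_j[OF tel] and Y = tel_X[OF tel] and y = tel_x[OF tel]
  note jy = tel_jx[OF tel] and tr = transition_Mor[OF tel]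
  show "H \<in> obj T" by (rule D(6))
  fix m \<theta> assume \<theta>: "(m, \<theta>) \<in> \<Theta>"
  note cen = \<Theta>_center[OF \<theta>]
  note sH = center_simps[OF cen D(6)] and sY = center_simps[OF cen Y]
    and sSY = center_simps[OF cen obj_pow_obj[OF Y, of m]]
  have t: "\<exists>t\<in>Mor T (\<Sigma>o m (Y n)) (Y (Suc n)). t \<cdot> \<theta> (Y n) = y n" for n
    using st[of n] \<theta> unfolding step_def by blast
  show "is_iso T (\<theta> H)"
  proof (rule K_isoI[OF center_Mor[OF cen D(6)]])
    fix C w assume C: "C \<in> K" and w: "w \<in> Mor T C H" and tw: "\<theta> H \<cdot> w = azero T C (\<Sigma>o m H)"
    note Co = K_obj[OF C]
    obtain n f where f: "f \<in> Mor T C (Y n)" "c \<cdot> \<iota> n \<cdot> f = w" using tel_K_surj[OF tel C w] .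
    let ?j = "c \<cdot> \<iota> n"
    have tf: "\<theta> (Y n) \<cdot> f \<in> Mor T C (\<Sigma>o m (Y n))" using sY[of n] f by simp
    have "\<Sigma>a m ?j \<cdot> (\<theta> (Y n) \<cdot> f) = \<theta> H \<cdot> (?j \<cdot> f)"
    proof -
      have "\<Sigma>a m ?j \<cdot> (\<theta> (Y n) \<cdot> f) = \<Sigma>a m ?j \<cdot> \<theta> (Y n) \<cdot> f"
        by (rule assoc[symmetric]) (use arr_pow_Mor[OF j[of n], of m] sY[of n] f in simp_all)
      also have "\<dots> = \<theta> H \<cdot> ?j \<cdot> f" unfolding center_nat[OF cen j] ..
      also have "\<dots> = \<theta> H \<cdot> (?j \<cdot> f)" by (rule assoc) (use j[of n] sH f in simp_all)
      finally show ?thesis .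
    qed
    then have z: "\<Sigma>a m ?j \<cdot> (\<theta> (Y n) \<cdot> f) = azero T C (\<Sigma>o m H)" using tw f(2) by simp
    \<comment> \<open>The colimit description concerns \<open>H\<close> itself, whereas
      \<open>\<theta> (Y n) \<cdot> f\<close> maps into a suspended stage; it is moved to degree
      zero before \<open>tel_K_inj\<close> is used.\<close>
    obtain v where v: "v \<in> Mor T (\<Sigma>o (- m) C) (Y n)" "\<Sigma>a m v = \<theta> (Y n) \<cdot> f" using Mor_pow_lift[OF tf Y] .
    have "\<Sigma>a m (?j \<cdot> v) = \<Sigma>a m ?j \<cdot> \<Sigma>a m v" by (rule arr_pow_cmp) (use v(1) j[of n] in simp_all)
    then have "\<Sigma>a m (?j \<cdot> v) = azero T (\<Sigma>o m (\<Sigma>o (- m) C)) (\<Sigma>o m H)" using z v(2) Co by simp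
    then have "?j \<cdot> v = azero T (\<Sigma>o (- m) C) H"
      using arr_pow_eq_zero_iff[OF cmp_mor[OF v(1) j]] by blast
    then obtain k where k: "transition Y y n k \<cdot> v = azero T (\<Sigma>o (- m) C) (Y (n + k))" using tel_K_inj[OF tel K_pow[OF C] v(1)] by metis
    let ?t = "transition Y y n k"
    define h where "h = ?t \<cdot> f"
    have h: "h \<in> Mor T C (Y (n + k))" using tr[of n k] f by (simp add: h_def)
    have "\<theta> (Y (n + k)) \<cdot> h = \<Sigma>a m ?t \<cdot> \<Sigma>a m v"
      unfolding v(2) h_def using cmp_eqD[OF center_nat[OF cen tr[of n k]], of f] tr[of n k] sY f by simp
    also have "\<dots> = \<Sigma>a m (?t \<cdot> v)" by (rule arr_pow_cmp[symmetric]) (use v(1) tr[of n k] in simp_all)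
    finally have th: "\<theta> (Y (n + k)) \<cdot> h = azero T C (\<Sigma>o m (Y (n + k)))" unfolding k using Co Y by simp
    obtain t where t: "t \<in> Mor T (\<Sigma>o m (Y (n + k))) (Y (Suc (n + k)))" "t \<cdot> \<theta> (Y (n + k)) = y (n + k)" using t by blast
    have "y (n + k) \<cdot> h = t \<cdot> (\<theta> (Y (n + k)) \<cdot> h)" unfolding t(2)[symmetric] using t(1) sY[of "n + k"] h by simp
    then have yh: "y (n + k) \<cdot> h = azero T C (Y (Suc (n + k)))" unfolding th using t(1) Co by simp
    have "w = c \<cdot> \<iota> (n + k) \<cdot> ?t \<cdot> f" unfolding tel_jtransition[OF tel] using f(2) by simp
    also have "\<dots> = c \<cdot> \<iota> (n + k) \<cdot> h" unfolding h_def by (rule assoc) (use j[of "n + k"] tr[of n k] f in simp_all)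
    also have "\<dots> = c \<cdot> \<iota> (Suc (n + k)) \<cdot> y (n + k) \<cdot> h" unfolding jy ..
    also have "\<dots> = c \<cdot> \<iota> (Suc (n + k)) \<cdot> (y (n + k) \<cdot> h)"
      by (rule assoc) (use j[of "Suc (n + k)"] y[of "n + k"] h in simp_all)
    also have "\<dots> = azero T C H" unfolding yh by (subst cmp_azero) (use j[of "Suc (n + k)"] Co in simp_all)
    finally show "w = azero T C H" .
  next
    fix C e assume C: "C \<in> K" and e: "e \<in> Mor T C (\<Sigma>o m H)"
    note Co = K_obj[OF C]
    obtain e' where e': "e' \<in> Mor T (\<Sigma>o (- m) C) H" "\<Sigma>a m e' = e" using Mor_pow_lift[OF e D(6)] .
    obtain n f where f: "f \<in> Mor T (\<Sigma>o (- m) C) (Y n)" "c \<cdot> \<iota> n \<cdot> f = e'" using tel_K_surj[OF tel K_pow[OF C] e'(1)] .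
    define f' where "f' = \<Sigma>a m f"
    have f': "f' \<in> Mor T C (\<Sigma>o m (Y n))" using f(1) Co by (simp add: f'_def)
    obtain t where t: "t \<in> Mor T (\<Sigma>o m (Y n)) (Y (Suc n))" "t \<cdot> \<theta> (Y n) = y n" using t by blast
    \<comment> \<open>\<open>g\<close> extends the canonical map \<open>c \<cdot> \<iota> n\<close>
      along \<open>\<theta> (Y n)\<close>; it uses the next stage, where \<open>t\<close> lands. The
      preimage of \<open>e\<close> will be \<open>g \<cdot> f'\<close> up to sign.\<close>
    define g where "g = c \<cdot> \<iota> (Suc n) \<cdot> t"
    have g: "g \<in> Mor T (\<Sigma>o m (Y n)) H" using cmp_mor[OF t(1) j] by (simp add: g_def)
    have g\<theta>: "g \<cdot> \<theta> (Y n) = c \<cdot> \<iota> n"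
    proof -
      have "g \<cdot> \<theta> (Y n) = c \<cdot> \<iota> (Suc n) \<cdot> (t \<cdot> \<theta> (Y n))"
        unfolding g_def by (rule assoc) (use t(1) sY[of n] j[of "Suc n"] in simp_all)
      then show ?thesis unfolding t(2) jy .
    qed
    have e_eq: "\<Sigma>a m g \<cdot> \<Sigma>a m (\<theta> (Y n)) \<cdot> f' = e"
    proof -
      have "\<Sigma>a m g \<cdot> \<Sigma>a m (\<theta> (Y n)) = \<Sigma>a m (c \<cdot> \<iota> n)"
        unfolding g\<theta>[symmetric] by (rule arr_pow_cmp[symmetric]) (use g sY[of n] in simp_all)
      then have "\<Sigma>a m g \<cdot> \<Sigma>a m (\<theta> (Y n)) \<cdot> f' = \<Sigma>a m (c \<cdot> \<iota> n) \<cdot> \<Sigma>a m f" by (simp only: f'_def)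
      also have "\<dots> = \<Sigma>a m (c \<cdot> \<iota> n \<cdot> f)" by (rule arr_pow_cmp[symmetric]) (use f(1) j[of n] in simp_all)
      finally show ?thesis unfolding f(2) e'(2) .
    qed
    have gf: "g \<cdot> f' \<in> Mor T C H" by (rule cmp_mor[OF f' g])
    have "\<theta> H \<cdot> (g \<cdot> f') = \<Sigma>a m g \<cdot> \<theta> (\<Sigma>o m (Y n)) \<cdot> f'"
      unfolding center_nat[OF cen g] using sH g f' by simp
    moreover have "\<Sigma>a m g \<cdot> (\<boxminus> \<Sigma>a m (\<theta> (Y n))) \<cdot> f' = \<boxminus> (\<Sigma>a m g \<cdot> \<Sigma>a m (\<theta> (Y n)) \<cdot> f')"
      using g sY[of n] f' by simp
    \<comment> \<open>The sign between \<open>\<theta> (\<Sigma>o m (Y n))\<close> and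
      \<open>\<Sigma>a m (\<theta> (Y n))\<close> is unknown; it is absorbed by negating the
      preimage if necessary.\<close>
    ultimately have "\<theta> H \<cdot> (g \<cdot> f') = e \<or> \<theta> H \<cdot> (g \<cdot> f') = \<boxminus> e"
      using center_pow[OF cen Y, of m n] e_eq by metis
    moreover have "\<theta> H \<cdot> \<boxminus> (g \<cdot> f') = \<boxminus> (\<theta> H \<cdot> (g \<cdot> f'))" using sH g f' by simp
    moreover have "\<boxminus> (\<boxminus> e) = e" using e by simp
    moreover have "\<boxminus> (g \<cdot> f') \<in> Mor T C H" using gf by simp
    ultimately show "\<exists>v\<in>Mor T C H. \<theta> H \<cdot> v = e" using gf by metis
  qed
qed

text \<open>All stages and fibres lie in \<open>Loc_of {X}\<close> and the fibres are torsion, so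
  \<open>telescope_cone\<close> applies to the intersection of these two localizing
  subcategories.\<close>

lemma tors_tri:
  assumes X: "X \<in> obj T"
    and X0: "Y 0 = X" and st: "\<And>n. step (Y n) (Y (Suc n)) (y n)" and tel: "telescope Y y A \<iota> s c d H"
  obtains f g h G where "triangle f g h G X H" "G \<in> tors" "G \<in> Loc_of {X}"
proof -
  have LX: "is_localizing (Loc_of {X})" using Loc_localizing[of "{X}"] X by simp
  note tLX = localizing_triangulated[OF LX] and tt = localizing_triangulated[OF tors_localizing]
  have F: "\<exists>k h F. triangle k (y n) h F (Y n) (Y (Suc n)) \<and> F \<in> tors \<and> F \<in> Loc_of {Y n}" for n
    using st[of n] unfolding step_def by blast
  have YL: "Y n \<in> Loc_of {X}" for n
  proof (induction n)
    case (Suc n)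
    obtain k h F where F: "triangle k (y n) h F (Y n) (Y (Suc n))" "F \<in> Loc_of {Y n}" using F by blast
    have "F \<in> Loc_of {X}" using Loc_min[OF LX, of "{Y n}"] Suc F(2) by blast
    then show ?case using tsub_cone[OF tLX F(1)] Suc by blast
  qed (use X0 Loc_self in simp)
  have cones: "\<exists>g h N. triangle (y n) g h (Y n) (Y (Suc n)) N \<and> N \<in> tors \<inter> Loc_of {X}" for n
  proof -
    obtain k h F where F: "triangle k (y n) h F (Y n) (Y (Suc n))" "F \<in> tors" "F \<in> Loc_of {Y n}" using F by blast
    have "F \<in> Loc_of {X}" using Loc_min[OF LX, of "{Y n}"] YL[of n] F(3) by blast
    then have "\<Sigma>o 1 F \<in> tors \<inter> Loc_of {X}" using F(2) tors_pow tsub_pow[OF tLX triangleD(4)[OF F(1)]] by simp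
    then show ?thesis using triangle_rot[OF F(1)] by blast
  qed
  obtain f g h G where "triangle f g h G (Y 0) H" "G \<in> tors \<inter> Loc_of {X}"
    using telescope_cone[OF tel localizing_Int[OF tors_localizing LX] cones] .
  then show ?thesis using that X0 by simp
qed

lemma tors_invs_zero:
  assumes X: "X \<in> tors" "X \<in> invs" shows "is_zero_obj T X"
proof (rule K_conservative[OF tors_obj[OF X(1)]])
  fix C w assume C: "C \<in> K" and w: "w \<in> Mor T C X"
  obtain n \<theta> where \<theta>: "(n, \<theta>) \<in> \<Theta>" "\<theta> X \<cdot> w = azero T C (\<Sigma>o n X)"
    using torsD[OF X(1) C w] w unfolding killed_def by auto
  show "w = azero T C X"
    using iso_cmp_zeroD[OF invs_iso[OF X(2) \<theta>(1)], of w C] \<theta>(2) w center_simps[OF \<Theta>_center[OF \<theta>(1)] tors_obj[OF X(1)]] by simp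
qed

text \<open>Localize the torsion object \<open>Y\<close>: its telescope \<open>H\<close> is torsion
  and local, hence zero. The map \<open>g\<close> extends over each stage, since the fibres have no
  nonzero maps to \<open>W\<close>, and so over \<open>H\<close>; thus it factors through
  zero.\<close>

lemma tors_invs_orth:
  assumes Y: "Y \<in> tors" and W: "W \<in> invs" and g: "g \<in> Mor T Y W"
  shows "g = azero T Y W"
proof -
  obtain Z z A \<iota> s c d H where Z: "Z 0 = Y" and st: "\<And>n. step (Z n) (Z (Suc n)) (z n)" and tel: "telescope Z z A \<iota> s c d H"
    using step_seq[OF tors_obj[OF Y]] by metis
  obtain p q r G where G: "triangle p q r G Y H" "G \<in> tors" using tors_tri[OF tors_obj[OF Y] Z st tel] by metis
  have "H \<in> tors" by (rule tsub_cone[OF localizing_triangulated[OF tors_localizing] G Y])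
  then have H0: "is_zero_obj T H" using tors_invs_zero step_telescope_invs[OF st tel] by blast
  \<comment> \<open>The extensions over the stages are chosen recursively, each along the next
    transition, so that they form a compatible family.\<close>
  define e where "e = rec_nat g (\<lambda>n f. SOME v. v \<in> Mor T (Z (Suc n)) W \<and> v \<cdot> z n = f)"
  have e_Suc: "e (Suc n) = (SOME v. v \<in> Mor T (Z (Suc n)) W \<and> v \<cdot> z n = e n)" for n by (simp add: e_def)
  have extensions: "\<exists>v. v \<in> Mor T (Z (Suc n)) W \<and> v \<cdot> z n = f" if f: "f \<in> Mor T (Z n) W" for n f
  proof -
    obtain k h F where F: "triangle k (z n) h F (Z n) (Z (Suc n))" "\<And>w. w \<in> Mor T F W \<Longrightarrow> w = azero T F W"
      using st[of n] W unfolding step_def by blast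
    have "f \<cdot> k = azero T F W" by (rule F(2)[OF cmp_mor[OF triangleD(1)[OF F(1)] f]])
    then show ?thesis using triangle_coexact[OF F(1) f] by metis
  qed
  have e: "e n \<in> Mor T (Z n) W" for n
  proof (induction n)
    case (Suc n)
    show ?case using someI_ex[OF extensions[OF Suc]] unfolding e_Suc by blast
  qed (use g Z in \<open>simp add: e_def\<close>)
  have ez: "e (Suc n) \<cdot> z n = e n" for n
    using someI_ex[OF extensions[OF e[of n]]] unfolding e_Suc[of n] by (rule conjunct2)
  obtain v where v: "v \<in> Mor T H W" "\<And>n. v \<cdot> (c \<cdot> \<iota> n) = e n" using tel_desc[OF tel e ez] by metis
  have "v = azero T H W" by (rule zero_src_eq[OF H0 v(1)])
  then have "e 0 = azero T (Z 0) W" using v(2)[of 0] tel_j[OF tel, of 0] invs_obj[OF W] by simp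
  then show ?thesis using Z by (simp add: e_def)
qed

text \<open>For an object orthogonal to torsion, the torsion fibre of \<open>X -> H\<close> maps to
  \<open>X\<close> by zero and is therefore zero; so \<open>X\<close> is isomorphic to the local
  object \<open>H\<close>.\<close>

lemma orth_tors: "orth tors = invs"
proof
  have sub: "invs \<subseteq> orth tors"
  proof
    fix W assume W: "W \<in> invs"
    show "W \<in> orth tors"
    proof (rule orthI[OF invs_obj[OF W]])
      show "tors \<subseteq> obj T" using tors_obj by blast
      show "w = azero T Y W" if "Y \<in> tors" "w \<in> Mor T Y W" for Y w by (rule tors_invs_orth[OF that(1) W that(2)])
    qed
  qed
  then show "invs \<subseteq> orth tors" .
  show "orth tors \<subseteq> invs"
  proof
    fix X assume X: "X \<in> orth tors"
    then have Xo: "X \<in> obj T" by (simp add: orth_def)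
    obtain Z z A \<iota> s c d H where Z: "Z 0 = X" and st: "\<And>n. step (Z n) (Z (Suc n)) (z n)" and tel: "telescope Z z A \<iota> s c d H"
      using step_seq[OF Xo] by metis
    obtain p q r G where G: "triangle p q r G X H" "G \<in> tors" using tors_tri[OF Xo Z st tel] by metis
    note E = triangleD[OF G(1)]
    have H: "H \<in> invs" by (rule step_telescope_invs[OF st tel])
    have "p = azero T G X" by (rule orth_zero[OF X G(2) E(1)])
    then have "p \<cdot> idt T G = azero T G X" using E by simp
    then have "idt T G = azero T G G"
      by (rule triangle_orth_mono[OF localizing_triangulated[OF tors_localizing] G(1) subsetD[OF sub H] G(2) idt_mor[OF E(4)]])
    then have "is_zero_obj T G" using E(4) unfolding is_zero_obj_iff by (intro conjI)
    then have "is_iso T q" by (rule triangle_zero_fst[OF G(1)])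
    then have "isomorphic T X H" using E(2) unfolding isomorphic_def by (intro bexI)
    then show "X \<in> invs" using tsub_iso[OF localizing_triangulated[OF invs_localizing] H] isomorphic_sym by blast
  qed
qed

lemma smashing_tors: "smashing tors"
  unfolding smashing_def orth_tors
proof (intro conjI ballI)
  fix X assume X: "X \<in> obj T"
  obtain Z z A \<iota> s c d H where Z: "Z 0 = X" and st: "\<And>n. step (Z n) (Z (Suc n)) (z n)" and tel: "telescope Z z A \<iota> s c d H"
    using step_seq[OF X] by metis
  obtain p q r G where G: "triangle p q r G X H" "G \<in> tors" "G \<in> Loc_of {X}" using tors_tri[OF X Z st tel] by metis
  then show "\<exists>f g h G L. triangle f g h G X L \<and> G \<in> tors \<and> G \<in> Loc_of {X} \<and> L \<in> invs"
    using step_telescope_invs[OF st tel] by blast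
qed (rule tors_localizing invs_localizing)+

end

section \<open>Compact generation\<close>

text \<open>\<open>gfinprod\<close> is the finite product over the support, and the unit if the
  support is infinite; the hypothesis on the unit covers that default as well as the empty
  product.\<close>

lemma (in comm_monoid) gfinprod_induct:
  assumes f: "f \<in> A \<rightarrow> carrier G" and one: "P \<one>" and step: "\<And>i. i \<in> A \<Longrightarrow> P (f i)"
    and mult: "\<And>x y. x \<in> carrier G \<Longrightarrow> y \<in> carrier G \<Longrightarrow> P x \<Longrightarrow> P y \<Longrightarrow> P (x \<otimes> y)"
  shows "P (gfinprod G f A)"
proof -
  have "P (finprod G f B)" if "finite B" "B \<subseteq> A" for B
    using that
  proof (induction B rule: finite_induct)
    case (insert b B)
    have fB: "f \<in> B \<rightarrow> carrier G" and fb: "f b \<in> carrier G" using f insert.prems by auto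
    then have "finprod G f (insert b B) = f b \<otimes> finprod G f B" using insert by (simp add: finprod_insert)
    then show ?case using mult[OF fb finprod_closed[OF fB]] step insert by simp
  qed (simp add: one)
  then show ?thesis using one unfolding gfinprod_def by simp
qed

context compactly_generated_cat
begin

lemma \<kappa>_facts: "Card_order \<kappa>" "natLeq <o \<kappa>"
  using size_bound unfolding size_bound_def by auto

lemma coproduct_cat: "coproduct_cat \<kappa> T"
  by unfold_locales (use \<kappa>_facts coproducts in auto)

text \<open>Generators closed under suspension by construction. Compactness of \<open>C\<close>
  passes to its shifts in the form of the induction rule, by desuspending the target.\<close>

definition shifts where
  "shifts = {\<Sigma>o n C | n C. compact_obj \<kappa> T C}"

lemma compact_induct:
  fixes I :: "'i set"
  assumes C: "compact_obj \<kappa> T C" and I: "|I| <o \<kappa>" and S: "is_coproduct T I X S \<iota>"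
    and X: "\<And>i. i \<in> I \<Longrightarrow> X i \<in> obj T" and e: "e \<in> Mor T C S" and zero: "P (azero T C S)"
    and inj: "\<And>i f. i \<in> I \<Longrightarrow> f \<in> Mor T C (X i) \<Longrightarrow> P (\<iota> i \<cdot> f)"
    and add: "\<And>u v. u \<in> Mor T C S \<Longrightarrow> v \<in> Mor T C S \<Longrightarrow> P u \<Longrightarrow> P v \<Longrightarrow> P (u \<boxplus> v)"
  shows "P e"
proof -
  have Co: "C \<in> obj T" using C by (simp add: compact_obj_def)
  interpret comm_group "mor_group T C S" by (rule mor_comm_group[OF Co coprod_obj[OF S]])
  have "X ` I \<subseteq> obj T" using X by blast
  then have "bij_betw (\<lambda>f. gfinprod (mor_group T C S) (\<lambda>i. \<iota> i \<cdot> f i) I)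
          (carrier (sum_group I (\<lambda>i. mor_group T C (X i)))) (Mor T C S)"
    using C I S unfolding compact_obj_def by blast
  then obtain f where f: "f \<in> carrier (sum_group I (\<lambda>i. mor_group T C (X i)))"
    "e = gfinprod (mor_group T C S) (\<lambda>i. \<iota> i \<cdot> f i) I"
    using e unfolding bij_betw_def by blast
  have "group (mor_group T C (X i))" if "i \<in> I" for i
    using mor_comm_group[OF Co X[OF that]] by (rule comm_group.axioms(2))
  from carrier_sum_group[of I "\<lambda>i. mor_group T C (X i)", OF this] f(1)
  have fi: "f i \<in> Mor T C (X i)" if "i \<in> I" for i using that by (auto simp del: Mor_def simp: PiE_iff)
  show ?thesis unfolding f(2)
  proof (rule gfinprod_induct)
    show "(\<lambda>i. \<iota> i \<cdot> f i) \<in> I \<rightarrow> carrier (mor_group T C S)"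
      using cmp_mor[OF fi coprod_inj[OF S]] by (simp del: Mor_def)
    show "P \<one>\<^bsub>mor_group T C S\<^esub>" using zero by simp
    show "P (\<iota> i \<cdot> f i)" if "i \<in> I" for i by (rule inj[OF that fi[OF that]])
    show "P (u \<otimes>\<^bsub>mor_group T C S\<^esub> v)"
      if "u \<in> carrier (mor_group T C S)" "v \<in> carrier (mor_group T C S)" "P u" "P v" for u v
      using add that by (simp del: Mor_def)
  qed
qed

lemma generated_cat: "generated_cat \<kappa> T shifts"
proof -
  interpret coproduct_cat \<kappa> T by (rule coproduct_cat)
  show ?thesis
  proof unfold_locales
    fix C assume "C \<in> shifts"
    then obtain m D where D: "C = \<Sigma>o m D" "compact_obj \<kappa> T D" unfolding shifts_def by blast
    have Do: "D \<in> obj T" using D(2) by (simp add: compact_obj_def)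
    show Co: "C \<in> obj T" using D(1) Do by simp
    show "\<Sigma>o n C \<in> shifts" for n
      unfolding shifts_def mem_Collect_eq using D Do by (intro exI[of _ "n + m"] exI[of _ D]) simp
    fix I :: "'i set" and X S \<iota> e P
    assume I: "|I| <o \<kappa>" and S: "is_coproduct T I X S \<iota>"
      and X: "\<And>i. i \<in> I \<Longrightarrow> X i \<in> obj T" and e: "e \<in> Mor T C S" and zero: "P (azero T C S)"
      and inj: "\<And>i f. i \<in> I \<Longrightarrow> f \<in> Mor T C (X i) \<Longrightarrow> P (\<iota> i \<cdot> f)"
      and add: "\<And>u v. u \<in> Mor T C S \<Longrightarrow> v \<in> Mor T C S \<Longrightarrow> P u \<Longrightarrow> P v \<Longrightarrow> P (u \<boxplus> v)"
    note So = coprod_obj[OF S]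
    \<comment> \<open>Desuspending by \<open>m\<close> turns \<open>e\<close> into a map from the
      compact object \<open>D\<close> to the desuspended coproduct; the property is transported
      along the suspension.\<close>
    have "P (\<Sigma>a m (\<Sigma>a (- m) e))"
    proof (rule compact_induct[OF D(2) I coprod_pow[OF S X, of "- m"], where e = "\<Sigma>a (- m) e" and P = "\<lambda>e. P (\<Sigma>a m e)"])
      show "\<Sigma>o (- m) (X i) \<in> obj T" if "i \<in> I" for i using X[OF that] by simp
      show "\<Sigma>a (- m) e \<in> Mor T D (\<Sigma>o (- m) S)" using e D(1) Do by simp
      show "P (\<Sigma>a m (azero T D (\<Sigma>o (- m) S)))" using zero D(1) Do So by simp
      fix i f assume i: "i \<in> I" and f: "f \<in> Mor T D (\<Sigma>o (- m) (X i))"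
      have "\<Sigma>a m f \<in> Mor T C (X i)" using f D(1) X[OF i] by simp
      then have "P (\<iota> i \<cdot> \<Sigma>a m f)" by (rule inj[OF i])
      then show "P (\<Sigma>a m (\<Sigma>a (- m) (\<iota> i) \<cdot> f))" using f coprod_inj[OF S i] by simp
    next
      fix u v assume u: "u \<in> Mor T D (\<Sigma>o (- m) S)" and v: "v \<in> Mor T D (\<Sigma>o (- m) S)"
        and P: "P (\<Sigma>a m u)" "P (\<Sigma>a m v)"
      have "\<Sigma>a m u \<in> Mor T C S" "\<Sigma>a m v \<in> Mor T C S" using u v D(1) So by simp_all
      then have "P (\<Sigma>a m u \<boxplus> \<Sigma>a m v)" using P by (rule add)
      then show "P (\<Sigma>a m (u \<boxplus> v))" using u v by simp
    qed
    then show "P e" using e by simp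
  next
    obtain G where G: "G \<subseteq> {C. compact_obj \<kappa> T C}" "Loc_of G = obj T" using compactly_generated by blast
    have "C \<in> shifts" if "compact_obj \<kappa> T C" for C
      unfolding shifts_def mem_Collect_eq using that by (intro exI[of _ 0] exI[of _ C]) simp
    then have "G \<subseteq> shifts" using G(1) by blast
    moreover have "shifts \<subseteq> obj T" unfolding shifts_def compact_obj_def by auto
    ultimately show "Loc_of shifts = obj T"
      using Loc_min[OF localizing_obj, of shifts] Loc_incl[of shifts] Loc_min[OF Loc_localizing, of shifts G] G(2) by blast
  qed
qed

end

sublocale compactly_generated_cat \<subseteq> generated_cat \<kappa> T shifts
  by (rule generated_cat)

section \<open>Homogeneous components and homogeneous primes\<close>

context graded_ring
begin

lemma hpart_sub: "x \<in> hpart R n \<Longrightarrow> x \<in> carrier R"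
  using additive_subgroup.a_subset[OF hpart_subgroup] by blast

lemma hpart_zero: "\<zero> \<in> hpart R n"
  by (rule additive_subgroup.zero_closed[OF hpart_subgroup])

lemma hpart_add: "x \<in> hpart R n \<Longrightarrow> y \<in> hpart R n \<Longrightarrow> x \<oplus> y \<in> hpart R n"
  by (rule additive_subgroup.a_closed[OF hpart_subgroup])

lemma hpart_neg: "x \<in> hpart R n \<Longrightarrow> \<ominus> x \<in> hpart R n"
  by (rule additive_subgroup.a_inv_closed[OF hpart_subgroup])

lemma hpart_pow: "x \<in> hpart R n \<Longrightarrow> x [^] k \<in> hpart R (int k * n)"
proof (induction k)
  case (Suc k)
  then show ?case using mult_hpart[of "x [^] k" "int k * n" x n] by (simp add: algebra_simps)
qed (simp add: one_hpart)

text \<open>Finitely supported families of homogeneous elements: the carrier of the direct sum in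
  the grading axiom, in explicit form.\<close>

definition coeffs where
  "coeffs = {c. (\<forall>n. c n \<in> hpart R n) \<and> finite {n :: int. c n \<noteq> \<zero>}}"

lemma coeffs_bij: "bij_betw (\<lambda>c. gfinprod (add_monoid R) c UNIV) coeffs (carrier R)"
proof -
  have "group ((add_monoid R)\<lparr>carrier := hpart R n\<rparr>)" for n
    by (rule subgroup.subgroup_is_group[OF additive_subgroup.a_subgroup[OF hpart_subgroup] add.is_group])
  then have "carrier (sum_group UNIV (\<lambda>n. (add_monoid R)\<lparr>carrier := hpart R n\<rparr>)) = coeffs"
    by (simp add: carrier_sum_group coeffs_def PiE_def extensional_def Pi_def)
  then show ?thesis using direct_sum by simp
qed

definition component where
  "component x = inv_into coeffs (\<lambda>c. gfinprod (add_monoid R) c UNIV) x"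

lemma component_coeffs: "x \<in> carrier R \<Longrightarrow> component x \<in> coeffs"
  and component_sum: "x \<in> carrier R \<Longrightarrow> gfinprod (add_monoid R) (component x) UNIV = x"
  unfolding component_def
  using bij_betwE[OF bij_betw_inv_into[OF coeffs_bij]] bij_betw_inv_into_right[OF coeffs_bij] by simp_all

lemma component_unique:
  assumes "c \<in> coeffs" "gfinprod (add_monoid R) c UNIV = x" shows "component x = c"
  unfolding component_def assms(2)[symmetric] by (rule bij_betw_inv_into_left[OF coeffs_bij assms(1)])

lemma component_hpart: "x \<in> carrier R \<Longrightarrow> component x n \<in> hpart R n"
  using component_coeffs by (simp add: coeffs_def)

lemma component_finite: "x \<in> carrier R \<Longrightarrow> finite {n. component x n \<noteq> \<zero>}"
  using component_coeffs by (simp add: coeffs_def)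

lemma component_add:
  assumes x: "x \<in> carrier R" and y: "y \<in> carrier R"
  shows "component (x \<oplus> y) n = component x n \<oplus> component y n"
proof -
  note A = a_comm_monoid
  define c where "c n = component x n \<oplus> component y n" for n
  have cx: "component x n \<in> carrier R" and cy: "component y n \<in> carrier R" for n
    by (rule hpart_sub[OF component_hpart[OF x]], rule hpart_sub[OF component_hpart[OF y]])
  have "c n = \<zero>" if "component x n = \<zero>" "component y n = \<zero>" for n
    unfolding c_def that by (rule l_zero[OF zero_closed])
  then have "{n. c n \<noteq> \<zero>} \<subseteq> {n. component x n \<noteq> \<zero>} \<union> {n. component y n \<noteq> \<zero>}" by blast
  then have "finite {n. c n \<noteq> \<zero>}"
    by (rule finite_subset) (rule finite_UnI[OF component_finite[OF x] component_finite[OF y]])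
  moreover have "c n \<in> hpart R n" for n
    unfolding c_def by (rule hpart_add[OF component_hpart[OF x] component_hpart[OF y]])
  ultimately have c: "c \<in> coeffs" unfolding coeffs_def by blast
  have "gfinprod (add_monoid R) (\<lambda>n. component x n \<otimes>\<^bsub>add_monoid R\<^esub> component y n) UNIV =
      gfinprod (add_monoid R) (component x) UNIV \<otimes>\<^bsub>add_monoid R\<^esub> gfinprod (add_monoid R) (component y) UNIV"
    by (rule comm_monoid.gfinprod_distrib[OF A])
      (simp_all only: monoid_record_simps UNIV_I simp_thms component_finite[OF x] component_finite[OF y] Pi_I cx cy)
  then have "gfinprod (add_monoid R) c UNIV = x \<oplus> y"
    unfolding component_sum[OF x] component_sum[OF y] monoid_record_simps c_def .
  then show ?thesis using component_unique[OF c] by (simp only: c_def)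
qed

lemma component_homogeneous:
  assumes x: "x \<in> hpart R m" shows "component x n = (if n = m then x else \<zero>)"
proof -
  note A = a_comm_monoid
  let ?c = "\<lambda>n. if n = m then x else \<zero>"
  have "{n. ?c n \<noteq> \<zero>} \<subseteq> {m}" by auto
  then have fin: "finite {n. ?c n \<noteq> \<zero>}" by (rule finite_subset) simp
  have c: "?c \<in> coeffs" using x hpart_zero fin by (simp add: coeffs_def)
  have "gfinprod (add_monoid R) ?c UNIV = x"
  proof -
    have "gfinprod (add_monoid R) ?c UNIV = gfinprod (add_monoid R) ?c {m}"
      by (rule comm_monoid.gfinprod_mono_neutral_cong_right[OF A]) (use hpart_sub[OF x] in auto)
    also have "\<dots> = finprod (add_monoid R) ?c {m}"
      by (rule comm_monoid.gfinprod_eq_finprod[OF A]) (use hpart_sub[OF x] in auto)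
    also have "\<dots> = x" using hpart_sub[OF x] by (subst comm_monoid.finprod_insert[OF A]) (auto simp: comm_monoid.finprod_empty[OF A])
    finally show ?thesis .
  qed
  then show ?thesis using component_unique[OF c] by simp
qed

lemma component_induct:
  assumes x: "x \<in> carrier R" and zero: "P \<zero>" and comp: "\<And>n. P (component x n)"
    and add: "\<And>y z. y \<in> carrier R \<Longrightarrow> z \<in> carrier R \<Longrightarrow> P y \<Longrightarrow> P z \<Longrightarrow> P (y \<oplus> z)"
  shows "P x"
proof -
  note A = a_comm_monoid
  have "P (gfinprod (add_monoid R) (component x) UNIV)"
    by (rule comm_monoid.gfinprod_induct[OF A]) (use zero comp add hpart_sub[OF component_hpart[OF x]] in auto)
  then show ?thesis using component_sum[OF x] by simp
qed

text \<open>A homogeneous ideal is encoded by the set of pairs \<open>(n, a)\<close> with \<open>a\<close> an element of degree \<open>n\<close>;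
  keeping the degree avoids the ambiguity of the degree of \<open>0\<close>.\<close>

definition hfam where
  "hfam H \<longleftrightarrow> (\<forall>n a. (n, a) \<in> H \<longrightarrow> a \<in> hpart R n) \<and> (\<forall>n. (n, \<zero>) \<in> H) \<and>
     (\<forall>n a b. (n, a) \<in> H \<longrightarrow> (n, b) \<in> H \<longrightarrow> (n, a \<oplus> b) \<in> H) \<and>
     (\<forall>m s n a. s \<in> hpart R m \<longrightarrow> (n, a) \<in> H \<longrightarrow> (m + n, s \<otimes> a) \<in> H \<and> (m + n, a \<otimes> s) \<in> H)"

text \<open>The ordinary ideal that belongs to \<open>H\<close>: its elements are those whose
  components all lie in \<open>H\<close>, in the matching degrees.\<close>

definition hspan where
  "hspan H = {x \<in> carrier R. \<forall>n. (n, component x n) \<in> H}"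

context
  fixes H assumes H: "hfam H"
begin

lemma hfam_hpart: "(n, a) \<in> H \<Longrightarrow> a \<in> hpart R n"
  and hfam_zero: "(n, \<zero>) \<in> H"
  and hfam_add: "(n, a) \<in> H \<Longrightarrow> (n, b) \<in> H \<Longrightarrow> (n, a \<oplus> b) \<in> H"
  and hfam_mult: "s \<in> hpart R m \<Longrightarrow> (n, a) \<in> H \<Longrightarrow> (m + n, s \<otimes> a) \<in> H"
    "s \<in> hpart R m \<Longrightarrow> (n, a) \<in> H \<Longrightarrow> (m + n, a \<otimes> s) \<in> H"
  using H unfolding hfam_def by blast+

lemma hfam_neg: assumes a: "(n, a) \<in> H" shows "(n, \<ominus> a) \<in> H"
  using hfam_mult(1)[OF hpart_neg[OF one_hpart] a] hpart_sub[OF hfam_hpart[OF a]] by (simp add: l_minus)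

lemma hspan_hpart: "x \<in> hpart R n \<Longrightarrow> x \<in> hspan H \<longleftrightarrow> (n, x) \<in> H"
  using component_homogeneous[of x n] hpart_sub hfam_zero unfolding hspan_def by auto

lemma hspan_add: "x \<in> hspan H \<Longrightarrow> y \<in> hspan H \<Longrightarrow> x \<oplus> y \<in> hspan H"
  unfolding hspan_def using component_add hfam_add by simp

lemma hspan_zero: "\<zero> \<in> hspan H"
  using hspan_hpart[OF hpart_zero[of 0]] hfam_zero by blast

lemma hspan_carrier: "x \<in> hspan H \<Longrightarrow> x \<in> carrier R"
  by (simp add: hspan_def)

lemma hspan_component: "x \<in> hspan H \<Longrightarrow> (n, component x n) \<in> H"
  by (simp add: hspan_def)

text \<open>The claim is additive in each factor, so it reduces to components: of \<open>x\<close>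
  for a homogeneous scalar, and then of the scalar \<open>r\<close>.\<close>

lemma hspan_mult:
  assumes x: "x \<in> hspan H" and r: "r \<in> carrier R"
  shows "r \<otimes> x \<in> hspan H" "x \<otimes> r \<in> hspan H"
proof -
  have hom: "s \<otimes> x \<in> hspan H \<and> x \<otimes> s \<in> hspan H" if s: "s \<in> hpart R m" for s m
  proof (rule component_induct[OF hspan_carrier[OF x], of "\<lambda>y. s \<otimes> y \<in> hspan H \<and> y \<otimes> s \<in> hspan H"])
    note sR = hpart_sub[OF s]
    show "s \<otimes> \<zero> \<in> hspan H \<and> \<zero> \<otimes> s \<in> hspan H" using sR hspan_zero by simp
    fix n
    note c = hspan_component[OF x, of n]
    have "s \<otimes> component x n \<in> hpart R (m + n)" "component x n \<otimes> s \<in> hpart R (m + n)"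
      using hfam_hpart hfam_mult[OF s c] by blast+
    then show "s \<otimes> component x n \<in> hspan H \<and> component x n \<otimes> s \<in> hspan H"
      using hspan_hpart hfam_mult[OF s c] by blast
  next
    fix y z assume yz: "y \<in> carrier R" "z \<in> carrier R" and
      "s \<otimes> y \<in> hspan H \<and> y \<otimes> s \<in> hspan H" "s \<otimes> z \<in> hspan H \<and> z \<otimes> s \<in> hspan H"
    then show "s \<otimes> (y \<oplus> z) \<in> hspan H \<and> (y \<oplus> z) \<otimes> s \<in> hspan H"
      using hpart_sub[OF s] hspan_add by (simp add: l_distr r_distr)
  qed
  have "r \<otimes> x \<in> hspan H \<and> x \<otimes> r \<in> hspan H"
  proof (rule component_induct[OF r, of "\<lambda>r. r \<otimes> x \<in> hspan H \<and> x \<otimes> r \<in> hspan H"])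
    show "\<zero> \<otimes> x \<in> hspan H \<and> x \<otimes> \<zero> \<in> hspan H" using hspan_carrier[OF x] hspan_zero by simp
    show "component r n \<otimes> x \<in> hspan H \<and> x \<otimes> component r n \<in> hspan H" for n
      by (rule hom[OF component_hpart[OF r]])
    fix y z assume yz: "y \<in> carrier R" "z \<in> carrier R" and
      "y \<otimes> x \<in> hspan H \<and> x \<otimes> y \<in> hspan H" "z \<otimes> x \<in> hspan H \<and> x \<otimes> z \<in> hspan H"
    then show "(y \<oplus> z) \<otimes> x \<in> hspan H \<and> x \<otimes> (y \<oplus> z) \<in> hspan H"
      using hspan_carrier[OF x] hspan_add by (simp add: l_distr r_distr)
  qed
  then show "r \<otimes> x \<in> hspan H" "x \<otimes> r \<in> hspan H" by auto
qed

lemma hspan_ideal: "ideal (hspan H) R"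
proof (rule idealI[OF ring_axioms])
  show "subgroup (hspan H) (add_monoid R)"
  proof (rule add.subgroupI)
    show "hspan H \<subseteq> carrier R" using hspan_carrier by blast
    show "hspan H \<noteq> {}" using hspan_zero by blast
    fix a assume a: "a \<in> hspan H"
    have "\<ominus> \<one> \<otimes> a \<in> hspan H" by (rule hspan_mult(1)[OF a]) simp
    then show "\<ominus> a \<in> hspan H" using hspan_carrier[OF a] by (simp add: l_minus)
  next
    show "a \<oplus> b \<in> hspan H" if "a \<in> hspan H" "b \<in> hspan H" for a b by (rule hspan_add[OF that])
  qed
qed (fact hspan_mult)+

end

lemma homogeneous_sub: "homogeneous R \<subseteq> carrier R"
  unfolding homogeneous_def using hpart_sub by blast

lemma hspan_homogeneous: assumes H: "hfam H" shows "homogeneous_ideal (hspan H) R"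
  unfolding homogeneous_ideal_def
proof
  show id: "ideal (hspan H) R" by (rule hspan_ideal[OF H])
  have sub: "hspan H \<inter> homogeneous R \<subseteq> carrier R" using homogeneous_sub by blast
  note gid = genideal_ideal[OF sub]
  have "Idl (hspan H \<inter> homogeneous R) \<subseteq> hspan H" by (rule genideal_minimal[OF id]) blast
  moreover have "x \<in> Idl (hspan H \<inter> homogeneous R)" if x: "x \<in> hspan H" for x
  proof (rule component_induct[OF hspan_carrier[OF H x], of "\<lambda>y. y \<in> Idl (hspan H \<inter> homogeneous R)"])
    show "\<zero> \<in> Idl (hspan H \<inter> homogeneous R)" by (rule additive_subgroup.zero_closed[OF ideal.axioms(1)[OF gid]])
    fix n
    have "component x n \<in> hpart R n" by (rule hfam_hpart[OF H hspan_component[OF H x]])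
    then have "component x n \<in> hspan H \<inter> homogeneous R"
      using hspan_hpart[OF H] hspan_component[OF H x] unfolding homogeneous_def by blast
    then show "component x n \<in> Idl (hspan H \<inter> homogeneous R)" using genideal_self[OF sub] by blast
  next
    show "y \<oplus> z \<in> Idl (hspan H \<inter> homogeneous R)"
      if "y \<in> Idl (hspan H \<inter> homogeneous R)" "z \<in> Idl (hspan H \<inter> homogeneous R)" for y z
      by (rule additive_subgroup.a_closed[OF ideal.axioms(1)[OF gid] that])
  qed
  ultimately show "hspan H = Idl (hspan H \<inter> homogeneous R)" by blast
qed

section \<open>Homogeneous primes\<close>

lemma SpecD:
  assumes "\<pp> \<in> Spec R"
  shows "ideal \<pp> R" "\<pp> = Idl (\<pp> \<inter> homogeneous R)" "\<one> \<notin> \<pp>"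
    "\<And>a b m n. a \<in> hpart R m \<Longrightarrow> b \<in> hpart R n \<Longrightarrow> a \<otimes> b \<in> \<pp> \<Longrightarrow> a \<in> \<pp> \<or> b \<in> \<pp>"
proof -
  show id: "ideal \<pp> R" and "\<pp> = Idl (\<pp> \<inter> homogeneous R)"
    using assms unfolding Spec_def homogeneous_ideal_def by blast+
  show "\<one> \<notin> \<pp>" using ideal.one_imp_carrier[OF id] assms unfolding Spec_def by blast
  show "a \<in> \<pp> \<or> b \<in> \<pp>" if "a \<in> hpart R m" "b \<in> hpart R n" "a \<otimes> b \<in> \<pp>" for a b m n
    using assms that unfolding Spec_def homogeneous_def by blast
qed

text \<open>Homogeneity is defined through generation by homogeneous elements. The homogeneous
  elements of \<open>\<pp>\<close> span an ideal closed under components and containing these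
  generators, hence containing \<open>\<pp>\<close>.\<close>

lemma Spec_component:
  assumes p: "\<pp> \<in> Spec R" and x: "x \<in> \<pp>" shows "component x n \<in> \<pp>"
proof -
  note id = SpecD(1)[OF p]
  note sg = ideal.axioms(1)[OF id]
  let ?H = "{(n, a). a \<in> hpart R n \<and> a \<in> \<pp>}"
  have mult: "a \<otimes> s \<in> hpart R (m + n)" if "a \<in> hpart R n" "s \<in> hpart R m" for a s m n
    using mult_hpart[OF that] by (simp add: add.commute)
  have H: "hfam ?H"
    unfolding hfam_def
    using hpart_zero hpart_add mult_hpart mult additive_subgroup.zero_closed[OF sg] additive_subgroup.a_closed[OF sg]
      ideal.I_l_closed[OF id] ideal.I_r_closed[OF id] hpart_sub
    by auto
  have "\<pp> \<inter> homogeneous R \<subseteq> hspan ?H"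
  proof
    fix y assume "y \<in> \<pp> \<inter> homogeneous R"
    then obtain m where "y \<in> hpart R m" "y \<in> \<pp>" unfolding homogeneous_def by blast
    then show "y \<in> hspan ?H" using hspan_hpart[OF H] by simp
  qed
  then have "Idl (\<pp> \<inter> homogeneous R) \<subseteq> hspan ?H" by (rule genideal_minimal[OF hspan_ideal[OF H]])
  moreover have "x \<in> Idl (\<pp> \<inter> homogeneous R)" using x by (subst (asm) SpecD(2)[OF p])
  ultimately have "x \<in> hspan ?H" by (rule subsetD)
  then have "(n, component x n) \<in> ?H" by (rule hspan_component[OF H])
  then show ?thesis by simp
qed

text \<open>The noetherian property gives finitely many generators; they are replaced by their
  nonzero homogeneous components, which still lie in \<open>\<pp>\<close>.\<close>

lemma Spec_finite:
  assumes N: "noetherian_ring R" and p: "\<pp> \<in> Spec R"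
  obtains B where "finite B" "B \<subseteq> \<pp> \<inter> homogeneous R" "\<pp> = Idl B"
proof -
  note id = SpecD(1)[OF p]
  obtain A where A: "A \<subseteq> carrier R" "finite A" "\<pp> = Idl A" using noetherian_ring.finetely_gen[OF N id] by blast
  have Ap: "A \<subseteq> \<pp>" using genideal_self[OF A(1)] A(3) by blast
  let ?B = "\<Union>a\<in>A. component a ` {n. component a n \<noteq> \<zero>}"
  have fin: "finite ?B" using A component_finite by blast
  have B: "?B \<subseteq> \<pp> \<inter> homogeneous R"
  proof
    fix b assume "b \<in> ?B"
    then obtain a n where a: "a \<in> A" and b: "b = component a n" by blast
    have "b \<in> hpart R n" unfolding b by (rule component_hpart) (use A(1) a in blast)
    moreover have "b \<in> \<pp>" unfolding b by (rule Spec_component[OF p]) (use Ap a in blast)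
    ultimately show "b \<in> \<pp> \<inter> homogeneous R" unfolding homogeneous_def by blast
  qed
  then have BR: "?B \<subseteq> carrier R" using homogeneous_sub by blast
  note gid = ideal.axioms(1)[OF genideal_ideal[OF BR]]
  have "a \<in> Idl ?B" if a: "a \<in> A" for a
  proof (rule component_induct[of a "\<lambda>y. y \<in> Idl ?B"])
    show "a \<in> carrier R" using a A(1) by blast
    show z: "\<zero> \<in> Idl ?B" by (rule additive_subgroup.zero_closed[OF gid])
    show "component a n \<in> Idl ?B" for n
    proof (cases "component a n = \<zero>")
      case False
      then have "component a n \<in> ?B" using a by blast
      then show ?thesis using genideal_self[OF BR] by blast
    qed (use z in simp)
    show "y \<oplus> z \<in> Idl ?B" if "y \<in> Idl ?B" "z \<in> Idl ?B" for y z
      by (rule additive_subgroup.a_closed[OF gid that])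
  qed
  then have "A \<subseteq> Idl ?B" by (rule subsetI)
  then have "\<pp> \<subseteq> Idl ?B" unfolding A(3) by (rule genideal_minimal[OF genideal_ideal[OF BR]])
  moreover have "?B \<subseteq> \<pp>" by (rule subset_trans[OF B Int_lower1])
  then have "Idl ?B \<subseteq> \<pp>" by (rule genideal_minimal[OF id])
  ultimately show ?thesis by (intro that[OF fin B] subset_antisym)
qed

end

section \<open>Primes avoiding the powers of a homogeneous element\<close>

context graded_commutative_ring
begin

lemma hfam_swap:
  assumes H: "hfam H" and x: "x \<in> hpart R m" and y: "y \<in> hpart R n"
    and xy: "(k, x \<otimes> y) \<in> H"
  shows "(k, y \<otimes> x) \<in> H"
proof (cases "even (n * m)")
  case True
  then show ?thesis using graded_comm[OF y x] xy by simp
next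
  case False
  then show ?thesis using graded_comm[OF y x] hfam_neg[OF H xy] by simp
qed

text \<open>If \<open>H\<close> is maximal among the homogeneous ideals avoiding the powers of \<open>r\<close> and \<open>a b \<in> H\<close>, \<open>b \<notin> H\<close>,
  then \<open>(H : b)\<close> contains no power of \<open>r\<close>: from \<open>r\<^sup>k b \<in> H\<close> the ideal \<open>(H : r\<^sup>k)\<close> would be strictly
  larger than \<open>H\<close> and still avoid the powers of \<open>r\<close>. Hence \<open>a \<in> (H : b) = H\<close>.\<close>

lemma prime_avoiding_powers:
  assumes H: "hfam H" and r: "r \<in> hpart R d" and pow: "\<And>k. (int k * d, r [^] k) \<notin> H"
  obtains \<qq> where "\<qq> \<in> Spec R" "r \<notin> \<qq>" "\<And>n a. (n, a) \<in> H \<Longrightarrow> a \<in> \<qq>"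
proof -
  \<comment> \<open>Avoidance is tested on pairs: the power \<open>r [^] k\<close> is considered in
    its degree \<open>int k * d\<close>.\<close>
  let ?av = "\<lambda>M. \<forall>k. (int k * d, r [^] k) \<notin> M"
  let ?\<A> = "{M. hfam M \<and> H \<subseteq> M \<and> ?av M}"
  have "\<exists>M\<in>?\<A>. \<forall>N\<in>?\<A>. M \<subseteq> N \<longrightarrow> N = M"
  proof (rule subset_Zorn_nonempty)
    show "?\<A> \<noteq> {}" using H pow by blast
    fix \<C> assume ne: "\<C> \<noteq> {}" and ch: "subset.chain ?\<A> \<C>"
    have sub: "\<C> \<subseteq> ?\<A>" using ch by (simp add: subset_chain_def)
    have dir: "A \<subseteq> B \<or> B \<subseteq> A" if "A \<in> \<C>" "B \<in> \<C>" for A B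
      using ch that by (simp add: subset_chain_def)
    obtain M0 where M0: "M0 \<in> \<C>" using ne by blast
    have hM: "hfam M" if "M \<in> \<C>" for M using sub that by blast
    have "hfam (\<Union>\<C>)"
      unfolding hfam_def
    proof (intro conjI allI impI)
      show "a \<in> hpart R n" if "(n, a) \<in> \<Union>\<C>" for n a using that hfam_hpart[OF hM] by blast
      show "(n, \<zero>) \<in> \<Union>\<C>" for n using hfam_zero[OF hM[OF M0]] M0 by blast
      show "(n, a \<oplus> b) \<in> \<Union>\<C>" if a: "(n, a) \<in> \<Union>\<C>" and b: "(n, b) \<in> \<Union>\<C>" for n a b
      proof -
        obtain A B where A: "A \<in> \<C>" "(n, a) \<in> A" and B: "B \<in> \<C>" "(n, b) \<in> B" using a b by blast
        consider "A \<subseteq> B" | "B \<subseteq> A" using dir A(1) B(1) by blast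
        then show ?thesis using hfam_add[OF hM[OF A(1)]] hfam_add[OF hM[OF B(1)]] A B by cases blast+
      qed
      show "(m + n, s \<otimes> a) \<in> \<Union>\<C>" "(m + n, a \<otimes> s) \<in> \<Union>\<C>" if "s \<in> hpart R m" "(n, a) \<in> \<Union>\<C>" for m s n a
        using that hfam_mult[OF hM] by blast+
    qed
    moreover have "H \<subseteq> \<Union>\<C>" using sub M0 by blast
    moreover have "?av (\<Union>\<C>)" using sub by blast
    ultimately show "\<Union>\<C> \<in> ?\<A>" by blast
  qed
  then obtain M where hM: "hfam M" and HM: "H \<subseteq> M" and av: "?av M"
    and max: "\<And>N. hfam N \<Longrightarrow> M \<subseteq> N \<Longrightarrow> ?av N \<Longrightarrow> N = M"
    by (smt (verit, del_insts) mem_Collect_eq subset_trans)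
  define colon where "colon j b = {(n, x). x \<in> hpart R n \<and> (n + j, x \<otimes> b) \<in> M}" for j b
  have colon: "hfam (colon j b)" "M \<subseteq> colon j b" if b: "b \<in> hpart R j" for j b
  proof -
    note bR = hpart_sub[OF b]
    show "hfam (colon j b)"
      unfolding hfam_def
    proof (intro conjI allI impI)
      show "x \<in> hpart R n" if "(n, x) \<in> colon j b" for n x using that by (simp add: colon_def)
      show "(n, \<zero>) \<in> colon j b" for n using bR hpart_zero hfam_zero[OF hM] by (simp add: colon_def)
      show "(n, x \<oplus> y) \<in> colon j b" if "(n, x) \<in> colon j b" "(n, y) \<in> colon j b" for n x y
      proof -
        have x: "x \<in> hpart R n" "(n + j, x \<otimes> b) \<in> M" and y: "y \<in> hpart R n" "(n + j, y \<otimes> b) \<in> M"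
          using that by (simp_all add: colon_def)
        have "(x \<oplus> y) \<otimes> b = x \<otimes> b \<oplus> y \<otimes> b" using hpart_sub[OF x(1)] hpart_sub[OF y(1)] bR by (rule l_distr)
        then show ?thesis using hpart_add[OF x(1) y(1)] hfam_add[OF hM x(2) y(2)] by (simp add: colon_def)
      qed
      fix m s n x assume s: "s \<in> hpart R m" and "(n, x) \<in> colon j b"
      then have x: "x \<in> hpart R n" "(n + j, x \<otimes> b) \<in> M" by (simp_all add: colon_def)
      note R = hpart_sub[OF s] hpart_sub[OF x(1)] bR
      have "(m + (n + j), s \<otimes> (x \<otimes> b)) \<in> M" by (rule hfam_mult(1)[OF hM s x(2)])
      then show "(m + n, s \<otimes> x) \<in> colon j b" using mult_hpart[OF s x(1)] R by (simp add: colon_def m_assoc add.assoc)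
      have "(m + (n + j), x \<otimes> b \<otimes> s) \<in> M" by (rule hfam_mult(2)[OF hM s x(2)])
      then have "(m + (n + j), x \<otimes> (b \<otimes> s)) \<in> M" using R by (simp add: m_assoc)
      \<comment> \<open>A right factor \<open>s\<close> has to pass \<open>b\<close> before the
        colon condition applies; graded commutativity permits this up to a sign, under which
        membership is stable.\<close>
      moreover have "b \<otimes> s = s \<otimes> b \<or> b \<otimes> s = \<ominus> (s \<otimes> b)" using graded_comm[OF b s] by presburger
      ultimately have "(m + (n + j), x \<otimes> (s \<otimes> b)) \<in> M"
        using hfam_neg[OF hM, of "m + (n + j)" "x \<otimes> (b \<otimes> s)"] R by (auto simp: r_minus)
      then show "(m + n, x \<otimes> s) \<in> colon j b"
        using mult_hpart[OF x(1) s] R by (simp add: colon_def m_assoc add.assoc add.commute add.left_commute)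
    qed
    show "M \<subseteq> colon j b"
    proof
      fix z assume z: "z \<in> M"
      obtain n x where nx: "z = (n, x)" by (cases z)
      show "z \<in> colon j b"
        using hfam_hpart[OF hM, of n x] hfam_mult(2)[OF hM b, of n x] z unfolding nx colon_def
        by (simp add: add.commute[of n j])
    qed
  qed
  have rR: "r [^] k \<in> hpart R (int k * d)" for k by (rule hpart_pow[OF r])
  have prime: "(m, a) \<in> M \<or> (j, b) \<in> M"
    if a: "a \<in> hpart R m" and b: "b \<in> hpart R j" and ab: "(m + j, a \<otimes> b) \<in> M" for a b m j
  proof (cases "?av (colon j b)")
    case True
    then have "colon j b = M" using max colon[OF b] by blast
    moreover have "(m, a) \<in> colon j b" using a ab by (simp add: colon_def)
    ultimately show ?thesis by blast
  next
    case False
    then obtain k where k: "(int k * d + j, r [^] k \<otimes> b) \<in> M" by (auto simp: colon_def)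
    then have "(j + int k * d, b \<otimes> r [^] k) \<in> M" using hfam_swap[OF hM rR b k] by (simp add: add.commute)
    then have bc: "(j, b) \<in> colon (int k * d) (r [^] k)" using b by (simp add: colon_def)
    have "?av (colon (int k * d) (r [^] k))"
    proof (intro allI notI)
      fix l assume "(int l * d, r [^] l) \<in> colon (int k * d) (r [^] k)"
      then have "(int l * d + int k * d, r [^] l \<otimes> r [^] k) \<in> M" by (simp add: colon_def)
      then have "(int (l + k) * d, r [^] (l + k)) \<in> M"
        using hpart_sub[OF r] by (simp add: nat_pow_mult algebra_simps)
      then show False using av by blast
    qed
    then have "colon (int k * d) (r [^] k) = M" using max colon[OF rR] by blast
    then show ?thesis using bc by blast
  qed
  have nR: "hspan M \<noteq> carrier R"
  proof
    assume "hspan M = carrier R"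
    then have "\<one> \<in> hspan M" by simp
    then have "(0, \<one>) \<in> M" using hspan_hpart[OF hM one_hpart] by blast
    then show False using av[rule_format, of 0] by simp
  qed
  have "hspan M \<in> Spec R"
    unfolding Spec_def
  proof (intro CollectI conjI ballI impI nR hspan_homogeneous[OF hM])
    fix a b assume "a \<in> homogeneous R" "b \<in> homogeneous R" and ab: "a \<otimes> b \<in> hspan M"
    then obtain m n where a: "a \<in> hpart R m" and b: "b \<in> hpart R n" unfolding homogeneous_def by blast
    have "(m + n, a \<otimes> b) \<in> M" using hspan_hpart[OF hM mult_hpart[OF a b]] ab by blast
    then show "a \<in> hspan M \<or> b \<in> hspan M" using prime[OF a b] hspan_hpart[OF hM a] hspan_hpart[OF hM b] by blast
  qed
  moreover have "r \<notin> hspan M"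
    using hspan_hpart[OF hM r] av[rule_format, of 1] hpart_sub[OF r] by simp
  moreover have "a \<in> hspan M" if "(n, a) \<in> H" for n a
    using hspan_hpart[OF hM hfam_hpart[OF hM]] HM that by blast
  ultimately show ?thesis by (rule that)
qed

end

section \<open>Torsion subcategories\<close>

locale noetherian_linear_cat = compactly_generated_cat \<kappa> T + linear_structure T R \<phi>
  for \<kappa> :: "'i rel" and T :: "('o, 'a, 'x) tricat_scheme" (structure)
    and R :: "('r, 'y) graded_ring_scheme" and \<phi> +
  assumes gcr: "graded_commutative_ring R" and noeth: "noetherian_ring R" and small: "|carrier R| <o \<kappa>"
begin

lemma int_small: "|UNIV :: int set| <o \<kappa>"
proof -
  have "|UNIV :: int set| \<le>o natLeq"
    using ordLeq_ordIso_trans[OF _ card_of_nat] card_of_ordLeqI[of to_nat "UNIV :: int set" "UNIV :: nat set"] by simp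
  then show ?thesis using \<kappa>_facts(2) by (rule ordLeq_ordLess_trans)
qed

text \<open>The larger of the two factors is infinite, since the integers are, and it absorbs the
  other one.\<close>

lemma degree_small: "|(UNIV :: int set) \<times> carrier R| <o \<kappa>"
proof -
  consider "|UNIV :: int set| \<le>o |carrier R|" | "|carrier R| \<le>o |UNIV :: int set|"
    using ordLeq_total[OF card_of_Well_order card_of_Well_order] by blast
  then show ?thesis
  proof cases
    case 1
    have "infinite (carrier R)" using card_of_ordLeq_infinite[OF 1] infinite_UNIV_int by blast
    then have "|(UNIV :: int set) \<times> carrier R| \<le>o |carrier R|"
      using card_of_Times_ordLeq_infinite_Field[of "|carrier R|" "UNIV :: int set" "carrier R"] 1 by simp
    then show ?thesis using small by (rule ordLeq_ordLess_trans)
  next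
    case 2
    have "|(UNIV :: int set) \<times> carrier R| \<le>o |UNIV :: int set|"
      using card_of_Times_ordLeq_infinite_Field[of "|UNIV :: int set|" "UNIV :: int set" "carrier R"] 2 infinite_UNIV_int by simp
    then show ?thesis using int_small by (rule ordLeq_ordLess_trans)
  qed
qed

text \<open>Scalars are pairs of degree and element, since \<open>\<phi>\<close> takes the degree as
  an argument and zero is homogeneous in every degree.\<close>

definition mult_set where
  "mult_set S \<longleftrightarrow> (\<forall>n s. (n, s) \<in> S \<longrightarrow> s \<in> hpart R n) \<and> S \<noteq> {} \<and>
     (\<forall>m s n t. (m, s) \<in> S \<longrightarrow> (n, t) \<in> S \<longrightarrow> (m + n, s \<otimes>\<^bsub>R\<^esub> t) \<in> S)"

definition tors_at where
  "tors_at S = {X \<in> obj T. \<forall>C\<in>shifts. \<forall>f\<in>Mor T C X. \<exists>n s. (n, s) \<in> S \<and> \<phi> n s X \<cdot> f = azero T C (\<Sigma>o n X)}"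

text \<open>The images of the scalars in the graded center form a central family, small because
  there are fewer than \<open>\<kappa>\<close> pairs of a degree and a ring element.\<close>

lemma smashing_tors_at:
  assumes S: "mult_set S" shows "smashing (tors_at S)"
proof -
  have SR: "s \<in> hpart R n" if "(n, s) \<in> S" for n s using S that unfolding mult_set_def by blast
  have Smult: "(m + n, s \<otimes>\<^bsub>R\<^esub> t) \<in> S" if "(m, s) \<in> S" "(n, t) \<in> S" for m s n t using S that unfolding mult_set_def by blast
  let ?\<Theta> = "(\<lambda>(n, s). (n, \<phi> n s)) ` S"
  have \<Theta>: "(n, \<theta>) \<in> ?\<Theta> \<longleftrightarrow> (\<exists>s. (n, s) \<in> S \<and> \<theta> = \<phi> n s)" for n \<theta> by auto
  interpret central_family \<kappa> T shifts ?\<Theta>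
  proof unfold_locales
    show "\<theta> \<in> center T n" if "(n, \<theta>) \<in> ?\<Theta>" for n \<theta> using that phi_center[OF SR] unfolding \<Theta> by blast
    show "?\<Theta> \<noteq> {}" using S unfolding mult_set_def by blast
    show "\<exists>\<zeta>. (m + n, \<zeta>) \<in> ?\<Theta> \<and> (\<forall>X\<in>obj T. \<zeta> X = \<Sigma>a n (\<theta> X) \<cdot> \<eta> X)" if "(m, \<theta>) \<in> ?\<Theta>" "(n, \<eta>) \<in> ?\<Theta>" for m \<theta> n \<eta>
    proof -
      obtain s t where s: "(m, s) \<in> S" "\<theta> = \<phi> m s" and t: "(n, t) \<in> S" "\<eta> = \<phi> n t" using \<open>(m, \<theta>) \<in> ?\<Theta>\<close> \<open>(n, \<eta>) \<in> ?\<Theta>\<close> unfolding \<Theta> by blast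
      have "\<forall>X\<in>obj T. \<phi> (m + n) (s \<otimes>\<^bsub>R\<^esub> t) X = \<Sigma>a n (\<theta> X) \<cdot> \<eta> X"
        unfolding s(2) t(2) using phi_mult[OF SR[OF s(1)] SR[OF t(1)]] by blast
      then show ?thesis using Smult[OF s(1) t(1)] unfolding \<Theta> by blast
    qed
    have "S \<subseteq> UNIV \<times> carrier R" using hpart_sub[OF SR] by auto
    then have "|S| \<le>o |(UNIV :: int set) \<times> carrier R|" by (rule card_of_mono1)
    then have "|?\<Theta>| \<le>o |(UNIV :: int set) \<times> carrier R|" by (rule ordLeq_transitive[OF card_of_image])
    then show "|?\<Theta>| <o \<kappa>" using degree_small by (rule ordLeq_ordLess_trans)
  qed
  have "killed X f \<longleftrightarrow> (\<exists>n s. (n, s) \<in> S \<and> \<phi> n s X \<cdot> f = azero T C (\<Sigma>o n X))" if "f \<in> Mor T C X" for C X f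
    using that unfolding killed_def \<Theta> by auto
  then have "tors = tors_at S" unfolding tors_def tors_at_def by (simp del: Mor_def cong: ball_cong)
  then show ?thesis using smashing_tors by simp
qed

lemma phi_simps:
  assumes "s \<in> hpart R n" "X \<in> obj T"
  shows "\<phi> n s X \<in> arr T" "src T (\<phi> n s X) = X" "tgt T (\<phi> n s X) = \<Sigma>o n X"
  using center_simps[OF phi_center[OF assms(1)] assms(2)] .

lemma phi_zero: assumes X: "X \<in> obj T" shows "\<phi> n \<zero>\<^bsub>R\<^esub> X = azero T X (\<Sigma>o n X)"
proof (rule aadd_self_zeroD)
  show "\<phi> n \<zero>\<^bsub>R\<^esub> X \<boxplus> \<phi> n \<zero>\<^bsub>R\<^esub> X = \<phi> n \<zero>\<^bsub>R\<^esub> X" using phi_add[OF hpart_zero hpart_zero X, of n] by simp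
qed (use phi_simps[OF hpart_zero X] in simp)

lemma tors_at_mono: "S \<subseteq> S' \<Longrightarrow> tors_at S \<subseteq> tors_at S'"
  unfolding tors_at_def by blast

lemma tors_at_obj: "X \<in> tors_at S \<Longrightarrow> X \<in> obj T"
  unfolding tors_at_def by blast

section \<open>Torsion at primes and at powers of one element\<close>

definition outside where
  "outside \<pp> = {(n, s). s \<in> hpart R n \<and> s \<notin> \<pp>}"

definition powers where
  "powers d r = {(int k * d, r [^]\<^bsub>R\<^esub> k) | k. True}"

lemma mult_outside: assumes p: "\<pp> \<in> Spec R" shows "mult_set (outside \<pp>)"
  unfolding mult_set_def outside_def
proof (intro conjI allI impI)
  have "(0, \<one>\<^bsub>R\<^esub>) \<in> {(n, s). s \<in> hpart R n \<and> s \<notin> \<pp>}" using SpecD(3)[OF p] one_hpart by simp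
  then show "{(n, s). s \<in> hpart R n \<and> s \<notin> \<pp>} \<noteq> {}" by blast
  show "(m + n, s \<otimes>\<^bsub>R\<^esub> t) \<in> {(n, s). s \<in> hpart R n \<and> s \<notin> \<pp>}"
    if "(m, s) \<in> {(n, s). s \<in> hpart R n \<and> s \<notin> \<pp>}" "(n, t) \<in> {(n, s). s \<in> hpart R n \<and> s \<notin> \<pp>}" for m s n t
    using that SpecD(4)[OF p, of s m t n] mult_hpart[of s m t n] by auto
qed auto

lemma mult_powers: assumes r: "r \<in> hpart R d" shows "mult_set (powers d r)"
  unfolding mult_set_def powers_def
proof (intro conjI allI impI)
  show "s \<in> hpart R n" if "(n, s) \<in> {(int k * d, r [^]\<^bsub>R\<^esub> k) | k. True}" for n s
    using that hpart_pow[OF r] by auto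
  fix m s n t
  assume "(m, s) \<in> {(int k * d, r [^]\<^bsub>R\<^esub> k) | k. True}" "(n, t) \<in> {(int k * d, r [^]\<^bsub>R\<^esub> k) | k. True}"
  then obtain k l where k: "m = int k * d" "s = r [^]\<^bsub>R\<^esub> k" and l: "n = int l * d" "t = r [^]\<^bsub>R\<^esub> l" by auto
  have "(m + n, s \<otimes>\<^bsub>R\<^esub> t) = (int (k + l) * d, r [^]\<^bsub>R\<^esub> (k + l))"
    unfolding k l using hpart_sub[OF r] by (simp add: nat_pow_mult algebra_simps)
  then show "(m + n, s \<otimes>\<^bsub>R\<^esub> t) \<in> {(int k * d, r [^]\<^bsub>R\<^esub> k) | k. True}" by blast
qed blast

text \<open>If the localization vanishes, comparing the fractions of \<open>f\<close> and of zero
  with denominator one gives a scalar outside \<open>\<pp>\<close> killing \<open>f\<close>.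
  Conversely, killed numerators identify any two fractions once their denominators are expanded to a
  common one.\<close>

lemma localization_is_zero_iff:
  assumes p: "\<pp> \<in> Spec R" and C: "C \<in> obj T" and X: "X \<in> obj T"
  shows "localization_is_zero R (graded_hom T \<phi> C X) \<pp> \<longleftrightarrow>
    (\<forall>d. \<forall>f\<in>Mor T C (\<Sigma>o d X). \<exists>n s. (n, s) \<in> outside \<pp> \<and> \<Sigma>a d (\<phi> n s X) \<cdot> f = azero T C (\<Sigma>o (d + n) X))"
    (is "?L \<longleftrightarrow> ?R")
proof -
  let ?M = "graded_hom T \<phi> C X"
  have gp: "carrier (gpart ?M i) = Mor T C (\<Sigma>o i X)" "\<one>\<^bsub>gpart ?M i\<^esub> = azero T C (\<Sigma>o i X)" for i
    by (simp_all add: graded_hom_def)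
  have gs: "gsmult ?M n s i f = \<Sigma>a i (\<phi> n s X) \<cdot> f" for n s i f by (simp add: graded_hom_def)
  note R1 = hpart_sub[OF one_hpart] and p1 = SpecD(3)[OF p]
  have base: "(0, \<one>\<^bsub>R\<^esub>, f) \<in> fractions R ?M \<pp> d" if "f \<in> Mor T C (\<Sigma>o d X)" for d f
    unfolding fractions_def using that one_hpart p1 gp by simp
  have zM: "azero T C (\<Sigma>o d X) \<in> Mor T C (\<Sigma>o d X)" for d using C X by simp
  show ?thesis
  proof
    assume L: ?L
    show ?R
    proof (intro allI ballI)
      fix d f assume f: "f \<in> Mor T C (\<Sigma>o d X)"
      let ?rel = "fraction_rel R ?M \<pp> d"
      have "?rel `` {(0, \<one>\<^bsub>R\<^esub>, f)} \<in> localization R ?M \<pp> d"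
        unfolding localization_def by (rule quotientI[OF base[OF f]])
      moreover have "localization R ?M \<pp> d = {?rel `` {(0, \<one>\<^bsub>R\<^esub>, azero T C (\<Sigma>o d X))}}"
        using L unfolding localization_is_zero_def gp(2) by blast
      ultimately have eq: "?rel `` {(0, \<one>\<^bsub>R\<^esub>, f)} = ?rel `` {(0, \<one>\<^bsub>R\<^esub>, azero T C (\<Sigma>o d X))}" by simp
      \<comment> \<open>Reflexivity at \<open>f\<close> places the fraction in its own class;
        equality of the two classes then yields a relation between \<open>f\<close> and
        zero.\<close>
      have "((0, \<one>\<^bsub>R\<^esub>, f), (0, \<one>\<^bsub>R\<^esub>, f)) \<in> ?rel"
        unfolding fraction_rel_def mem_Collect_eq prod.case
        using base[OF f] one_hpart p1 R1 by (intro conjI exI[of _ 0] exI[of _ "\<one>\<^bsub>R\<^esub>"]) simp_all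
      then have "(0, \<one>\<^bsub>R\<^esub>, f) \<in> ?rel `` {(0, \<one>\<^bsub>R\<^esub>, f)}" by simp
      then have "((0, \<one>\<^bsub>R\<^esub>, azero T C (\<Sigma>o d X)), (0, \<one>\<^bsub>R\<^esub>, f)) \<in> ?rel" unfolding eq by simp
      then obtain k k' a a' where a: "a \<in> hpart R k" "a' \<in> hpart R k'" "k + 0 = k' + 0"
          "a \<otimes>\<^bsub>R\<^esub> \<one>\<^bsub>R\<^esub> = a' \<otimes>\<^bsub>R\<^esub> \<one>\<^bsub>R\<^esub>" "a \<otimes>\<^bsub>R\<^esub> \<one>\<^bsub>R\<^esub> \<notin> \<pp>"
          "\<Sigma>a (d + 0) (\<phi> k a X) \<cdot> azero T C (\<Sigma>o d X) = \<Sigma>a (d + 0) (\<phi> k' a' X) \<cdot> f"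
        unfolding fraction_rel_def gs by auto
      have kk: "k' = k" and aa: "a' = a" using a(1-4) hpart_sub by simp_all
      have "\<Sigma>a d (\<phi> k a X) \<cdot> azero T C (\<Sigma>o d X) = azero T C (\<Sigma>o (d + k) X)"
        using phi_simps[OF a(1) X] C X by simp
      then have "\<Sigma>a d (\<phi> k a X) \<cdot> f = azero T C (\<Sigma>o (d + k) X)" using a(6) kk aa by simp
      moreover have "(k, a) \<in> outside \<pp>" using a(1,5) hpart_sub[OF a(1)] by (simp add: outside_def)
      ultimately show "\<exists>n s. (n, s) \<in> outside \<pp> \<and> \<Sigma>a d (\<phi> n s X) \<cdot> f = azero T C (\<Sigma>o (d + n) X)" by blast
    qed
  next
    assume RR: ?R
    have rel: "(x, y) \<in> fraction_rel R ?M \<pp> d" if x: "x \<in> fractions R ?M \<pp> d" and y: "y \<in> fractions R ?M \<pp> d" for x y d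
    proof -
      obtain n s m where xe: "x = (n, s, m)" by (cases x)
      obtain n' s' m' where ye: "y = (n', s', m')" by (cases y)
      have s: "s \<in> hpart R n" "s \<notin> \<pp>" "m \<in> Mor T C (\<Sigma>o (d + n) X)"
        using x unfolding xe fractions_def gp(1) by blast+
      have s': "s' \<in> hpart R n'" "s' \<notin> \<pp>" "m' \<in> Mor T C (\<Sigma>o (d + n') X)"
        using y unfolding ye fractions_def gp(1) by blast+
      obtain j t where t: "(j, t) \<in> outside \<pp>" "\<Sigma>a (d + n) (\<phi> j t X) \<cdot> m = azero T C (\<Sigma>o (d + n + j) X)"
        using RR s(3) by blast
      obtain j' t' where t': "(j', t') \<in> outside \<pp>" "\<Sigma>a (d + n') (\<phi> j' t' X) \<cdot> m' = azero T C (\<Sigma>o (d + n' + j') X)"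
        using RR s'(3) by blast
      have tR: "t \<in> hpart R j" "t \<notin> \<pp>" "t' \<in> hpart R j'" "t' \<notin> \<pp>" using t(1) t'(1) by (simp_all add: outside_def)
      note c = hpart_sub[OF s(1)] hpart_sub[OF s'(1)] hpart_sub[OF tR(1)] hpart_sub[OF tR(3)]
      have kill: "\<Sigma>a i (\<phi> (l + j) (u \<otimes>\<^bsub>R\<^esub> t) X) \<cdot> m = azero T C (\<Sigma>o (i + (l + j)) X)"
        if u: "u \<in> hpart R l" and t: "t \<in> hpart R j" and m: "m \<in> Mor T C (\<Sigma>o i X)"
          and z: "\<Sigma>a i (\<phi> j t X) \<cdot> m = azero T C (\<Sigma>o (i + j) X)" for i l j u t m
      proof -
        note su = phi_simps[OF u X] and st = phi_simps[OF t X]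
        have "\<Sigma>a i (\<phi> (l + j) (u \<otimes>\<^bsub>R\<^esub> t) X) \<cdot> m = \<Sigma>a (i + j) (\<phi> l u X) \<cdot> (\<Sigma>a i (\<phi> j t X) \<cdot> m)"
          unfolding phi_mult[OF u t X] using su st m X by (simp add: add.commute)
        also have "\<dots> = azero T C (\<Sigma>o (i + (l + j)) X)"
          unfolding z using su C X by (simp add: add.assoc add.commute add.left_commute)
        finally show ?thesis .
      qed
      have w: "t' \<otimes>\<^bsub>R\<^esub> s' \<in> hpart R (j' + n')" "t' \<otimes>\<^bsub>R\<^esub> s' \<notin> \<pp>" "t \<otimes>\<^bsub>R\<^esub> s \<in> hpart R (j + n)" "t \<otimes>\<^bsub>R\<^esub> s \<notin> \<pp>"
        using mult_hpart tR s s' SpecD(4)[OF p tR(1) s(1)] SpecD(4)[OF p tR(3) s'(1)] by blast+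
      let ?w = "t' \<otimes>\<^bsub>R\<^esub> s'" and ?v = "t \<otimes>\<^bsub>R\<^esub> s"
      have nz: "?w \<otimes>\<^bsub>R\<^esub> ?v \<notin> \<pp>" using SpecD(4)[OF p w(1) w(3)] w by blast
      \<comment> \<open>The Koszul sign of exchanging \<open>?w\<close> and \<open>?v\<close>, as a
        scalar of degree zero.\<close>
      define \<epsilon> where "\<epsilon> = (if even ((j' + n') * (j + n)) then \<one>\<^bsub>R\<^esub> else \<ominus>\<^bsub>R\<^esub> \<one>\<^bsub>R\<^esub>)"
      have \<epsilon>: "\<epsilon> \<in> hpart R 0" unfolding \<epsilon>_def using one_hpart hpart_neg by simp
      have wc: "?w \<in> carrier R" "?v \<in> carrier R" using w hpart_sub by blast+
      have comm: "?w \<otimes>\<^bsub>R\<^esub> ?v = \<epsilon> \<otimes>\<^bsub>R\<^esub> (?v \<otimes>\<^bsub>R\<^esub> ?w)"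
        using graded_commutative_ring.graded_comm[OF gcr w(1) w(3)] wc unfolding \<epsilon>_def by (simp add: l_minus)
      \<comment> \<open>The multipliers contain \<open>t\<close> and \<open>t'\<close>, so they kill
        the numerators \<open>m\<close> and \<open>m'\<close>, and both expand the denominators to
        \<open>?w \<otimes> ?v\<close>, which is outside \<open>\<pp>\<close> by primality.\<close>
      let ?a = "?w \<otimes>\<^bsub>R\<^esub> t" and ?a' = "\<epsilon> \<otimes>\<^bsub>R\<^esub> ?v \<otimes>\<^bsub>R\<^esub> t'"
      have \<epsilon>v: "\<epsilon> \<otimes>\<^bsub>R\<^esub> ?v \<in> hpart R (j + n)" using mult_hpart[OF \<epsilon> w(3)] by simp
      have a: "?a \<in> hpart R (j' + n' + j)" "?a' \<in> hpart R (j + n + j')"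
        using mult_hpart[OF w(1) tR(1)] mult_hpart[OF \<epsilon>v tR(3)] by simp_all
      have as: "?a \<otimes>\<^bsub>R\<^esub> s = ?w \<otimes>\<^bsub>R\<^esub> ?v" using c wc by (simp add: m_assoc)
      have as': "?a' \<otimes>\<^bsub>R\<^esub> s' = ?w \<otimes>\<^bsub>R\<^esub> ?v"
        unfolding comm using c wc hpart_sub[OF \<epsilon>] by (simp add: m_assoc)
      have z: "\<Sigma>a (d + n) (\<phi> (j' + n' + j) ?a X) \<cdot> m = azero T C (\<Sigma>o (d + n + (j' + n' + j)) X)"
        by (rule kill[OF w(1) tR(1) s(3) t(2)])
      have z': "\<Sigma>a (d + n') (\<phi> (j + n + j') ?a' X) \<cdot> m' = azero T C (\<Sigma>o (d + n' + (j + n + j')) X)"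
        by (rule kill[OF \<epsilon>v tR(3) s'(3) t'(2)])
      have deg: "d + n + (j' + n' + j) = d + n' + (j + n + j')" "j' + n' + j + n = j + n + j' + n'" by simp_all
      show ?thesis
        unfolding fraction_rel_def xe ye mem_Collect_eq prod.case gs
        using x y a as as' nz z z' deg unfolding xe ye
        by (intro conjI exI[of _ "j' + n' + j"] exI[of _ "j + n + j'"] exI[of _ ?a] exI[of _ ?a']) simp_all
    qed
    show ?L
      unfolding localization_is_zero_def gp(2)
    proof
      fix d
      let ?F = "fractions R ?M \<pp> d" and ?rel = "fraction_rel R ?M \<pp> d"
      have "?rel \<subseteq> ?F \<times> ?F" unfolding fraction_rel_def by auto
      then have im: "?rel `` {x} = ?F" if "x \<in> ?F" for x using rel[OF that] by blast
      have z: "(0, \<one>\<^bsub>R\<^esub>, azero T C (\<Sigma>o d X)) \<in> ?F" by (rule base[OF zM])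
      have "localization R ?M \<pp> d = {?F}" unfolding localization_def quotient_def using im z by auto
      then show "localization R ?M \<pp> d = {?rel `` {(0, \<one>\<^bsub>R\<^esub>, azero T C (\<Sigma>o d X))}}" using im[OF z] by simp
    qed
  qed
qed

text \<open>Suspension translates degree \<open>d\<close> maps from a compact object into degree
  zero maps from one of its shifts, which is how the graded condition and the condition on
  \<open>shifts\<close> agree.\<close>

lemma tors_at_outside_iff:
  assumes p: "\<pp> \<in> Spec R" and X: "X \<in> obj T"
  shows "X \<in> tors_at (outside \<pp>) \<longleftrightarrow> (\<forall>C. compact_obj \<kappa> T C \<longrightarrow> localization_is_zero R (graded_hom T \<phi> C X) \<pp>)"
proof
  assume A: "X \<in> tors_at (outside \<pp>)"
  show "\<forall>C. compact_obj \<kappa> T C \<longrightarrow> localization_is_zero R (graded_hom T \<phi> C X) \<pp>"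
  proof (intro allI impI)
    fix C assume C: "compact_obj \<kappa> T C"
    then have Co: "C \<in> obj T" by (simp add: compact_obj_def)
    show "localization_is_zero R (graded_hom T \<phi> C X) \<pp>"
      unfolding localization_is_zero_iff[OF p Co X]
    proof (intro allI ballI)
      fix d f assume f: "f \<in> Mor T C (\<Sigma>o d X)"
      obtain v where v: "v \<in> Mor T (\<Sigma>o (- d) C) X" "\<Sigma>a d v = f" using Mor_pow_lift[OF f X] .
      have "\<Sigma>o (- d) C \<in> shifts" unfolding shifts_def using C by blast
      then obtain n s where s: "(n, s) \<in> outside \<pp>" "\<phi> n s X \<cdot> v = azero T (\<Sigma>o (- d) C) (\<Sigma>o n X)"
        using A v(1) unfolding tors_at_def by blast
      have sR: "s \<in> hpart R n" using s(1) by (simp add: outside_def)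
      have "\<Sigma>a d (\<phi> n s X) \<cdot> f = \<Sigma>a d (\<phi> n s X \<cdot> v)"
        unfolding v(2)[symmetric] by (rule arr_pow_cmp[symmetric]) (use v(1) phi_simps[OF sR X] in simp_all)
      then have "\<Sigma>a d (\<phi> n s X) \<cdot> f = azero T C (\<Sigma>o (d + n) X)" unfolding s(2) using Co X by simp
      then show "\<exists>n s. (n, s) \<in> outside \<pp> \<and> \<Sigma>a d (\<phi> n s X) \<cdot> f = azero T C (\<Sigma>o (d + n) X)" using s(1) by blast
    qed
  qed
next
  assume A: "\<forall>C. compact_obj \<kappa> T C \<longrightarrow> localization_is_zero R (graded_hom T \<phi> C X) \<pp>"
  show "X \<in> tors_at (outside \<pp>)"
    unfolding tors_at_def
  proof (intro CollectI conjI ballI X)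
    fix C f assume "C \<in> shifts" and f: "f \<in> Mor T C X"
    then obtain m D where D: "C = \<Sigma>o m D" "compact_obj \<kappa> T D" unfolding shifts_def by blast
    then have Do: "D \<in> obj T" by (simp add: compact_obj_def)
    have g: "\<Sigma>a (- m) f \<in> Mor T D (\<Sigma>o (- m) X)" using f D(1) Do by simp
    obtain n s where s: "(n, s) \<in> outside \<pp>" "\<Sigma>a (- m) (\<phi> n s X) \<cdot> \<Sigma>a (- m) f = azero T D (\<Sigma>o (- m + n) X)"
      using A D(2) g localization_is_zero_iff[OF p Do X] by blast
    have sR: "s \<in> hpart R n" using s(1) by (simp add: outside_def)
    have fs: "\<phi> n s X \<cdot> f \<in> Mor T C (\<Sigma>o n X)" using f phi_simps[OF sR X] by simp
    have "\<Sigma>a (- m) (\<phi> n s X \<cdot> f) = \<Sigma>a (- m) (\<phi> n s X) \<cdot> \<Sigma>a (- m) f"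
      by (rule arr_pow_cmp) (use f phi_simps[OF sR X] in simp_all)
    then have "\<Sigma>a (- m) (\<phi> n s X \<cdot> f) = azero T (\<Sigma>o (- m) C) (\<Sigma>o (- m) (\<Sigma>o n X))"
      unfolding s(2) using D(1) Do X by simp
    then have "\<phi> n s X \<cdot> f = azero T C (\<Sigma>o n X)" using arr_pow_eq_zero_iff[OF fs] by blast
    then show "\<exists>n s. (n, s) \<in> outside \<pp> \<and> \<phi> n s X \<cdot> f = azero T C (\<Sigma>o n X)" using s(1) by blast
  qed
qed

abbreviation torsion where "torsion \<equiv> torsion_subcat \<kappa> T R \<phi>"

lemma torsion_iff: "X \<in> torsion W \<longleftrightarrow> X \<in> obj T \<and> (\<forall>\<pp>\<in>Spec R - W. X \<in> tors_at (outside \<pp>))"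
proof -
  have "(\<forall>C. compact_obj \<kappa> T C \<longrightarrow> (\<forall>\<pp>\<in>Spec R - W. localization_is_zero R (graded_hom T \<phi> C X) \<pp>)) \<longleftrightarrow>
      (\<forall>\<pp>\<in>Spec R - W. X \<in> tors_at (outside \<pp>))" if "X \<in> obj T"
    using tors_at_outside_iff[OF _ that] by (metis DiffD1)
  then show ?thesis unfolding torsion_subcat_def by blast
qed

text \<open>The primes not in \<open>\<Z>(\<pp>)\<close> are those contained in
  \<open>\<pp>\<close>. A smaller prime has a larger complement, so the condition at
  \<open>\<pp>\<close> implies all others.\<close>

lemma torsion_Z:
  assumes p: "\<pp> \<in> Spec R" shows "torsion (Z_set R \<pp>) = tors_at (outside \<pp>)"
proof
  show "torsion (Z_set R \<pp>) \<subseteq> tors_at (outside \<pp>)"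
    using p torsion_iff[of _ "Z_set R \<pp>"] by (auto simp: Z_set_def)
  have "X \<in> tors_at (outside \<qq>)" if "X \<in> tors_at (outside \<pp>)" "\<qq> \<subseteq> \<pp>" for X \<qq>
    using tors_at_mono[of "outside \<pp>" "outside \<qq>"] that unfolding outside_def by blast
  then show "tors_at (outside \<pp>) \<subseteq> torsion (Z_set R \<pp>)"
    using torsion_iff[of _ "Z_set R \<pp>"] tors_at_obj by (auto simp: Z_set_def)
qed

lemma smashing_Z: "\<pp> \<in> Spec R \<Longrightarrow> smashing (torsion (Z_set R \<pp>))"
  using torsion_Z smashing_tors_at[OF mult_outside] by simp

lemma power_not_in_Spec:
  assumes q: "\<qq> \<in> Spec R" and r: "r \<in> hpart R d" "r \<notin> \<qq>" shows "r [^]\<^bsub>R\<^esub> (k :: nat) \<notin> \<qq>"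
proof (induction k)
  case (Suc k)
  then show ?case using SpecD(4)[OF q hpart_pow[OF r(1), of k] r(1)] r(2) by auto
qed (use SpecD(3)[OF q] in simp)

text \<open>The annihilator of \<open>f : C -> X\<close> is a homogeneous ideal. If it avoided all
  powers of \<open>r\<close>, some prime \<open>\<qq>\<close> would contain it without
  \<open>r\<close>, hence not contain \<open>\<pp>\<close>; torsion at \<open>\<qq>\<close> then
  annihilates \<open>f\<close> by a scalar outside \<open>\<qq>\<close>, a contradiction.\<close>

lemma torsion_V_powers:
  assumes p: "\<pp> \<in> Spec R" and X: "X \<in> torsion (V_closed R \<pp>)" and r: "r \<in> hpart R d" "r \<in> \<pp>"
  shows "X \<in> tors_at (powers d r)"
proof (rule ccontr)
  have Xo: "X \<in> obj T" using X torsion_iff by blast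
  assume "X \<notin> tors_at (powers d r)"
  then obtain C f where C: "C \<in> shifts" and f: "f \<in> Mor T C X"
    and nk: "\<And>n s. (n, s) \<in> powers d r \<Longrightarrow> \<phi> n s X \<cdot> f \<noteq> azero T C (\<Sigma>o n X)"
    using Xo unfolding tors_at_def by blast
  note Co = K_obj[OF C]
  let ?H = "{(n, a). a \<in> hpart R n \<and> \<phi> n a X \<cdot> f = azero T C (\<Sigma>o n X)}"
  have H: "hfam ?H"
    unfolding hfam_def
  proof (intro conjI allI impI)
    show "a \<in> hpart R n" if "(n, a) \<in> ?H" for n a using that by simp
    show "(n, \<zero>\<^bsub>R\<^esub>) \<in> ?H" for n using hpart_zero phi_zero[OF Xo] f Xo by simp
    show "(n, a \<oplus>\<^bsub>R\<^esub> b) \<in> ?H" if "(n, a) \<in> ?H" "(n, b) \<in> ?H" for n a b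
    proof -
      have a: "a \<in> hpart R n" "\<phi> n a X \<cdot> f = azero T C (\<Sigma>o n X)" and b: "b \<in> hpart R n" "\<phi> n b X \<cdot> f = azero T C (\<Sigma>o n X)"
        using that by simp_all
      have "\<phi> n (a \<oplus>\<^bsub>R\<^esub> b) X \<cdot> f = \<phi> n a X \<cdot> f \<boxplus> \<phi> n b X \<cdot> f"
        unfolding phi_add[OF a(1) b(1) Xo] using phi_simps[OF a(1) Xo] phi_simps[OF b(1) Xo] f by simp
      then show ?thesis using a b hpart_add Co Xo by simp
    qed
    fix m s n a assume s: "s \<in> hpart R m" and "(n, a) \<in> ?H"
    then have a: "a \<in> hpart R n" "\<phi> n a X \<cdot> f = azero T C (\<Sigma>o n X)" by simp_all
    note ps = phi_simps[OF s Xo] and pa = phi_simps[OF a(1) Xo] and ps' = phi_simps[OF s obj_pow_obj[OF Xo, of n]]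
    have "\<phi> (m + n) (s \<otimes>\<^bsub>R\<^esub> a) X \<cdot> f = \<Sigma>a n (\<phi> m s X) \<cdot> (\<phi> n a X \<cdot> f)"
      unfolding phi_mult[OF s a(1) Xo] using ps pa f Xo by (simp add: add.commute)
    then have "\<phi> (m + n) (s \<otimes>\<^bsub>R\<^esub> a) X \<cdot> f = azero T C (\<Sigma>o (m + n) X)" unfolding a(2) using ps Co Xo by (simp add: add.commute)
    then show "(m + n, s \<otimes>\<^bsub>R\<^esub> a) \<in> ?H" using mult_hpart[OF s a(1)] by simp
    have "\<phi> (n + m) (a \<otimes>\<^bsub>R\<^esub> s) X \<cdot> f = \<phi> m s (\<Sigma>o n X) \<cdot> \<phi> n a X \<cdot> f"
      unfolding phi_mult[OF a(1) s Xo] center_nat[OF phi_center[OF s] center_Mor[OF phi_center[OF a(1)] Xo]] ..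
    also have "\<dots> = \<phi> m s (\<Sigma>o n X) \<cdot> (\<phi> n a X \<cdot> f)" using ps' pa f by simp
    finally have "\<phi> (m + n) (a \<otimes>\<^bsub>R\<^esub> s) X \<cdot> f = azero T C (\<Sigma>o (m + n) X)" unfolding a(2) using ps' Co Xo by (simp add: add.commute)
    then show "(m + n, a \<otimes>\<^bsub>R\<^esub> s) \<in> ?H" using mult_hpart[OF a(1) s] by (simp add: add.commute)
  qed
  have pow: "(int k * d, r [^]\<^bsub>R\<^esub> k) \<notin> ?H" for k using nk[of "int k * d" "r [^]\<^bsub>R\<^esub> k"] unfolding powers_def by blast
  obtain \<qq> where q: "\<qq> \<in> Spec R" "r \<notin> \<qq>" "\<And>n a. (n, a) \<in> ?H \<Longrightarrow> a \<in> \<qq>"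
    using graded_commutative_ring.prime_avoiding_powers[OF gcr H r(1) pow] by blast
  have "\<qq> \<notin> V_closed R \<pp>" using q(2) r(2) by (auto simp: V_closed_def)
  then have "X \<in> tors_at (outside \<qq>)" using X q(1) unfolding torsion_iff by blast
  then obtain n s where s: "(n, s) \<in> outside \<qq>" "\<phi> n s X \<cdot> f = azero T C (\<Sigma>o n X)" using C f unfolding tors_at_def by blast
  then have "(n, s) \<in> ?H" by (simp add: outside_def)
  then have "s \<in> \<qq>" by (rule q(3))
  then show False using s(1) by (simp add: outside_def)
qed

text \<open>The system consisting of zero alone makes every object torsion. This is the empty case
  of the finite intersections below.\<close>

lemma smashing_obj: "smashing (obj T)"
proof -
  have "mult_set {(0, \<zero>\<^bsub>R\<^esub>)}" unfolding mult_set_def using hpart_zero by simp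
  then have "smashing (tors_at {(0, \<zero>\<^bsub>R\<^esub>)})" by (rule smashing_tors_at)
  moreover have "X \<in> tors_at {(0, \<zero>\<^bsub>R\<^esub>)}" if "X \<in> obj T" for X
    unfolding tors_at_def using phi_zero[OF that, of 0] that by simp
  ultimately show ?thesis using tors_at_obj by (metis subsetI subset_antisym)
qed

text \<open>Built one element at a time with \<open>smashing_Int\<close>; degrees are kept with the
  elements because \<open>powers\<close> depends on them.\<close>

lemma smashing_Inter:
  assumes "finite B" "\<And>d r. (d, r) \<in> B \<Longrightarrow> r \<in> hpart R d"
  shows "smashing {X \<in> obj T. \<forall>(d, r)\<in>B. X \<in> tors_at (powers d r)}"
  using assms
proof (induction B rule: finite_induct)
  case (insert b B)
  obtain d r where b: "b = (d, r)" by (cases b)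
  let ?A = "{X \<in> obj T. \<forall>(d, r)\<in>B. X \<in> tors_at (powers d r)}"
  have "smashing ?A" using insert by blast
  moreover have "smashing (tors_at (powers d r))" by (rule smashing_tors_at[OF mult_powers]) (use insert.prems b in simp)
  ultimately have "smashing (tors_at (powers d r) \<inter> ?A)" using smashing_Int by blast
  moreover have "{X \<in> obj T. \<forall>(d, r)\<in>insert b B. X \<in> tors_at (powers d r)} = tors_at (powers d r) \<inter> ?A"
    using b by auto
  ultimately show ?case by simp
qed (use smashing_obj in simp)

lemma smashing_V:
  assumes p: "\<pp> \<in> Spec R" shows "smashing (torsion (V_closed R \<pp>))"
proof -
  obtain B where B: "finite B" "B \<subseteq> \<pp> \<inter> homogeneous R" "\<pp> = Idl\<^bsub>R\<^esub> B" using Spec_finite[OF noeth p] .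
  have "\<exists>d. b \<in> hpart R d" if "b \<in> B" for b using B(2) that unfolding homogeneous_def by blast
  then obtain deg where deg: "\<And>b. b \<in> B \<Longrightarrow> b \<in> hpart R (deg b)" by metis
  let ?B = "(\<lambda>b. (deg b, b)) ` B"
  have "torsion (V_closed R \<pp>) = {X \<in> obj T. \<forall>(d, r)\<in>?B. X \<in> tors_at (powers d r)}" (is "_ = ?A")
  proof
    have "X \<in> tors_at (powers (deg b) b)" if "X \<in> torsion (V_closed R \<pp>)" "b \<in> B" for X b
      by (rule torsion_V_powers[OF p that(1) deg[OF that(2)]]) (use B(2) that(2) in blast)
    then show "torsion (V_closed R \<pp>) \<subseteq> ?A" using torsion_iff by auto
    show "?A \<subseteq> torsion (V_closed R \<pp>)"
    proof
      fix X assume X: "X \<in> ?A"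
      have "X \<in> tors_at (outside \<qq>)" if q: "\<qq> \<in> Spec R - V_closed R \<pp>" for \<qq>
      proof -
        have q': "\<qq> \<in> Spec R" "\<not> \<pp> \<subseteq> \<qq>" using q by (auto simp: V_closed_def)
        \<comment> \<open>A prime not containing \<open>\<pp>\<close> misses one of the generators,
          and all powers of that generator lie outside it.\<close>
        have "\<not> B \<subseteq> \<qq>" using genideal_minimal[OF SpecD(1)[OF q'(1)], of B] q'(2) unfolding B(3)[symmetric] by blast
        then obtain b where b: "b \<in> B" "b \<notin> \<qq>" by blast
        have "powers (deg b) b \<subseteq> outside \<qq>"
          unfolding powers_def outside_def using hpart_pow[OF deg[OF b(1)]] power_not_in_Spec[OF q'(1) deg[OF b(1)] b(2)] by blast
        moreover have "X \<in> tors_at (powers (deg b) b)" using X b(1) by auto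
        ultimately show ?thesis using tors_at_mono by blast
      qed
      then show "X \<in> torsion (V_closed R \<pp>)" using X torsion_iff by blast
    qed
  qed
  then show ?thesis using smashing_Inter[of ?B] B(1) deg by auto
qed

section \<open>Local cohomology and the local-global principle\<close>

abbreviation \<Gamma>W where "\<Gamma>W \<equiv> Gamma_W \<kappa> T R \<phi>"
abbreviation LW where "LW \<equiv> L_W \<kappa> T R \<phi>"
abbreviation \<Gamma>p where "\<Gamma>p \<equiv> Gamma_p \<kappa> T R \<phi>"

section \<open>Local cohomology for a smashing torsion subcategory\<close>

context
  fixes W assumes W: "smashing (torsion W)"
begin

lemma localizing_W: "is_localizing (torsion W)" "is_localizing (orth (torsion W))"
  using W unfolding smashing_def by blast+

lemmas tri_W = localizing_triangulated[OF localizing_W(1)]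

text \<open>Smashing provides one localization triangle, so the choice operator in
  \<open>localization_triangle\<close> returns a genuine one.\<close>

lemma W_triangle:
  assumes X: "X \<in> obj T"
  obtains f g h where "triangle f g h (\<Gamma>W W X) X (LW W X)" "\<Gamma>W W X \<in> torsion W" "LW W X \<in> orth (torsion W)"
proof -
  obtain f g h G L where D: "triangle f g h G X L" "G \<in> torsion W" "L \<in> orth (torsion W)" using smashingE[OF W X] .
  have "is_localization_triangle \<kappa> T R \<phi> W X (f, g, h)"
    using D unfolding is_localization_triangle_def prod.case triangle_iff orth_def by blast
  then have "is_localization_triangle \<kappa> T R \<phi> W X (localization_triangle \<kappa> T R \<phi> W X)"
    unfolding localization_triangle_def by (rule someI)
  moreover obtain f' g' h' where t: "localization_triangle \<kappa> T R \<phi> W X = (f', g', h')" by (cases "localization_triangle \<kappa> T R \<phi> W X")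
  ultimately have L: "(f', g', h') \<in> tri T" "tgt T f' = X" "src T f' \<in> torsion W"
      "\<forall>Y\<in>torsion W. Mor T Y (tgt T g') = {azero T Y (tgt T g')}"
    unfolding is_localization_triangle_def by simp_all
  have D': "triangle f' g' h' (\<Gamma>W W X) X (LW W X)"
    unfolding Gamma_W_def L_W_def t using triangle_tri[OF L(1)] L(2) by simp
  have "\<Gamma>W W X \<in> torsion W" unfolding Gamma_W_def t using L(3) by simp
  moreover have "LW W X \<in> orth (torsion W)"
    using L(4) triangleD(6)[OF D'] unfolding orth_def L_W_def t by simp
  ultimately show ?thesis using that D' by blast
qed

text \<open>Links the arbitrarily chosen triangle to any convenient one; all further facts on
  \<open>\<Gamma>W\<close> and \<open>LW\<close> are transported through it.\<close>

lemma W_unique: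
  assumes "triangle f g h G X L" "G \<in> torsion W" "L \<in> orth (torsion W)"
  shows "isomorphic T G (\<Gamma>W W X)" "isomorphic T L (LW W X)"
proof -
  obtain f' g' h' where D: "triangle f' g' h' (\<Gamma>W W X) X (LW W X)" "\<Gamma>W W X \<in> torsion W" "LW W X \<in> orth (torsion W)"
    using W_triangle[OF triangleD(5)[OF assms(1)]] .
  show "isomorphic T G (\<Gamma>W W X)" "isomorphic T L (LW W X)" using triangle_orth_unique[OF tri_W assms D] by blast+
qed

lemma \<Gamma>W_Loc:
  assumes X: "X \<in> obj T" shows "\<Gamma>W W X \<in> Loc_of {X}" "LW W X \<in> Loc_of {X}"
proof -
  obtain f g h G L where D: "triangle f g h G X L" "G \<in> torsion W" "G \<in> Loc_of {X}" "L \<in> orth (torsion W)" using smashingE[OF W X] .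
  have t: "triangulated_subcat T (Loc_of {X})" using localizing_triangulated[OF Loc_localizing] X by simp
  have "L \<in> Loc_of {X}" by (rule tsub_cone[OF t D(1) D(3) Loc_self])
  then show "\<Gamma>W W X \<in> Loc_of {X}" "LW W X \<in> Loc_of {X}"
    using tsub_iso[OF t] W_unique[OF D(1,2,4)] D(3) by blast+
qed

text \<open>The preimage consists of the extensions of a local object by a torsion object of
  \<open>S\<close>, a description that involves no functor. Such a class is localizing because
  torsion objects do not map to local ones.\<close>

lemma \<Gamma>W_preimage:
  assumes S: "is_localizing S" shows "is_localizing {X \<in> obj T. \<Gamma>W W X \<in> S}"
proof -
  note tS = localizing_triangulated[OF S]
  have "{X \<in> obj T. \<Gamma>W W X \<in> S} = extensions (torsion W \<inter> S) (orth (torsion W))"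
  proof (intro subset_antisym subsetI)
    fix X assume "X \<in> {X \<in> obj T. \<Gamma>W W X \<in> S}"
    then have X: "X \<in> obj T" "\<Gamma>W W X \<in> S" by simp_all
    obtain f g h where D: "triangle f g h (\<Gamma>W W X) X (LW W X)" "\<Gamma>W W X \<in> torsion W" "LW W X \<in> orth (torsion W)"
      using W_triangle[OF X(1)] .
    show "X \<in> extensions (torsion W \<inter> S) (orth (torsion W))" by (rule extensionsI[OF D(1) IntI[OF D(2) X(2)] D(3)])
  next
    fix X assume "X \<in> extensions (torsion W \<inter> S) (orth (torsion W))"
    then obtain f g h G L where D: "triangle f g h G X L" "G \<in> torsion W \<inter> S" "L \<in> orth (torsion W)" by (rule extensionsE)
    have "isomorphic T G (\<Gamma>W W X)" by (rule W_unique[OF D(1) _ D(3)]) (use D(2) in blast)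
    then have "\<Gamma>W W X \<in> S" using tsub_iso[OF tS] D(2) by blast
    then show "X \<in> {X \<in> obj T. \<Gamma>W W X \<in> S}" using triangleD(5)[OF D(1)] by simp
  qed
  moreover have "is_localizing (extensions (torsion W \<inter> S) (orth (torsion W)))"
  proof (rule extensions_localizing[OF localizing_Int[OF localizing_W(1) S] localizing_W(2)])
    show "w = azero T G L" if "G \<in> torsion W \<inter> S" "L \<in> orth (torsion W)" "w \<in> Mor T G L" for G L w
      using orth_zero[OF that(2) _ that(3)] that(1) by blast
  qed
  ultimately show ?thesis by simp
qed

text \<open>The same with the condition \<open>S\<close> imposed on the local part of the
  extension.\<close>

lemma LW_preimage:
  assumes S: "is_localizing S" shows "is_localizing {X \<in> obj T. LW W X \<in> S}"
proof -
  note tS = localizing_triangulated[OF S]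
  have "{X \<in> obj T. LW W X \<in> S} = extensions (torsion W) (orth (torsion W) \<inter> S)"
  proof (intro subset_antisym subsetI)
    fix X assume "X \<in> {X \<in> obj T. LW W X \<in> S}"
    then have X: "X \<in> obj T" "LW W X \<in> S" by simp_all
    obtain f g h where D: "triangle f g h (\<Gamma>W W X) X (LW W X)" "\<Gamma>W W X \<in> torsion W" "LW W X \<in> orth (torsion W)"
      using W_triangle[OF X(1)] .
    show "X \<in> extensions (torsion W) (orth (torsion W) \<inter> S)" by (rule extensionsI[OF D(1,2) IntI[OF D(3) X(2)]])
  next
    fix X assume "X \<in> extensions (torsion W) (orth (torsion W) \<inter> S)"
    then obtain f g h G L where D: "triangle f g h G X L" "G \<in> torsion W" "L \<in> orth (torsion W) \<inter> S" by (rule extensionsE)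
    have "isomorphic T L (LW W X)" by (rule W_unique[OF D(1,2)]) (use D(3) in blast)
    then have "LW W X \<in> S" using tsub_iso[OF tS] D(3) by blast
    then show "X \<in> {X \<in> obj T. LW W X \<in> S}" using triangleD(5)[OF D(1)] by simp
  qed
  moreover have "is_localizing (extensions (torsion W) (orth (torsion W) \<inter> S))"
  proof (rule extensions_localizing[OF localizing_W(1) localizing_Int[OF localizing_W(2) S]])
    show "w = azero T G L" if "G \<in> torsion W" "L \<in> orth (torsion W) \<inter> S" "w \<in> Mor T G L" for G L w
      using orth_zero[OF _ that(1,3)] that(2) by blast
  qed
  ultimately show ?thesis by simp
qed

lemma \<Gamma>W_id: assumes X: "X \<in> torsion W" shows "isomorphic T X (\<Gamma>W W X)"
proof -
  obtain N where N: "is_zero_obj T N" "N \<in> obj T" by (rule zero_obtain)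
  have Xo: "X \<in> obj T" by (rule tsub_obj[OF tri_W X])
  have "N \<in> orth (torsion W)" by (rule tsub_zero[OF localizing_triangulated[OF localizing_W(2)] N(1)])
  then show ?thesis by (rule W_unique(1)[OF triangle_idt[OF Xo N(1)] X])
qed

lemma LW_id: assumes X: "X \<in> orth (torsion W)" shows "isomorphic T X (LW W X)"
proof -
  obtain N where N: "is_zero_obj T N" "N \<in> obj T" by (rule zero_obtain)
  have Xo: "X \<in> obj T" using X by (simp add: orth_def)
  have "N \<in> torsion W" by (rule tsub_zero[OF tri_W N(1)])
  then show ?thesis using W_unique(2)[OF triangle_idt'[OF Xo N(1)] _ X] by blast
qed

end

text \<open>Intrinsic form of the image of \<open>\<Gamma>p \<qq>\<close>, as
  \<open>Gamma_image_eq\<close> shows. Being an intersection of localizing subcategories, it is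
  visibly localizing.\<close>

definition local_at where
  "local_at \<qq> = torsion (V_closed R \<qq>) \<inter> orth (torsion (Z_set R \<qq>))"

context
  fixes \<pp> assumes p: "\<pp> \<in> Spec R"
begin

lemma local_at_localizing: "is_localizing (local_at \<pp>)"
  unfolding local_at_def by (rule localizing_Int[OF localizing_W(1)[OF smashing_V[OF p]] localizing_W(2)[OF smashing_Z[OF p]]])

lemma LZ_obj: "X \<in> obj T \<Longrightarrow> LW (Z_set R \<pp>) X \<in> obj T"
  using W_triangle[OF smashing_Z[OF p]] triangleD(6) by metis

lemma \<Gamma>p_preimage:
  assumes S: "is_localizing S" shows "is_localizing {X \<in> obj T. \<Gamma>p \<pp> X \<in> S}"
proof -
  have "{X \<in> obj T. \<Gamma>p \<pp> X \<in> S} = {X \<in> obj T. LW (Z_set R \<pp>) X \<in> {Y \<in> obj T. \<Gamma>W (V_closed R \<pp>) Y \<in> S}}"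
    unfolding Gamma_p_def using LZ_obj by blast
  then show ?thesis using LW_preimage[OF smashing_Z[OF p] \<Gamma>W_preimage[OF smashing_V[OF p] S]] by simp
qed

lemma \<Gamma>p_Loc: assumes X: "X \<in> obj T" shows "\<Gamma>p \<pp> X \<in> Loc_of {X}"
proof -
  have "\<Gamma>p \<pp> X \<in> Loc_of {LW (Z_set R \<pp>) X}" unfolding Gamma_p_def by (rule \<Gamma>W_Loc(1)[OF smashing_V[OF p] LZ_obj[OF X]])
  moreover have "Loc_of {LW (Z_set R \<pp>) X} \<subseteq> Loc_of {X}"
    by (rule Loc_min[OF Loc_localizing]) (use X \<Gamma>W_Loc(2)[OF smashing_Z[OF p] X] in simp_all)
  ultimately show ?thesis by blast
qed

text \<open>Applying \<open>\<Gamma>W\<close> for \<open>\<V>(\<pp>)\<close> stays inside the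
  localizing subcategory generated by its argument, so it does not leave the
  \<open>\<Z>(\<pp>)\<close>-local objects.\<close>

lemma \<Gamma>p_local: assumes X: "X \<in> obj T" shows "\<Gamma>p \<pp> X \<in> local_at \<pp>"
proof -
  obtain f g h where "LW (Z_set R \<pp>) X \<in> orth (torsion (Z_set R \<pp>))" using W_triangle[OF smashing_Z[OF p] X] .
  then have "Loc_of {LW (Z_set R \<pp>) X} \<subseteq> orth (torsion (Z_set R \<pp>))"
    by (intro Loc_min[OF localizing_W(2)[OF smashing_Z[OF p]]]) simp
  moreover have "\<Gamma>p \<pp> X \<in> Loc_of {LW (Z_set R \<pp>) X}" unfolding Gamma_p_def by (rule \<Gamma>W_Loc(1)[OF smashing_V[OF p] LZ_obj[OF X]])
  moreover obtain f' g' h' where "\<Gamma>W (V_closed R \<pp>) (LW (Z_set R \<pp>) X) \<in> torsion (V_closed R \<pp>)"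
    using W_triangle[OF smashing_V[OF p] LZ_obj[OF X]] .
  ultimately show ?thesis unfolding local_at_def by (auto simp: Gamma_p_def)
qed

lemma \<Gamma>p_id: assumes X: "X \<in> local_at \<pp>" shows "isomorphic T X (\<Gamma>p \<pp> X)"
proof -
  have X': "X \<in> torsion (V_closed R \<pp>)" "X \<in> orth (torsion (Z_set R \<pp>))" using X unfolding local_at_def by blast+
  have 1: "isomorphic T X (LW (Z_set R \<pp>) X)" by (rule LW_id[OF smashing_Z[OF p] X'(2)])
  then have "LW (Z_set R \<pp>) X \<in> torsion (V_closed R \<pp>)" by (rule tsub_iso[OF tri_W[OF smashing_V[OF p]] X'(1)])
  from \<Gamma>W_id[OF smashing_V[OF p] this] show ?thesis unfolding Gamma_p_def by (rule isomorphic_trans[OF 1])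
qed

lemma Gamma_image_eq: "Gamma_image \<kappa> T R \<phi> \<pp> = local_at \<pp>"
proof (intro subset_antisym subsetI)
  fix Y assume "Y \<in> Gamma_image \<kappa> T R \<phi> \<pp>"
  then obtain X where "X \<in> obj T" "isomorphic T (\<Gamma>p \<pp> X) Y" unfolding Gamma_image_def by blast
  then show "Y \<in> local_at \<pp>" using tsub_iso[OF localizing_triangulated[OF local_at_localizing] \<Gamma>p_local] by blast
next
  fix Y assume Y: "Y \<in> local_at \<pp>"
  then have "Y \<in> obj T" by (rule tsub_obj[OF localizing_triangulated[OF local_at_localizing]])
  then show "Y \<in> Gamma_image \<kappa> T R \<phi> \<pp>" using isomorphic_sym[OF \<Gamma>p_id[OF Y]] unfolding Gamma_image_def by blast
qed

end

text \<open>Since \<open>\<qq>\<close> lies outside \<open>\<V>(\<pp>)\<close>, an object local at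
  \<open>\<pp>\<close> is torsion at \<open>\<qq>\<close>, that is,
  \<open>\<Z>(\<qq>)\<close>-torsion. Being also orthogonal to such objects, it has zero
  identity.\<close>

lemma local_at_disjoint_aux:
  assumes p: "\<pp> \<in> Spec R" and q: "\<qq> \<in> Spec R" and pq: "\<not> \<pp> \<subseteq> \<qq>"
    and X: "X \<in> local_at \<pp>" "X \<in> local_at \<qq>"
  shows "is_zero_obj T X"
proof -
  have "\<qq> \<in> Spec R - V_closed R \<pp>" using q pq by (simp add: V_closed_def)
  moreover have "\<forall>\<qq>\<in>Spec R - V_closed R \<pp>. X \<in> tors_at (outside \<qq>)"
    using X(1) unfolding local_at_def Int_iff torsion_iff by simp
  ultimately have "X \<in> tors_at (outside \<qq>)" by simp
  then have Z: "X \<in> torsion (Z_set R \<qq>)" using torsion_Z[OF q] by simp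
  have O: "X \<in> orth (torsion (Z_set R \<qq>))" using X(2) unfolding local_at_def by simp
  then have Xo: "X \<in> obj T" by (simp add: orth_def)
  have "idt T X = azero T X X" by (rule orth_zero[OF O Z idt_mor[OF Xo]])
  then show ?thesis using Xo by (simp add: is_zero_obj_iff)
qed

lemma local_at_disjoint:
  assumes "\<pp> \<in> Spec R" "\<qq> \<in> Spec R" "\<pp> \<noteq> \<qq>" "X \<in> local_at \<pp>" "X \<in> local_at \<qq>"
  shows "is_zero_obj T X"
proof (cases "\<pp> \<subseteq> \<qq>")
  case True
  then have "\<not> \<qq> \<subseteq> \<pp>" using assms(3) by blast
  then show ?thesis by (rule local_at_disjoint_aux[OF assms(2,1) _ assms(5,4)])
next
  case False
  then show ?thesis by (rule local_at_disjoint_aux[OF assms(1,2) _ assms(4,5)])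
qed

section \<open>Support and the maps between localizing subcategories and families\<close>

abbreviation \<V> where "\<V> \<equiv> supp_cat \<kappa> T R \<phi>"

lemma \<V>_Spec: "\<pp> \<in> \<V> \<Longrightarrow> \<pp> \<in> Spec R"
  unfolding supp_cat_def supp_def by blast

lemma \<Gamma>p_zero: "\<pp> \<in> Spec R \<Longrightarrow> \<pp> \<notin> \<V> \<Longrightarrow> X \<in> obj T \<Longrightarrow> is_zero_obj T (\<Gamma>p \<pp> X)"
  unfolding supp_cat_def supp_def by blast

abbreviation \<sigma> where "\<sigma> \<equiv> sigma_map \<kappa> T R \<phi>"
abbreviation \<tau> where "\<tau> \<equiv> tau_map \<kappa> T R \<phi>"
abbreviation families where "families \<equiv> localizing_families \<kappa> T R \<phi>"

lemma \<sigma>_apply: "\<pp> \<in> \<V> \<Longrightarrow> \<sigma> S \<pp> = S \<inter> local_at \<pp>"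
  unfolding sigma_map_def using Gamma_image_eq[OF \<V>_Spec] by simp

lemma \<sigma>_families: assumes S: "is_localizing S" shows "\<sigma> S \<in> families"
  unfolding localizing_families_def
proof (rule PiE_I)
  show "\<sigma> S \<pp> \<in> {S. is_localizing S \<and> S \<subseteq> Gamma_image \<kappa> T R \<phi> \<pp>}" if "\<pp> \<in> \<V>" for \<pp>
    using localizing_Int[OF S local_at_localizing[OF \<V>_Spec[OF that]]] \<sigma>_apply[OF that] Gamma_image_eq[OF \<V>_Spec[OF that]] by simp
  show "\<sigma> S \<pp> = undefined" if "\<pp> \<notin> \<V>" for \<pp> using that by (simp add: sigma_map_def)
qed

lemma familiesD:
  assumes "F \<in> families" "\<pp> \<in> \<V>" shows "is_localizing (F \<pp>)" "F \<pp> \<subseteq> local_at \<pp>"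
  using PiE_mem[OF assms(1)[unfolded localizing_families_def] assms(2)]
  unfolding mem_Collect_eq Gamma_image_eq[OF \<V>_Spec[OF assms(2)]] by (rule conjunct1, rule conjunct2)

lemma families_obj: "F \<in> families \<Longrightarrow> (\<Union>\<pp>\<in>\<V>. F \<pp>) \<subseteq> obj T"
  by (rule UN_least, rule subsetI) (rule tsub_obj[OF localizing_triangulated[OF familiesD(1)]])

lemma \<tau>_localizing: "F \<in> families \<Longrightarrow> is_localizing (\<tau> F)"
  unfolding tau_map_def by (rule Loc_localizing[OF families_obj])

text \<open>Every \<open>\<Gamma>p \<pp> X\<close> with \<open>X \<in> S\<close> lies in
  \<open>S\<close> and is local at \<open>\<pp>\<close>, so it belongs to
  \<open>\<tau> (\<sigma> S)\<close>. The local-global principle rebuilds \<open>X\<close> from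
  these objects.\<close>

lemma \<tau>\<sigma>:
  assumes lgp: "local_global_principle \<kappa> T R \<phi>" and S: "is_localizing S" shows "\<tau> (\<sigma> S) = S"
proof
  note tS = localizing_triangulated[OF S]
  show "\<tau> (\<sigma> S) \<subseteq> S" unfolding tau_map_def by (rule Loc_min[OF S], rule UN_least) (simp add: \<sigma>_apply)
  have lt: "is_localizing (\<tau> (\<sigma> S))" by (rule \<tau>_localizing[OF \<sigma>_families[OF S]])
  show "S \<subseteq> \<tau> (\<sigma> S)"
  proof
    fix X assume X: "X \<in> S"
    then have Xo: "X \<in> obj T" by (rule tsub_obj[OF tS])
    have "\<Gamma>p \<pp> X \<in> \<tau> (\<sigma> S)" if p: "\<pp> \<in> Spec R" for \<pp>
    proof (cases "\<pp> \<in> \<V>")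
      case True
      have "Loc_of {X} \<subseteq> S" by (rule Loc_min[OF S]) (use X in simp)
      then have "\<Gamma>p \<pp> X \<in> S \<inter> local_at \<pp>" by (intro IntI \<Gamma>p_local[OF p Xo] subsetD[OF _ \<Gamma>p_Loc[OF p Xo]])
      then have "\<Gamma>p \<pp> X \<in> \<sigma> S \<pp>" unfolding \<sigma>_apply[OF True] .
      then have "\<Gamma>p \<pp> X \<in> (\<Union>\<pp>\<in>\<V>. \<sigma> S \<pp>)" by (rule UN_I[OF True])
      then show ?thesis unfolding tau_map_def by (rule subsetD[OF Loc_incl])
    next
      case False
      \<comment> \<open>The principle ranges over all primes, the families only over the support;
        the remaining primes contribute zero objects.\<close>
      show ?thesis by (rule tsub_zero[OF localizing_triangulated[OF lt] \<Gamma>p_zero[OF p False Xo]])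
    qed
    then have "Loc_of ((\<lambda>\<pp>. \<Gamma>p \<pp> X) ` Spec R) \<subseteq> \<tau> (\<sigma> S)" by (intro Loc_min[OF lt]) blast
    moreover have "X \<in> Loc_of ((\<lambda>\<pp>. \<Gamma>p \<pp> X) ` Spec R)"
      using lgp Xo Loc_self[of X] unfolding local_global_principle_def by blast
    ultimately show "X \<in> \<tau> (\<sigma> S)" by blast
  qed
qed

lemma \<sigma>\<tau>:
  assumes F: "F \<in> families" shows "\<sigma> (\<tau> F) = F"
proof
  fix \<pp>
  show "\<sigma> (\<tau> F) \<pp> = F \<pp>"
  proof (cases "\<pp> \<in> \<V>")
    case True
    note p = \<V>_Spec[OF True] and Fp = familiesD[OF F True]
    note tF = localizing_triangulated[OF Fp(1)]
    have "F \<pp> \<subseteq> \<tau> F" unfolding tau_map_def using True Loc_incl by blast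
    moreover have "X \<in> F \<pp>" if X: "X \<in> \<tau> F" "X \<in> local_at \<pp>" for X
    proof -
      \<comment> \<open>\<open>?P\<close> is localizing and contains every \<open>F \<qq>\<close>,
        hence all of \<open>\<tau> F\<close>. So \<open>\<Gamma>p \<pp>\<close> carries
        \<open>\<tau> F\<close> into \<open>F \<pp>\<close>, while on \<open>local_at \<pp>\<close>
        it is the identity up to isomorphism.\<close>
      let ?P = "{X \<in> obj T. \<Gamma>p \<pp> X \<in> F \<pp>}"
      have "Y \<in> ?P" if q: "\<qq> \<in> \<V>" and Y: "Y \<in> F \<qq>" for \<qq> Y
      proof -
        have Yo: "Y \<in> obj T" and Yl: "Y \<in> local_at \<qq>" using familiesD[OF F q] Y tsub_obj[OF localizing_triangulated] by blast+
        have "\<Gamma>p \<pp> Y \<in> F \<pp>"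
        proof (cases "\<qq> = \<pp>")
          case True
          then show ?thesis using tsub_iso[OF tF _ \<Gamma>p_id[OF p]] Y Yl by blast
        next
          case False
          \<comment> \<open>\<open>\<Gamma>p \<pp> Y\<close> is local at both primes: at
            \<open>\<qq>\<close> as a member of \<open>Loc_of {Y}\<close>, at \<open>\<pp>\<close>
            by construction. Hence it is zero.\<close>
          have "Loc_of {Y} \<subseteq> local_at \<qq>" by (rule Loc_min[OF local_at_localizing[OF \<V>_Spec[OF q]]]) (use Yl in simp)
          then have "is_zero_obj T (\<Gamma>p \<pp> Y)"
            using local_at_disjoint[OF \<V>_Spec[OF q] p False] \<Gamma>p_Loc[OF p Yo] \<Gamma>p_local[OF p Yo] by blast
          then show ?thesis by (rule tsub_zero[OF tF])
        qed
        then show ?thesis using Yo by simp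
      qed
      then have "\<tau> F \<subseteq> ?P" unfolding tau_map_def by (intro Loc_min[OF \<Gamma>p_preimage[OF p Fp(1)]]) blast
      then have "\<Gamma>p \<pp> X \<in> F \<pp>" using X(1) by blast
      then show ?thesis using tsub_iso[OF tF _ isomorphic_sym[OF \<Gamma>p_id[OF p X(2)]]] by blast
    qed
    ultimately show ?thesis unfolding \<sigma>_apply[OF True] using Fp(2) by blast
  next
    case False
    then show ?thesis using F unfolding localizing_families_def sigma_map_def by (auto simp: PiE_def extensional_def)
  qed
qed

text \<open>The two localizing subcategories of the principle are shown to have the same pieces at
  every prime of the support, so injectivity identifies them.\<close>

lemma inj_imp_lgp:
  assumes inj: "inj_on \<sigma> (localizing_subcats \<kappa> T)" shows "local_global_principle \<kappa> T R \<phi>"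
  unfolding local_global_principle_def
proof
  fix X assume X: "X \<in> obj T"
  let ?S = "Loc_of {X}" and ?S' = "Loc_of ((\<lambda>\<pp>. \<Gamma>p \<pp> X) ` Spec R)"
  have S: "is_localizing ?S" by (rule Loc_localizing) (use X in simp)
  note tS = localizing_triangulated[OF S]
  have \<Gamma>S: "(\<lambda>\<pp>. \<Gamma>p \<pp> X) ` Spec R \<subseteq> ?S" by (rule image_subsetI) (rule \<Gamma>p_Loc[OF _ X])
  have "?S \<subseteq> obj T" by (rule subsetI) (rule tsub_obj[OF tS])
  with \<Gamma>S have S': "is_localizing ?S'" by (intro Loc_localizing) (rule subset_trans)
  have sub: "?S' \<subseteq> ?S" by (rule Loc_min[OF S \<Gamma>S])
  have "\<sigma> ?S = \<sigma> ?S'"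
  proof
    fix \<pp>
    show "\<sigma> ?S \<pp> = \<sigma> ?S' \<pp>"
    proof (cases "\<pp> \<in> \<V>")
      case True
      note p = \<V>_Spec[OF True]
      have "Y \<in> ?S'" if Y: "Y \<in> ?S" "Y \<in> local_at \<pp>" for Y
      proof -
        have "\<Gamma>p \<pp> X \<in> ?S'" by (rule subsetD[OF Loc_incl imageI[OF p]])
        \<comment> \<open>The preimage of \<open>?S'\<close> under \<open>\<Gamma>p \<pp>\<close> is
          localizing and contains \<open>X\<close>, hence all of \<open>?S\<close>; an object
          \<open>Y\<close> of \<open>?S\<close> local at \<open>\<pp>\<close> is isomorphic to
          \<open>\<Gamma>p \<pp> Y\<close>.\<close>
        then have "?S \<subseteq> {Y \<in> obj T. \<Gamma>p \<pp> Y \<in> ?S'}"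
          by (intro Loc_min[OF \<Gamma>p_preimage[OF p S']]) (use X in simp)
        then have "\<Gamma>p \<pp> Y \<in> ?S'" using Y(1) by blast
        then show ?thesis by (rule tsub_iso[OF localizing_triangulated[OF S'] _ isomorphic_sym[OF \<Gamma>p_id[OF p Y(2)]]])
      qed
      then have "?S \<inter> local_at \<pp> = ?S' \<inter> local_at \<pp>" using sub by blast
      then show ?thesis unfolding \<sigma>_apply[OF True] .
    qed (simp add: sigma_map_def)
  qed
  then show "?S = ?S'" by (rule inj_onD[OF inj]) (simp_all add: localizing_subcats_def S S')
qed

lemma lgp_iff:
  shows "(local_global_principle \<kappa> T R \<phi> \<longleftrightarrow>
            bij_betw \<sigma> (localizing_subcats \<kappa> T) families \<and>
            (\<forall>S\<in>localizing_subcats \<kappa> T. \<tau> (\<sigma> S) = S) \<and> (\<forall>F\<in>families. \<sigma> (\<tau> F) = F)) \<and>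
         (local_global_principle \<kappa> T R \<phi> \<longleftrightarrow> inj_on \<sigma> (localizing_subcats \<kappa> T))"
proof -
  have 12: "bij_betw \<sigma> (localizing_subcats \<kappa> T) families \<and>
            (\<forall>S\<in>localizing_subcats \<kappa> T. \<tau> (\<sigma> S) = S) \<and> (\<forall>F\<in>families. \<sigma> (\<tau> F) = F)"
    if lgp: "local_global_principle \<kappa> T R \<phi>"
  proof (intro conjI ballI)
    show ts: "\<tau> (\<sigma> S) = S" if "S \<in> localizing_subcats \<kappa> T" for S
      using \<tau>\<sigma>[OF lgp] that by (simp add: localizing_subcats_def)
    show st: "\<sigma> (\<tau> F) = F" if "F \<in> families" for F by (rule \<sigma>\<tau>[OF that])
    show "bij_betw \<sigma> (localizing_subcats \<kappa> T) families"
      by (rule bij_betw_byWitness[of _ \<tau>])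
        (use ts st \<sigma>_families \<tau>_localizing in \<open>auto simp: localizing_subcats_def\<close>)
  qed
  have 23: "inj_on \<sigma> (localizing_subcats \<kappa> T)" if "bij_betw \<sigma> (localizing_subcats \<kappa> T) families"
    using that by (rule bij_betw_imp_inj_on)
  show ?thesis using 12 23 inj_imp_lgp by blast
qed

end

theorem proposition3p6:
  fixes \<kappa> :: "'i rel"
    and T :: "('o, 'a) tricat"
    and R :: "'r graded_ring"
    and \<phi> :: "int \<Rightarrow> 'r \<Rightarrow> 'o \<Rightarrow> 'a"
  assumes "graded_commutative_ring R" and "noetherian_ring R" and "|carrier R| <o \<kappa>"
    and "compactly_generated_cat \<kappa> T"
    and "linear_structure T R \<phi>"
  shows "(local_global_principle \<kappa> T R \<phi> \<longleftrightarrow>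
            bij_betw (sigma_map \<kappa> T R \<phi>) (localizing_subcats \<kappa> T) (localizing_families \<kappa> T R \<phi>) \<and>
            (\<forall>S\<in>localizing_subcats \<kappa> T. tau_map \<kappa> T R \<phi> (sigma_map \<kappa> T R \<phi> S) = S) \<and>
            (\<forall>F\<in>localizing_families \<kappa> T R \<phi>. sigma_map \<kappa> T R \<phi> (tau_map \<kappa> T R \<phi> F) = F)) \<and>
         (local_global_principle \<kappa> T R \<phi> \<longleftrightarrow>
            inj_on (sigma_map \<kappa> T R \<phi>) (localizing_subcats \<kappa> T))"
proof -
  interpret noetherian_linear_cat \<kappa> T R \<phi>
    by (intro noetherian_linear_cat.intro noetherian_linear_cat_axioms.intro assms)
  show ?thesis by (rule lgp_iff)
qed

end
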